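(* Let $d\ge 3$ be an integer. Then: (1) If there exists a finite projective plane of order $d-1$, then $\mathbf{gap}(\mathcal{G}_{=d})=\mathbf{gap}(\mathcal{G}_{\ge d})=\frac{\sqrt{d-1}}{d}$, and the set of graphs $G\in\mathcal{G}_{\ge d}$ with $\mathrm{gap}(G)=\mathbf{gap}(\mathcal{G}_{\ge d})$ coincides with the set of graphs $G\in\mathcal{G}_{=d}$ with $\mathrm{gap}(G)=\mathbf{gap}(\mathcal{G}_{=d})$, and both equal the set of incidence graphs of projective planes of order $d-1$. (2) For every $G\in\mathcal{G}_{=d}$ that is not the incidence graph of a projective plane of order $d-1$, $\mathrm{gap}(G)\le\frac{\sqrt{d-2}}{d}$. If moreover there exists no finite projective plane of order $d-1$, then $\mathrm{gap}(G)<\frac{\sqrt{d-1}}{d}$ for every $G\in\mathcal{G}_{\ge d}$, and $\mathbf{gap}(\mathcal{G}_{=d})\le\frac{\sqrt{d-2}}{d}$.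
   Context: $\mathcal{G}$ is the set of connected finite simple graphs with at least $3$ vertices; $\mathcal{G}_{\ge d}$ (resp. $\mathcal{G}_{=d}$) is the set of $G\in\mathcal{G}$ with all degrees $\ge d$ (resp. all degrees $=d$). For $G$ with adjacency matrix $\mathbf{A}$ and diagonal degree matrix $\mathbf{D}$, the normalized Laplacian is $\mathbf{L}=\mathbf{I}-\mathbf{D}^{-1}\mathbf{A}$ and $\mathrm{gap}(G):=\min_{\lambda\in\sigma(\mathbf{L})}|\lambda-1|$. For a family $\mathcal{G}'\subset\mathcal{G}$, $\mathbf{gap}(\mathcal{G}'):=\sup_{G\in\mathcal{G}'}\mathrm{gap}(G)$. A finite projective plane of order $n\ge 2$ is an incidence structure of a finite set of points and a finite set of lines such that every two distinct points lie on a unique common line, every two distinct lines share a unique common point, there exist four points no three collinear, and some line contains exactly $n+1$ points; its incidence graph is the bipartite graph on points $\sqcup$ lines with a point adjacent to a line iff they are incident. *)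

theory Defs
  imports
    Complex_Main
    "HOL-Library.Countable_Set"
    "HOL-Library.Infinite_Typeclass"
    "Graph_Theory.Pair_Digraph"
    "Graph_Theory.Digraph_Component"
    "Graph_Theory.Digraph_Isomorphism"
    "Jordan_Normal_Form.Spectral_Radius"
begin

text \<open>
  A finite simple graph is a \<^locale>\<open>pair_graph\<close>: every edge is stored as the two arcs
  (u, v) and (v, u), so the degree of a vertex is its out-degree. The qualifier below
  selects graph connectedness rather than topological connectedness.
\<close>

definition graphs :: "'a pair_pre_digraph set" where
  "graphs = {G. pair_graph G \<and> Digraph_Component.connected (with_proj G) \<and> card (pverts G) \<ge> 3}"

definition graphs_ge :: "nat \<Rightarrow> 'a pair_pre_digraph set" where
  "graphs_ge d = {G \<in> graphs. \<forall>v \<in> pverts G. out_degree (with_proj G) v \<ge> d}"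

definition graphs_eq :: "nat \<Rightarrow> 'a pair_pre_digraph set" where
  "graphs_eq d = {G \<in> graphs. \<forall>v \<in> pverts G. out_degree (with_proj G) v = d}"

text \<open>
  Matrices are indexed by {0..<n}, so the n vertices are enumerated by
  \<^term>\<open>from_nat_into (pverts G)\<close>; another enumeration gives a matrix similar by a
  permutation, with the same spectrum.
\<close>

definition adjacency_mat :: "'a pair_pre_digraph \<Rightarrow> complex mat" where
  "adjacency_mat G = (let n = card (pverts G); v = from_nat_into (pverts G) in
     mat n n (\<lambda>(i, j). if (v i, v j) \<in> parcs G then 1 else 0))"

text \<open>The inverse of the diagonal degree matrix; degrees are nonzero for all graphs considered.\<close>

definition degree_mat_inv :: "'a pair_pre_digraph \<Rightarrow> complex mat" where
  "degree_mat_inv G = mat_diag (card (pverts G))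
     (\<lambda>i. inverse (of_nat (out_degree (with_proj G) (from_nat_into (pverts G) i))))"

definition normalized_laplacian :: "'a pair_pre_digraph \<Rightarrow> complex mat" where
  "normalized_laplacian G = 1\<^sub>m (card (pverts G)) - degree_mat_inv G * adjacency_mat G"

definition gap :: "'a pair_pre_digraph \<Rightarrow> real" where
  "gap G = Min ((\<lambda>l. cmod (l - 1)) ` spectrum (normalized_laplacian G))"

definition family_gap :: "'a pair_pre_digraph set \<Rightarrow> real" where
  "family_gap \<F> = (SUP G \<in> \<F>. gap G)"

definition projective_plane :: "nat \<Rightarrow> 'p set \<Rightarrow> 'l set \<Rightarrow> ('p \<Rightarrow> 'l \<Rightarrow> bool) \<Rightarrow> bool" where
  "projective_plane n P L I \<longleftrightarrow>
     n \<ge> 2 \<and> finite P \<and> finite L \<and>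
     (\<forall>p \<in> P. \<forall>q \<in> P. p \<noteq> q \<longrightarrow> (\<exists>!l. l \<in> L \<and> I p l \<and> I q l)) \<and>
     (\<forall>l \<in> L. \<forall>m \<in> L. l \<noteq> m \<longrightarrow> (\<exists>!p. p \<in> P \<and> I p l \<and> I p m)) \<and>
     (\<exists>Q \<subseteq> P. card Q = 4 \<and>
        (\<forall>T \<subseteq> Q. card T = 3 \<longrightarrow> \<not> (\<exists>l \<in> L. \<forall>p \<in> T. I p l))) \<and>
     (\<exists>l \<in> L. card {p \<in> P. I p l} = n + 1)"

definition incidence_graph :: "'p set \<Rightarrow> 'l set \<Rightarrow> ('p \<Rightarrow> 'l \<Rightarrow> bool) \<Rightarrow> ('p + 'l) pair_pre_digraph" where
  "incidence_graph P L I = \<lparr> pverts = P <+> L,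
     parcs = {(Inl p, Inr l) | p l. p \<in> P \<and> l \<in> L \<and> I p l} \<union>
             {(Inr l, Inl p) | p l. p \<in> P \<and> l \<in> L \<and> I p l} \<rparr>"

text \<open>
  Every finite projective plane has an isomorphic copy whose points and lines are natural
  numbers, so quantifying over those loses nothing. Being an incidence graph is understood
  up to graph isomorphism.
\<close>

definition projective_plane_exists :: "nat \<Rightarrow> bool" where
  "projective_plane_exists n \<longleftrightarrow>
     (\<exists>(P :: nat set) (L :: nat set) I. projective_plane n P L I)"

definition incidence_graphs :: "nat \<Rightarrow> 'a pair_pre_digraph set" where
  "incidence_graphs n = {G. \<exists>(P :: nat set) (L :: nat set) I. projective_plane n P L I \<and>
     digraph_iso (with_proj (incidence_graph P L I)) (with_proj G)}"

end

theory Submission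
  imports Defs "HOL-Analysis.Function_Topology"
begin

text \<open>
  Writing M for the random walk operator, gap(G)^2 is the least eigenvalue of M^2, that is, the
  minimum of the Rayleigh quotient sum_w (sum_{u ~ w} f(u))^2 / d_w over sum_v d_v f(v)^2.
  Test functions supported on two vertices with a common neighbour bound it by (d - 1) / d^2,
  and show that a graph of minimum degree at least d attaining this bound is d-regular.

  Let G be d-regular with gap(G)^2 > (d - 2) / d^2. Two vertices then have at most one common
  neighbour, so the neighbourhoods are the lines of a partial linear space on the vertices, with
  collinearity graph B, and A^2 = d I + B. Hence B + 2 I is positive definite, i.e. B is
  the Gram graph of linearly independent roots of norm 2. A claw or a diamond (K4 minus an edge) in B spans a
  root system of type D4; the remaining vertices fall into the three nontrivial cosets of its
  weight lattice, and at least five of them only fit if they lie in a single coset. As B is regular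
  of valency d (d - 1), this excludes claws, and a diamond yields a clique of size
  d (d - 1) / 2 + 1 that is closed under lines. Fisher's counting argument rules out every proper
  clique closed under lines: it has more points than lines, so some nonzero function on it
  vanishes on all its lines and violates positivity. It follows that a component of B is complete, and
  G is the incidence graph of a projective plane unless B is complete on all vertices. The last
  case is the regular case of the friendship theorem and is excluded by the trace of the Laplacian.
\<close>

section \<open>Positive definite forms\<close>

text \<open>The threshold \<open>(d - 2) / d^2\<close> is the value of the squared gap at which the
  least eigenvalue of B is -2, the classical border of root lattices. Their classification is
  replaced by a local argument. D4 is generated by four orthogonal roots together with half their
  sum, so every other vertex has four integer coordinates of even sum with respect to it. A vertex
  not orthogonal to D4 has exactly two nonzero coordinates, and its part orthogonal to D4 is a unit
  vector. Such parts are orthogonal within a coset and have inner product 1/2 or -1/2 across cosets,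
  which five of them cannot realize in mixed position. A single coset means that two of the roots
  are orthogonal to the same vertices; this yields twins, or fixes all adjacencies around a diamond.
  Strict positivity turns every explicit null vector into a contradiction. The number five is what
  the smallest case \<open>d = 3\<close> supplies, where B has valency 6; the same case needs an
  extra count for diamonds, because there a triangle can be a full line.\<close>

lemma abs_half_cases: "\<bar>x\<bar> = 1/2 \<Longrightarrow> x = 1/2 \<or> x = -1/2" for x :: real
  by linarith

lemma abs_half_square: "\<bar>x\<bar> = 1/2 \<Longrightarrow> x * x = 1/4" for x :: real
  by (drule abs_half_cases, elim disjE) (hypsubst, simp)+

lemma abs_half_mult: "\<bar>x\<bar> = 1/2 \<Longrightarrow> \<bar>y\<bar> = 1/2 \<Longrightarrow> x * y = 1/4 \<or> x * y = -1/4" for x y :: real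
  by (drule abs_half_cases, drule abs_half_cases, elim disjE) (hypsubst, simp)+

text \<open>Positivity is phrased through a value at one point of \<open>V\<close>, so that a
  combination is certified nonzero at a vertex where a single summand survives.\<close>

locale pos_form =
  fixes V :: "'a set" and b :: "('a \<Rightarrow> real) \<Rightarrow> ('a \<Rightarrow> real) \<Rightarrow> real"
  assumes form_add: "b (\<lambda>v. f v + g v) h = b f h + b g h"
    and form_scale: "b (\<lambda>v. c * f v) h = c * b f h"
    and form_sym: "b f g = b g f"
    and form_pos: "x \<in> V \<Longrightarrow> f x \<noteq> 0 \<Longrightarrow> b f f > 0"
begin

lemma form_diff: "b (\<lambda>v. f v - g v) h = b f h - b g h"
  using form_add[of f "\<lambda>v. (-1) * g v" h] form_scale[of "-1" g h] by simp

lemma form_add_right: "b h (\<lambda>v. f v + g v) = b h f + b h g"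
  by (metis form_add form_sym)

lemma form_diff_right: "b h (\<lambda>v. f v - g v) = b h f - b h g"
  by (metis form_diff form_sym)

lemma form_scale_right: "b h (\<lambda>v. c * f v) = c * b h f"
  by (metis form_scale form_sym)

lemmas form_simps = form_add form_diff form_scale form_add_right form_diff_right form_scale_right

lemma form_sum: "finite S \<Longrightarrow> b (\<lambda>v. \<Sum>i \<in> S. c i * q i v) h = (\<Sum>i \<in> S. c i * b (q i) h)"
proof (induction S rule: finite_induct)
  case empty
  show ?case using form_scale[of 0 "\<lambda>v. 0" h] by simp
qed (simp add: form_add form_scale)

lemma form_sum_right: "finite S \<Longrightarrow> b h (\<lambda>v. \<Sum>i \<in> S. c i * q i v) = (\<Sum>i \<in> S. c i * b h (q i))"
  using form_sum by (simp add: form_sym[of h])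

text \<open>For orthonormal \<open>q\<close> this is the component of \<open>f\<close> orthogonal to
  the span.\<close>

definition residual :: "'a set \<Rightarrow> ('a \<Rightarrow> 'a \<Rightarrow> real) \<Rightarrow> ('a \<Rightarrow> real) \<Rightarrow> 'a \<Rightarrow> real" where
  "residual S q f = (\<lambda>v. f v - (\<Sum>i \<in> S. b f (q i) * q i v))"

lemma residual_form:
  assumes S: "finite S" and on: "\<And>i j. i \<in> S \<Longrightarrow> j \<in> S \<Longrightarrow> b (q i) (q j) = (if i = j then 1 else 0)"
  shows "b (residual S q f) (residual S q g) = b f g - (\<Sum>i \<in> S. b f (q i) * b g (q i))"
proof -
  have "(\<Sum>i \<in> S. b f (q i) * (\<Sum>j \<in> S. b g (q j) * b (q i) (q j))) = (\<Sum>i \<in> S. b f (q i) * b g (q i))"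
    using S by (intro sum.cong refl) (simp add: on if_distrib[of "\<lambda>x. _ * x"] cong: if_cong)
  then show ?thesis
    unfolding residual_def form_diff form_diff_right form_sum[OF S] form_sum_right[OF S]
    by (simp add: form_sym[of _ g] mult.commute)
qed

text \<open>Abstract core of the D4 argument: \<open>p x\<close> stands for the part of a root
  orthogonal to D4 and \<open>k x\<close> for its coset. Projecting off vectors of one class costs
  the others 1/4 of squared norm each, while inner products stay multiples of 1/4; positivity leaves
  no room for this.\<close>

lemma half_system_one_class:
  fixes p :: "'a \<Rightarrow> 'a \<Rightarrow> real" and k :: "'a \<Rightarrow> nat"
  assumes T: "finite T" "T \<subseteq> V" "card T \<ge> 5"
    and kT: "\<And>x. x \<in> T \<Longrightarrow> k x < 3"
    and p: "\<And>x y. x \<in> T \<Longrightarrow> y \<in> T \<Longrightarrow> p x y = (if x = y then 1 else 0)"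
    and n: "\<And>x. x \<in> T \<Longrightarrow> b (p x) (p x) = 1"
    and same: "\<And>x y. x \<in> T \<Longrightarrow> y \<in> T \<Longrightarrow> x \<noteq> y \<Longrightarrow> k x = k y \<Longrightarrow> b (p x) (p y) = 0"
    and diff: "\<And>x y. x \<in> T \<Longrightarrow> y \<in> T \<Longrightarrow> k x \<noteq> k y \<Longrightarrow> \<bar>b (p x) (p y)\<bar> = 1/2"
    and xy: "x \<in> T" "y \<in> T"
  shows "k x = k y"
proof (rule ccontr)
  assume ne: "k x \<noteq> k y"
  define C where "C i = {z \<in> T. k z = i}" for i
  have finC: "finite (C i)" for i using T by (simp add: C_def)
  have TC: "T = C 0 \<union> C 1 \<union> C 2"
    proof (intro equalityI subsetI)
    fix z assume z: "z \<in> T"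
    then have "k z = 0 \<or> k z = 1 \<or> k z = 2" using kT[OF z] by linarith
    then show "z \<in> C 0 \<union> C 1 \<union> C 2" using z by (auto simp: C_def)
  qed (auto simp: C_def)
  have "card T = card (C 0) + card (C 1) + card (C 2)"
    unfolding TC using finC
    by (subst card_Un_disjoint; (subst card_Un_disjoint)?) (auto simp: C_def)
  with T have five: "card (C 0) + card (C 1) + card (C 2) \<ge> 5" by simp
  have ev: "residual S p (p y) y = 1" "z \<in> T \<Longrightarrow> y \<noteq> z \<Longrightarrow> residual S p (p z) y = 0"
    and norm: "b (residual S p (p y)) (residual S p (p y)) = 1 - card S / 4"
    and on: "x \<in> S \<Longrightarrow> x' \<in> S \<Longrightarrow> b (p x) (p x') = (if x = x' then 1 else 0)" and finS: "finite S"
    if S: "S \<subseteq> C i" and y: "y \<in> T" "k y \<noteq> i" for S i y z x x'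
  proof -
    show finS: "finite S" using S finC finite_subset by auto
    have ST: "x \<in> T" "k x = i" if "x \<in> S" for x using that S by (auto simp: C_def)
    have on: "b (p x) (p x') = (if x = x' then 1 else 0)" if "x \<in> S" "x' \<in> S" for x x'
      using ST[OF that(1)] ST[OF that(2)] n same by (cases "x = x'") simp_all
    then show "x \<in> S \<Longrightarrow> x' \<in> S \<Longrightarrow> b (p x) (p x') = (if x = x' then 1 else 0)" .
    have px: "p x y = 0" if "x \<in> S" for x using ST[OF that] p[of x y] y by auto
    then show "residual S p (p y) y = 1" "z \<in> T \<Longrightarrow> y \<noteq> z \<Longrightarrow> residual S p (p z) y = 0"
      using p y by (simp_all add: residual_def)
    have "(\<Sum>x \<in> S. b (p y) (p x) * b (p y) (p x)) = (\<Sum>x \<in> S. 1 / 4)"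
      using diff y ST by (intro sum.cong refl abs_half_square) auto
    then show "b (residual S p (p y)) (residual S p (p y)) = 1 - card S / 4"
      using y n by (simp add: residual_form[OF finS on])
  qed
  have single: "card S < 4" if S: "S \<subseteq> C i" and y: "y \<in> T" "k y \<noteq> i" for S i y
  proof -
    have "b (residual S p (p y)) (residual S p (p y)) > 0"
      using ev(1)[OF S y] y T by (intro form_pos[of y]) auto
    then show ?thesis using norm[OF S y] by simp
  qed
  \<comment> \<open>Strict Cauchy-Schwarz for two residuals of squared norm
    \<open>1 - card S / 4\<close>, tested on their difference and their sum.\<close>
  have pair: "\<bar>b (p y) (p z) - (\<Sum>x \<in> S. b (p y) (p x) * b (p z) (p x))\<bar> < 1 - card S / 4"
    if S: "S \<subseteq> C i" and y: "y \<in> T" "k y \<noteq> i" and z: "z \<in> T" "k z \<noteq> i" "y \<noteq> z" for S i y z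
  proof -
    define s where "s = b (p y) (p z) - (\<Sum>x \<in> S. b (p y) (p x) * b (p z) (p x))"
    have yz: "b (residual S p (p y)) (residual S p (p z)) = s"
      unfolding s_def by (rule residual_form[OF finS[OF S y] on[OF S y]])
    have "0 < 2 * (1 - card S / 4) - 2 * e * s" if e: "e * e = 1" for e :: real
    proof -
      define f where "f = (\<lambda>v. residual S p (p y) v - e * residual S p (p z) v)"
      have "b f f > 0" using ev[OF S y] y z T by (intro form_pos[of y]) (auto simp: f_def)
      moreover have "b f f = (1 - card S / 4) - 2 * e * s + (e * e) * (1 - card S / 4)"
        unfolding f_def form_diff form_diff_right form_scale form_scale_right
          norm[OF S y] norm[OF S z(1,2)] yz form_sym[of "residual S p (p z)" "residual S p (p y)"]
        by (simp add: mult.assoc)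
      ultimately show ?thesis by (simp add: e)
    qed
    from this[of 1] this[of "-1"] show ?thesis by (simp add: s_def[symmetric] abs_less_iff)
  qed
  have C4: "card (C i) < 4" for i
  proof -
    obtain z where "z \<in> T" "k z \<noteq> i" using ne xy by metis
    then show ?thesis using single[of "C i" i z] by simp
  qed
  \<comment> \<open>With three vectors removed the residuals have squared norm 1/4, but their inner
    product is an odd multiple of 1/4: it is 0 or half a sign, minus three signed quarters.\<close>
  have C3: "card (C i) < 3" for i
  proof (rule ccontr)
    assume "\<not> card (C i) < 3"
    then have "card (C i) = 3" using C4[of i] by simp
    then obtain q1 q2 q3 where q: "C i = {q1,q2,q3}" "q1 \<noteq> q2" "q1 \<noteq> q3" "q2 \<noteq> q3"
      by (auto simp: card_3_iff)
    have "card (T - C i) = card T - card (C i)"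
      by (rule card_Diff_subset) (use finC in \<open>auto simp: C_def\<close>)
    with T C4[of i] have "card (T - C i) \<ge> 2" by simp
    then obtain R where R: "R \<subseteq> T - C i" "card R = 2"
      by (meson obtain_subset_with_card_n)
    then obtain r z where r: "R = {r,z}" "r \<noteq> z" by (auto simp: card_2_iff)
    have rT: "r \<in> T" "k r \<noteq> i" "z \<in> T" "k z \<noteq> i" using R r by (auto simp: C_def)
    have qC: "q1 \<in> C i" "q2 \<in> C i" "q3 \<in> C i" using q(1) by auto
    have half: "\<bar>b (p t) (p x)\<bar> = 1/2" if "t \<in> T" "k t \<noteq> i" "x \<in> C i" for t x
      using that diff by (auto simp: C_def)
    have lt: "\<bar>b (p r) (p z) - (b (p r) (p q1) * b (p z) (p q1) + (b (p r) (p q2) * b (p z) (p q2) +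
      b (p r) (p q3) * b (p z) (p q3)))\<bar> < 1/4"
      using pair[OF subset_refl rT r(2)] unfolding q(1) using q(2-) by simp
    have prod: "b (p r) (p x) * b (p z) (p x) = 1/4 \<or> b (p r) (p x) * b (p z) (p x) = -1/4" if "x \<in> C i" for x
      using half[OF rT(1,2) that] half[OF rT(3,4) that] by (rule abs_half_mult)
    have "b (p r) (p z) = 0 \<or> b (p r) (p z) = 1/2 \<or> b (p r) (p z) = -1/2"
      using same[of r z] diff[of r z] rT r abs_half_cases by blast
    with prod[OF qC(1)] prod[OF qC(2)] prod[OF qC(3)] lt show False by (elim disjE) simp_all
  qed
  \<comment> \<open>Class sizes at most 2 with total at least 5 leave two full classes and a
    nonempty third.\<close>
  obtain i j l where ijl: "card (C i) \<ge> 2" "card (C j) \<ge> 2" "card (C l) \<ge> 1" "i \<noteq> j" "i \<noteq> l" "j \<noteq> l"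
  proof -
    have "card (C 0) \<le> 2" "card (C 1) \<le> 2" "card (C 2) \<le> 2"
      using C3[of 0] C3[of 1] C3[of 2] by auto
    with five have "card (C 0) \<ge> 2 \<and> card (C 1) \<ge> 2 \<and> card (C 2) \<ge> 1 \<or>
      card (C 0) \<ge> 2 \<and> card (C 2) \<ge> 2 \<and> card (C 1) \<ge> 1 \<or>
      card (C 1) \<ge> 2 \<and> card (C 2) \<ge> 2 \<and> card (C 0) \<ge> 1" by linarith
    then show ?thesis
      using that[of 0 1 2] that[of 0 2 1] that[of 1 2 0] by auto
  qed
  obtain P where "P \<subseteq> C i" "card P = 2" using ijl by (meson obtain_subset_with_card_n)
  then obtain p1 p2 where P: "p1 \<in> C i" "p2 \<in> C i" "p1 \<noteq> p2" by (auto simp: card_2_iff)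
  obtain Q where "Q \<subseteq> C j" "card Q = 2" using ijl by (meson obtain_subset_with_card_n)
  then obtain q1 q2 where Q: "q1 \<in> C j" "q2 \<in> C j" "q1 \<noteq> q2" by (auto simp: card_2_iff)
  obtain r where r: "r \<in> C l" using ijl by fastforce
  have mem: "p1 \<in> T" "p2 \<in> T" "q1 \<in> T" "q2 \<in> T" "r \<in> T"
    "k p1 = i" "k p2 = i" "k q1 = j" "k q2 = j" "k r = l"
    using P Q r by (auto simp: C_def)
  have lt: "\<bar>b (p x) (p z) - (b (p x) (p p1) * b (p z) (p p1) + b (p x) (p p2) * b (p z) (p p2))\<bar> < 1/2"
    if "x \<in> T" "k x \<noteq> i" "z \<in> T" "k z \<noteq> i" "x \<noteq> z" for x z
    using pair[of "{p1, p2}" i x z] that P by simp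
  have 1: "\<bar>b (p q1) (p q2) - (b (p q1) (p p1) * b (p q2) (p p1) + b (p q1) (p p2) * b (p q2) (p p2))\<bar> < 1/2"
    by (rule lt) (use mem Q ijl in auto)
  have 2: "\<bar>b (p r) (p q1) - (b (p r) (p p1) * b (p q1) (p p1) + b (p r) (p p2) * b (p q1) (p p2))\<bar> < 1/2"
    by (rule lt) (use mem Q ijl in auto)
  have 3: "\<bar>b (p r) (p q2) - (b (p r) (p p1) * b (p q2) (p p1) + b (p r) (p p2) * b (p q2) (p p2))\<bar> < 1/2"
    by (rule lt) (use mem Q ijl in auto)
  have h: "\<bar>b (p q1) (p p1)\<bar> = 1/2" "\<bar>b (p q1) (p p2)\<bar> = 1/2" "\<bar>b (p q2) (p p1)\<bar> = 1/2" "\<bar>b (p q2) (p p2)\<bar> = 1/2"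
    "\<bar>b (p r) (p p1)\<bar> = 1/2" "\<bar>b (p r) (p p2)\<bar> = 1/2" "\<bar>b (p r) (p q1)\<bar> = 1/2" "\<bar>b (p r) (p q2)\<bar> = 1/2"
    by (rule diff; use mem ijl in simp)+
  have o: "b (p q1) (p q2) = 0" using same mem Q by simp
  note prod = abs_half_mult[OF h(1) h(3)] abs_half_mult[OF h(2) h(4)] abs_half_mult[OF h(5) h(1)]
    abs_half_mult[OF h(6) h(2)] abs_half_mult[OF h(5) h(3)] abs_half_mult[OF h(6) h(4)]
  \<comment> \<open>Removing \<open>p1\<close> and \<open>p2\<close> leaves squared norms 1/2, so
    inner products of residuals stay below 1/2. Hence the two products for the orthogonal pair
    \<open>q1\<close>, \<open>q2\<close> cancel, while those for \<open>r\<close> against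
    \<open>q1\<close> and against \<open>q2\<close> agree. Together these relations make a nonzero
    number equal to its negative.\<close>
  have A: "b (p q1) (p p2) * b (p q2) (p p2) = - (b (p q1) (p p1) * b (p q2) (p p1))"
    using 1 prod(1,2) o by (elim disjE) simp_all
  have C: "b (p r) (p p2) * b (p q1) (p p2) = b (p r) (p p1) * b (p q1) (p p1)"
    using 2 prod(3,4) abs_half_cases[OF h(7)] by (elim disjE) simp_all
  have E: "b (p r) (p p2) * b (p q2) (p p2) = b (p r) (p p1) * b (p q2) (p p1)"
    using 3 prod(5,6) abs_half_cases[OF h(8)] by (elim disjE) simp_all
  have "(b (p r) (p p1) * b (p r) (p p1)) * (b (p q1) (p p1) * b (p q2) (p p1)) = (b (p r) (p p1) * b (p q1) (p p1)) * (b (p r) (p p1) * b (p q2) (p p1))"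
    by (simp add: ac_simps)
  also have "\<dots> = (b (p r) (p p2) * b (p q1) (p p2)) * (b (p r) (p p2) * b (p q2) (p p2))" unfolding C E by simp
  also have "\<dots> = (b (p r) (p p2) * b (p r) (p p2)) * (b (p q1) (p p2) * b (p q2) (p p2))" by (simp add: ac_simps)
  finally show False
    unfolding h(5,6)[THEN abs_half_square] A using prod(1) by auto
qed

end

section \<open>Root systems of type D4 in the form\<close>

definition delta :: "'a \<Rightarrow> 'a \<Rightarrow> real" where
  "delta x v = (if v = x then 1 else 0)"

text \<open>The bound 6 is \<open>d * (d - 1)\<close> at \<open>d = 3\<close>. It supplies the five
  vertices that the coset argument consumes, both for claws and for diamonds.\<close>

locale root_graph = pos_form V b for V :: "'a set" and b +
  fixes adj :: "'a \<Rightarrow> 'a \<Rightarrow> bool" and k :: nat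
  assumes finite_V: "finite V"
    and adj_sym: "adj x y \<Longrightarrow> adj y x"
    and adj_irrefl: "\<not> adj x x"
    and gram: "x \<in> V \<Longrightarrow> y \<in> V \<Longrightarrow>
      b (delta x) (delta y) = (if x = y then 2 else if adj x y then 1 else 0)"
    and valency: "x \<in> V \<Longrightarrow> card {y \<in> V. adj x y} = k"
    and valency_ge: "k \<ge> 6"
begin

lemma adj_commute: "adj x y \<longleftrightarrow> adj y x"
  using adj_sym by blast

text \<open>Alternating signs on an induced 4-cycle give a null vector: four norms 2 cancel against
  four edges counted twice.\<close>

lemma no_induced_C4:
  assumes V: "a \<in> V" "u \<in> V" "c \<in> V" "x \<in> V" and ne: "a \<noteq> c" "u \<noteq> x"
    and adj: "adj a u" "adj u c" "adj c x" "adj x a" and ac: "\<not> adj a c"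
  shows "adj u x"
proof (rule ccontr)
  assume ux: "\<not> adj u x"
  define f where "f = (\<lambda>v. delta a v - delta u v + delta c v - delta x v)"
  have ne': "a \<noteq> u" "u \<noteq> c" "c \<noteq> x" "x \<noteq> a"
    using adj adj_irrefl by metis+
  note adj' = adj adj[THEN adj_sym] ac ac[unfolded adj_commute[of a c]] ux ux[unfolded adj_commute[of u x]]
  have "b f f = 0"
    unfolding f_def form_simps using V ne ne' adj' by (simp add: gram)
  moreover have "b f f > 0"
    by (rule form_pos[of a]) (use V ne ne' in \<open>auto simp: f_def delta_def\<close>)
  ultimately show False by simp
qed

text \<open>A further common neighbour \<open>x\<close> closes a 4-cycle with \<open>u\<close>, so
  it is adjacent to \<open>u\<close>. Then \<open>u\<close> is adjacent to \<open>a\<close>,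
  \<open>a'\<close> and the \<open>k - 1\<close> other neighbours of \<open>a\<close>, one more than
  its valency.\<close>

lemma no_twins:
  assumes V: "a \<in> V" "a' \<in> V" "u \<in> V" and adj: "a \<noteq> a'" "\<not> adj a a'" "adj a u" "adj a' u"
    and twins: "\<And>x. x \<in> V \<Longrightarrow> x \<noteq> u \<Longrightarrow> adj a x \<longleftrightarrow> adj a' x"
  shows False
proof -
  let ?A = "{y \<in> V. adj a y} - {u}"
  have "insert a (insert a' ?A) \<subseteq> {y \<in> V. adj u y}"
  proof -
    have "adj u x" if x: "x \<in> V" "adj a x" "x \<noteq> u" for x
      by (rule no_induced_C4[of a u a' x]) (use V adj x twins adj_sym in auto)
    then show ?thesis using V adj adj_sym by auto
  qed
  then have "card (insert a (insert a' ?A)) \<le> card {y \<in> V. adj u y}"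
    by (intro card_mono) (use finite_V in auto)
  moreover have "card ?A = k - 1"
    using valency[OF V(1)] V adj finite_V by simp
  moreover have "card (insert a (insert a' ?A)) = card ?A + 2"
    using finite_V adj adj_irrefl by auto
  ultimately show False using valency[OF V(3)] valency_ge by simp
qed

end

text \<open>The half sum of the four roots is not named; \<open>frame_int\<close> records that
  vertices pair integrally with it, the coordinate sum being \<open>2 * m\<close>. The roots vanish
  outside \<open>S\<close>, so evaluation at a vertex outside \<open>S\<close> isolates its own
  \<open>delta\<close>.\<close>

locale d4_frame = root_graph +
  fixes S :: "'a set" and g1 g2 g3 g4 :: "'a \<Rightarrow> real"
  assumes frame_support: "v \<notin> S \<Longrightarrow> g1 v = 0" "v \<notin> S \<Longrightarrow> g2 v = 0" "v \<notin> S \<Longrightarrow> g3 v = 0" "v \<notin> S \<Longrightarrow> g4 v = 0"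
    and frame_norm: "b g1 g1 = 2" "b g2 g2 = 2" "b g3 g3 = 2" "b g4 g4 = 2"
    and frame_orth: "b g1 g2 = 0" "b g1 g3 = 0" "b g1 g4 = 0" "b g2 g3 = 0" "b g2 g4 = 0" "b g3 g4 = 0"
    and frame_int: "x \<in> V - S \<Longrightarrow> \<exists>(h1::int) (h2::int) (h3::int) (m::int). b (delta x) g1 = h1 \<and> b (delta x) g2 = h2 \<and>
      b (delta x) g3 = h3 \<and> b (delta x) g4 = 2 * m - h1 - h2 - h3"
begin

abbreviation co1 :: "'a \<Rightarrow> real" where "co1 x \<equiv> b (delta x) g1"
abbreviation co2 :: "'a \<Rightarrow> real" where "co2 x \<equiv> b (delta x) g2"
abbreviation co3 :: "'a \<Rightarrow> real" where "co3 x \<equiv> b (delta x) g3"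
abbreviation co4 :: "'a \<Rightarrow> real" where "co4 x \<equiv> b (delta x) g4"

lemma frame_orth': "b g2 g1 = 0" "b g3 g1 = 0" "b g4 g1 = 0" "b g3 g2 = 0" "b g4 g2 = 0" "b g4 g3 = 0"
  by (simp_all only: frame_orth form_sym[of g2 g1] form_sym[of g3 g1] form_sym[of g3 g2]
      form_sym[of g4 g1] form_sym[of g4 g2] form_sym[of g4 g3])

text \<open>Subtracting \<open>g\<close> with the sign of the coordinate leaves a vector that is
  nonzero at \<open>x\<close>; its norm is 4 minus twice the modulus of the coordinate.\<close>

lemma coordinate_range:
  assumes x: "x \<in> V - S" and g: "g \<in> {g1, g2, g3, g4}"
  shows "\<bar>b (delta x) g\<bar> < 2"
proof -
  define s where "s = b (delta x) g"
  define e :: real where "e = (if s > 0 then 1 else -1)"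
  define f where "f = (\<lambda>v. delta x v - e * g v)"
  have "g x = 0" "b g g = 2" using g x frame_support frame_norm by auto
  then have "b f f > 0"
    by (intro form_pos[of x]) (use x in \<open>auto simp: f_def delta_def\<close>)
  moreover have "b f f = 2 - 2 * (e * s) + (e * e) * 2"
    unfolding f_def form_simps using \<open>b g g = 2\<close> x
    by (simp add: gram form_sym[of g "delta x"] s_def algebra_simps)
  moreover have "e * e = 1" "e * s = \<bar>s\<bar>" by (auto simp: e_def)
  ultimately show ?thesis by (simp add: s_def)
qed

text \<open>The component of \<open>delta x\<close> orthogonal to the frame; 1/2 is the inverse of
  the norm of a root.\<close>

definition proj :: "'a \<Rightarrow> 'a \<Rightarrow> real" where
  "proj x = (\<lambda>v. delta x v - 1/2 * (co1 x * g1 v + co2 x * g2 v +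
     co3 x * g3 v + co4 x * g4 v))"

lemma proj_form:
  "b (proj x) (proj y) = b (delta x) (delta y) -
    1/2 * (co1 x * co1 y + co2 x * co2 y +
     co3 x * co3 y + co4 x * co4 y)"
  unfolding proj_def form_simps
  by (simp add: frame_norm frame_orth frame_orth' form_sym[of g1 "delta y"] form_sym[of g2 "delta y"]
      form_sym[of g3 "delta y"] form_sym[of g4 "delta y"] field_simps)

lemma proj_eval: "x \<in> V - S \<Longrightarrow> y \<in> V - S \<Longrightarrow> proj x y = (if x = y then 1 else 0)"
  using frame_support by (auto simp: proj_def delta_def)

text \<open>The coordinates are 0, 1 or -1 with even sum. Four nonzero ones would make the
  projection a null vector, as \<open>2 - 4 / 2 = 0\<close>, so none or exactly two are
  nonzero.\<close>

lemma coordinate_cases: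
  assumes x: "x \<in> V - S"
  obtains "co1 x = 0" "co2 x = 0" "co3 x = 0" "co4 x = 0"
  | "\<bar>co1 x\<bar> = 1" "\<bar>co2 x\<bar> = 1" "co3 x = 0" "co4 x = 0"
  | "\<bar>co1 x\<bar> = 1" "co2 x = 0" "\<bar>co3 x\<bar> = 1" "co4 x = 0"
  | "\<bar>co1 x\<bar> = 1" "co2 x = 0" "co3 x = 0" "\<bar>co4 x\<bar> = 1"
  | "co1 x = 0" "\<bar>co2 x\<bar> = 1" "\<bar>co3 x\<bar> = 1" "co4 x = 0"
  | "co1 x = 0" "\<bar>co2 x\<bar> = 1" "co3 x = 0" "\<bar>co4 x\<bar> = 1"
  | "co1 x = 0" "co2 x = 0" "\<bar>co3 x\<bar> = 1" "\<bar>co4 x\<bar> = 1"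
proof -
  obtain h1 h2 h3 m :: int where h: "co1 x = h1" "co2 x = h2"
    "co3 x = h3" "co4 x = 2 * real_of_int m - h1 - h2 - h3" using frame_int[OF x] by blast
  define h4 where "h4 = 2 * m - h1 - h2 - h3"
  have h': "co4 x = h4" using h by (simp add: h4_def)
  have r: "h1 = 0 \<or> h1 = 1 \<or> h1 = -1" "h2 = 0 \<or> h2 = 1 \<or> h2 = -1" "h3 = 0 \<or> h3 = 1 \<or> h3 = -1" "h4 = 0 \<or> h4 = 1 \<or> h4 = -1"
    using coordinate_range[OF x, of g1] coordinate_range[OF x, of g2] coordinate_range[OF x, of g3]
      coordinate_range[OF x, of g4] h h' by auto
  have "\<not> (h1 \<noteq> 0 \<and> h2 \<noteq> 0 \<and> h3 \<noteq> 0 \<and> h4 \<noteq> 0)"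
  proof
    assume n: "h1 \<noteq> 0 \<and> h2 \<noteq> 0 \<and> h3 \<noteq> 0 \<and> h4 \<noteq> 0"
    have sq: "h1 * h1 = 1" "h2 * h2 = 1" "h3 * h3 = 1" "h4 * h4 = 1" using n r by auto
    have "b (proj x) (proj x) = 2 - 1/2 * (of_int (h1 * h1) + of_int (h2 * h2) + of_int (h3 * h3) + of_int (h4 * h4))"
      unfolding proj_form h(1-3) h' using x by (simp add: gram)
    moreover have "b (proj x) (proj x) > 0"
      by (rule form_pos[of x]) (use x proj_eval[OF x x] in auto)
    ultimately show False unfolding sq by simp
  qed
  moreover have "even (h1 + h2 + h3 + h4)" by (simp add: h4_def)
  ultimately have "(h1 = 0 \<and> h2 = 0 \<and> h3 = 0 \<and> h4 = 0) \<or>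
    (\<bar>h1\<bar> = 1 \<and> \<bar>h2\<bar> = 1 \<and> h3 = 0 \<and> h4 = 0) \<or> (\<bar>h1\<bar> = 1 \<and> h2 = 0 \<and> \<bar>h3\<bar> = 1 \<and> h4 = 0) \<or>
    (\<bar>h1\<bar> = 1 \<and> h2 = 0 \<and> h3 = 0 \<and> \<bar>h4\<bar> = 1) \<or> (h1 = 0 \<and> \<bar>h2\<bar> = 1 \<and> \<bar>h3\<bar> = 1 \<and> h4 = 0) \<or>
    (h1 = 0 \<and> \<bar>h2\<bar> = 1 \<and> h3 = 0 \<and> \<bar>h4\<bar> = 1) \<or> (h1 = 0 \<and> h2 = 0 \<and> \<bar>h3\<bar> = 1 \<and> \<bar>h4\<bar> = 1)"
    using r by (elim disjE) simp_all
  then show ?thesis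
  proof (elim disjE conjE)
    assume "h1 = 0" "h2 = 0" "h3 = 0" "h4 = 0"
    then show ?thesis by (intro that(1)) (simp_all add: h(1-3) h' flip: of_int_abs)
  next
    assume "\<bar>h1\<bar> = 1" "\<bar>h2\<bar> = 1" "h3 = 0" "h4 = 0"
    then show ?thesis by (intro that(2)) (simp_all add: h(1-3) h' flip: of_int_abs)
  next
    assume "\<bar>h1\<bar> = 1" "h2 = 0" "\<bar>h3\<bar> = 1" "h4 = 0"
    then show ?thesis by (intro that(3)) (simp_all add: h(1-3) h' flip: of_int_abs)
  next
    assume "\<bar>h1\<bar> = 1" "h2 = 0" "h3 = 0" "\<bar>h4\<bar> = 1"
    then show ?thesis by (intro that(4)) (simp_all add: h(1-3) h' flip: of_int_abs)
  next
    assume "h1 = 0" "\<bar>h2\<bar> = 1" "\<bar>h3\<bar> = 1" "h4 = 0"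
    then show ?thesis by (intro that(5)) (simp_all add: h(1-3) h' flip: of_int_abs)
  next
    assume "h1 = 0" "\<bar>h2\<bar> = 1" "h3 = 0" "\<bar>h4\<bar> = 1"
    then show ?thesis by (intro that(6)) (simp_all add: h(1-3) h' flip: of_int_abs)
  next
    assume "h1 = 0" "h2 = 0" "\<bar>h3\<bar> = 1" "\<bar>h4\<bar> = 1"
    then show ?thesis by (intro that(7)) (simp_all add: h(1-3) h' flip: of_int_abs)
  qed
qed

definition attached :: "'a set" where
  "attached = {x \<in> V - S. co1 x \<noteq> 0 \<or> co2 x \<noteq> 0 \<or> co3 x \<noteq> 0 \<or> co4 x \<noteq> 0}"

text \<open>
  The coset is recorded as the pairing of the four orthogonal roots, one part of which is the set of
  roots not orthogonal to x.
\<close>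

definition coset :: "'a \<Rightarrow> nat" where
  "coset x = (if (co1 x = 0) = (co2 x = 0) then 0
     else if (co1 x = 0) = (co3 x = 0) then 1 else 2)"

lemma coset_cases:
  assumes "x \<in> attached"
  shows "coset x = 0 \<and> (\<bar>co1 x\<bar> = 1 \<and> \<bar>co2 x\<bar> = 1 \<and> co3 x = 0 \<and> co4 x = 0 \<or>
      co1 x = 0 \<and> co2 x = 0 \<and> \<bar>co3 x\<bar> = 1 \<and> \<bar>co4 x\<bar> = 1) \<or>
    coset x = 1 \<and> (\<bar>co1 x\<bar> = 1 \<and> co2 x = 0 \<and> \<bar>co3 x\<bar> = 1 \<and> co4 x = 0 \<or>
      co1 x = 0 \<and> \<bar>co2 x\<bar> = 1 \<and> co3 x = 0 \<and> \<bar>co4 x\<bar> = 1) \<or>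
    coset x = 2 \<and> (\<bar>co1 x\<bar> = 1 \<and> co2 x = 0 \<and> co3 x = 0 \<and> \<bar>co4 x\<bar> = 1 \<or>
      co1 x = 0 \<and> \<bar>co2 x\<bar> = 1 \<and> \<bar>co3 x\<bar> = 1 \<and> co4 x = 0)"
proof -
  have "x \<in> V - S" using assms by (simp add: attached_def)
  then show ?thesis
    by (rule coordinate_cases) (use assms in \<open>auto simp: attached_def coset_def\<close>)
qed

text \<open>The form in which a common coset is used: two of the first three roots are orthogonal to
  the same attached vertices. For roots that are themselves vertices, orthogonal means
  nonadjacent.\<close>

lemma coset_zero_patterns:
  assumes "x \<in> attached"
  shows "coset x = 0 \<Longrightarrow> co1 x = 0 \<longleftrightarrow> co2 x = 0"
    and "coset x = 1 \<Longrightarrow> co1 x = 0 \<longleftrightarrow> co3 x = 0"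
    and "coset x = 2 \<Longrightarrow> co2 x = 0 \<longleftrightarrow> co3 x = 0"
  using coset_cases[OF assms] by auto

lemma sign_square: "\<bar>r\<bar> = 1 \<Longrightarrow> r * r = 1" for r :: real
  by (metis abs_mult_self_eq mult_1)

lemma abs_one_cases: "\<bar>r\<bar> = 1 \<Longrightarrow> r = 1 \<or> r = -1" for r :: real
  by linarith

lemma sign_mult: "\<bar>r\<bar> = 1 \<Longrightarrow> \<bar>s\<bar> = 1 \<Longrightarrow> r * s = 1 \<or> r * s = -1" for r s :: real
  by (metis abs_mult abs_one_cases mult_1)

lemma sign_mult_add:
  "\<bar>r\<bar> = 1 \<Longrightarrow> \<bar>s\<bar> = 1 \<Longrightarrow> \<bar>p\<bar> = 1 \<Longrightarrow> \<bar>q\<bar> = 1 \<Longrightarrow>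
    r * s + p * q = 2 \<or> r * s + p * q = 0 \<or> r * s + p * q = -2" for r s p q :: real
  using sign_mult[of r s] sign_mult[of p q] by linarith

lemma proj_unit:
  assumes "x \<in> attached"
  shows "b (proj x) (proj x) = 1"
proof -
  have "x \<in> V" using assms by (simp add: attached_def)
  then show ?thesis
    using coset_cases[OF assms] by (elim disjE conjE) (simp_all add: proj_form gram sign_square)
qed

text \<open>Within a coset the coordinate supports coincide or are disjoint, so the inner product is
  an integer; for two independent unit vectors its modulus is below 1.\<close>

lemma proj_orth_same_coset:
  assumes x: "x \<in> attached" and y: "y \<in> attached" and ne: "x \<noteq> y" and c: "coset x = coset y"
  shows "b (proj x) (proj y) = 0"
proof -
  have V: "x \<in> V - S" "y \<in> V - S" using x y by (auto simp: attached_def)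
  define t where "t = co1 x * co1 y + co2 x * co2 y +
     co3 x * co3 y + co4 x * co4 y"
  have t: "t = 2 \<or> t = 0 \<or> t = -2"
    using coset_cases[OF x] coset_cases[OF y] c
    by (elim disjE conjE) (simp_all add: t_def sign_mult_add)
  have form: "b (proj x) (proj y) = b (delta x) (delta y) - 1/2 * t"
    by (simp add: proj_form t_def)
  define f where "f e = (\<lambda>v. proj x v - e * proj y v)" for e :: real
  have "b (f e) (f e) > 0" for e
    by (rule form_pos[of x]) (use V ne in \<open>auto simp: f_def proj_eval\<close>)
  moreover have "b (f e) (f e) = 1 + e * e - 2 * e * b (proj x) (proj y)" for e
    unfolding f_def form_simps by (simp add: proj_unit x y form_sym[of "proj y" "proj x"] algebra_simps)
  ultimately have "1 + e * e - 2 * e * b (proj x) (proj y) > 0" for e by metis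
  from this[of 1] this[of "-1"] show ?thesis
    unfolding form using t V ne by (auto simp: gram split: if_splits)
qed

text \<open>Supports from different cosets share exactly one root, so the inner product is half an
  odd integer, again of modulus below 1.\<close>

lemma proj_half_diff_coset:
  assumes x: "x \<in> attached" and y: "y \<in> attached" and c: "coset x \<noteq> coset y"
  shows "\<bar>b (proj x) (proj y)\<bar> = 1/2"
proof -
  have V: "x \<in> V - S" "y \<in> V - S" using x y by (auto simp: attached_def)
  have "x \<noteq> y" using c by auto
  define t where "t = co1 x * co1 y + co2 x * co2 y +
     co3 x * co3 y + co4 x * co4 y"
  have t: "t = 1 \<or> t = -1"
    using coset_cases[OF x] coset_cases[OF y] c
    by (elim disjE conjE) (simp_all add: t_def sign_mult)
  have form: "b (proj x) (proj y) = b (delta x) (delta y) - 1/2 * t"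
    by (simp add: proj_form t_def)
  define f where "f e = (\<lambda>v. proj x v - e * proj y v)" for e :: real
  have "b (f e) (f e) > 0" for e
    by (rule form_pos[of x]) (use V \<open>x \<noteq> y\<close> in \<open>auto simp: f_def proj_eval\<close>)
  moreover have "b (f e) (f e) = 1 + e * e - 2 * e * b (proj x) (proj y)" for e
    unfolding f_def form_simps by (simp add: proj_unit x y form_sym[of "proj y" "proj x"] algebra_simps)
  ultimately have "1 + e * e - 2 * e * b (proj x) (proj y) > 0" for e by metis
  from this[of 1] this[of "-1"] show ?thesis
    unfolding form using t V \<open>x \<noteq> y\<close> by (auto simp: gram split: if_splits)
qed

lemma one_coset:
  assumes "card attached \<ge> 5" "x \<in> attached" "y \<in> attached"
  shows "coset x = coset y"
proof (rule half_system_one_class[where T = attached and k = coset and p = proj])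
  show "finite attached" "attached \<subseteq> V" using finite_V by (auto simp: attached_def)
  show "coset x < 3" for x by (simp add: coset_def)
  show "proj x y = (if x = y then 1 else 0)" if "x \<in> attached" "y \<in> attached" for x y
    using that by (intro proj_eval) (auto simp: attached_def)
qed (use assms proj_unit proj_orth_same_coset proj_half_diff_coset in auto)

text \<open>Since the projections are orthogonal, the frame coordinates alone decide
  adjacency.\<close>

lemma gram_same_coset:
  assumes "x \<in> attached" "y \<in> attached" "x \<noteq> y" "coset x = coset y"
  shows "b (delta x) (delta y) =
    1/2 * (co1 x * co1 y + co2 x * co2 y +
     co3 x * co3 y + co4 x * co4 y)"
  using proj_orth_same_coset[OF assms] by (simp add: proj_form)

end

section \<open>Claws and diamonds\<close>

context root_graph begin

lemma form_delta_adj: "x \<in> V \<Longrightarrow> y \<in> V \<Longrightarrow> x \<noteq> y \<Longrightarrow> b (delta x) (delta y) = of_bool (adj x y)"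
  by (simp add: gram)

text \<open>The fourth root is chosen so that the centre \<open>u\<close> is half the sum of all
  four; adjacency to \<open>u\<close> then supplies the \<open>m\<close> of the parity
  condition.\<close>

lemma claw_frame:
  assumes V: "u \<in> V" "a1 \<in> V" "a2 \<in> V" "a3 \<in> V" and adj: "adj u a1" "adj u a2" "adj u a3"
    and ne: "a1 \<noteq> a2" "a1 \<noteq> a3" "a2 \<noteq> a3" and nadj: "\<not> adj a1 a2" "\<not> adj a1 a3" "\<not> adj a2 a3"
  shows "d4_frame V b adj k {u, a1, a2, a3} (delta a1) (delta a2) (delta a3)
    (\<lambda>v. 2 * delta u v - delta a1 v - delta a2 v - delta a3 v)"
proof unfold_locales
  have ne': "u \<noteq> a1" "u \<noteq> a2" "u \<noteq> a3" using adj adj_irrefl by metis+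
  have nadj': "\<not> adj a2 a1" "\<not> adj a3 a1" "\<not> adj a3 a2" "adj a1 u" "adj a2 u" "adj a3 u"
    using nadj adj adj_sym by blast+
  note facts = V adj ne ne[symmetric] ne' ne'[symmetric] nadj nadj'
  let ?g = "\<lambda>v. 2 * delta u v - delta a1 v - delta a2 v - delta a3 v"
  show "delta a1 v = 0" "delta a2 v = 0" "delta a3 v = 0" "?g v = 0" if "v \<notin> {u,a1,a2,a3}" for v
    using that by (auto simp: delta_def)
  show "b (delta a1) (delta a1) = 2" "b (delta a2) (delta a2) = 2" "b (delta a3) (delta a3) = 2"
    "b (delta a1) (delta a2) = 0" "b (delta a1) (delta a3) = 0" "b (delta a2) (delta a3) = 0"
    using facts by (simp_all add: gram)
  show "b ?g ?g = 2" "b (delta a1) ?g = 0" "b (delta a2) ?g = 0" "b (delta a3) ?g = 0"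
    unfolding form_simps using facts by (simp_all add: gram)
  show "\<exists>h1 h2 h3 m. b (delta x) (delta a1) = real_of_int h1 \<and> b (delta x) (delta a2) = real_of_int h2 \<and>
     b (delta x) (delta a3) = real_of_int h3 \<and>
     b (delta x) ?g = 2 * real_of_int m - real_of_int h1 - real_of_int h2 - real_of_int h3"
    if x: "x \<in> V - {u, a1, a2, a3}" for x
    by (rule exI[of _ "of_bool (adj x a1)"], rule exI[of _ "of_bool (adj x a2)"],
        rule exI[of _ "of_bool (adj x a3)"], rule exI[of _ "of_bool (adj x u)"])
      (use x V in \<open>simp add: form_simps form_delta_adj\<close>)
qed

text \<open>The \<open>k - 1\<close> neighbours of a leaf other than \<open>u\<close> are all
  attached, enough to force one coset. Each coset pairs two of the leaves, which become
  twins.\<close>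

lemma no_claw:
  assumes V: "u \<in> V" "a1 \<in> V" "a2 \<in> V" "a3 \<in> V" and adj: "adj u a1" "adj u a2" "adj u a3"
    and ne: "a1 \<noteq> a2" "a1 \<noteq> a3" "a2 \<noteq> a3"
  shows "adj a1 a2 \<or> adj a1 a3 \<or> adj a2 a3"
proof (rule ccontr)
  assume "\<not> ?thesis"
  then have nadj: "\<not> adj a1 a2" "\<not> adj a1 a3" "\<not> adj a2 a3" by auto
  interpret d4_frame V b adj k "{u, a1, a2, a3}" "delta a1" "delta a2" "delta a3"
    "\<lambda>v. 2 * delta u v - delta a1 v - delta a2 v - delta a3 v"
    by (rule claw_frame) (use assms nadj in auto)
  let ?S = "{u, a1, a2, a3}"
  have h: "b (delta x) (delta a) = of_bool (adj a x)" if "x \<in> V - ?S" "a \<in> {a1, a2, a3}" for x a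
    using that V by (auto simp: form_delta_adj adj_commute)
  have "{y \<in> V. adj a1 y} - {u} \<subseteq> attached"
  proof
    fix y assume y: "y \<in> {y \<in> V. adj a1 y} - {u}"
    then have "y \<in> V - ?S" using nadj adj_irrefl by auto
    then show "y \<in> attached" using h[of y a1] y by (simp add: attached_def)
  qed
  then have "card ({y \<in> V. adj a1 y} - {u}) \<le> card attached"
    by (rule card_mono[rotated]) (use finite_V in \<open>auto simp: attached_def\<close>)
  moreover have "card ({y \<in> V. adj a1 y} - {u}) = k - 1"
    using valency[OF V(2)] V adj adj_sym finite_V by simp
  ultimately have "card attached \<ge> 5" using valency_ge by simp
  note one = one_coset[OF this]
  have "attached \<noteq> {}" using \<open>card attached \<ge> 5\<close> by auto
  then obtain y where y: "y \<in> attached" by blast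
  have same: "a = a'" if tw: "a \<in> {a1, a2, a3}" "a' \<in> {a1, a2, a3}"
    "\<And>x. x \<in> V - ?S \<Longrightarrow> adj a x \<longleftrightarrow> adj a' x" for a a'
  proof (rule ccontr)
    assume "a \<noteq> a'"
    show False
    proof (rule no_twins[of a a' u])
      show "adj a x \<longleftrightarrow> adj a' x" if "x \<in> V" "x \<noteq> u" for x
        using that tw nadj adj_sym adj_irrefl by (cases "x \<in> ?S") auto
    qed (use tw V adj nadj adj_sym \<open>a \<noteq> a'\<close> in auto)
  qed
  have att: "x \<in> attached \<or> (\<not> adj a1 x \<and> \<not> adj a2 x \<and> \<not> adj a3 x)" if "x \<in> V - ?S" for x
    using that h[OF that] by (auto simp: attached_def)
  have "coset y < 3" by (simp add: coset_def)
  then consider "coset y = 0" | "coset y = 1" | "coset y = 2" by linarith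
  then show False
  proof cases
    case 1
    have "adj a1 x \<longleftrightarrow> adj a2 x" if x: "x \<in> V - ?S" for x
    proof (cases "x \<in> attached")
      case True
      then show ?thesis
        using coset_zero_patterns(1)[OF True] one[OF True y] 1 h[OF x, of a1] h[OF x, of a2] by simp
    qed (use att[OF x] in auto)
    then show False using same[of a1 a2] ne by auto
  next
    case 2
    have "adj a1 x \<longleftrightarrow> adj a3 x" if x: "x \<in> V - ?S" for x
    proof (cases "x \<in> attached")
      case True
      then show ?thesis
        using coset_zero_patterns(2)[OF True] one[OF True y] 2 h[OF x, of a1] h[OF x, of a3] by simp
    qed (use att[OF x] in auto)
    then show False using same[of a1 a3] ne by auto
  next
    case 3
    have "adj a2 x \<longleftrightarrow> adj a3 x" if x: "x \<in> V - ?S" for x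
    proof (cases "x \<in> attached")
      case True
      then show ?thesis
        using coset_zero_patterns(3)[OF True] one[OF True y] 3 h[OF x, of a2] h[OF x, of a3] by simp
    qed (use att[OF x] in auto)
    then show False using same[of a2 a3] ne by auto
  qed
qed

definition diamond :: "'a \<Rightarrow> 'a \<Rightarrow> 'a \<Rightarrow> 'a \<Rightarrow> bool" where
  "diamond a c u m \<longleftrightarrow> a \<in> V \<and> c \<in> V \<and> u \<in> V \<and> m \<in> V \<and> a \<noteq> c \<and> u \<noteq> m \<and> \<not> adj a c \<and>
     adj a u \<and> adj a m \<and> adj c u \<and> adj c m \<and> adj u m"

text \<open>Again \<open>u\<close> is half the sum of the roots. The third root detects whether a
  vertex distinguishes \<open>u\<close> from \<open>m\<close>.\<close>

lemma diamond_frame: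
  assumes "diamond a c u m"
  shows "d4_frame V b adj k {a, c, u, m} (delta a) (delta c) (\<lambda>v. delta u v - delta m v)
    (\<lambda>v. delta u v + delta m v - delta a v - delta c v)"
proof unfold_locales
  have V: "a \<in> V" "c \<in> V" "u \<in> V" "m \<in> V" and adj: "adj a u" "adj a m" "adj c u" "adj c m" "adj u m"
    and ne: "a \<noteq> c" "u \<noteq> m" and nadj: "\<not> adj a c" using assms by (auto simp: diamond_def)
  have ne': "a \<noteq> u" "a \<noteq> m" "c \<noteq> u" "c \<noteq> m" using adj adj_irrefl by metis+
  have nadj': "\<not> adj c a" using nadj adj_sym by blast
  note facts = V adj adj[THEN adj_sym] ne ne[symmetric] ne' ne'[symmetric] nadj nadj'
  let ?g = "\<lambda>v. delta u v - delta m v"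
  let ?h = "\<lambda>v. delta u v + delta m v - delta a v - delta c v"
  show "delta a v = 0" "delta c v = 0" "?g v = 0" "?h v = 0" if "v \<notin> {a, c, u, m}" for v
    using that by (auto simp: delta_def)
  show "b (delta a) (delta a) = 2" "b (delta c) (delta c) = 2" "b (delta a) (delta c) = 0"
    using facts by (simp_all add: gram)
  show "b ?g ?g = 2" "b (delta a) ?g = 0" "b (delta c) ?g = 0"
    "b ?h ?h = 2" "b (delta a) ?h = 0" "b (delta c) ?h = 0" "b ?g ?h = 0"
    unfolding form_simps using facts by (simp_all add: gram)
  show "\<exists>h1 h2 h3 m. b (delta x) (delta a) = real_of_int h1 \<and> b (delta x) (delta c) = real_of_int h2 \<and>
     b (delta x) ?g = real_of_int h3 \<and>
     b (delta x) ?h = 2 * real_of_int m - real_of_int h1 - real_of_int h2 - real_of_int h3"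
    if x: "x \<in> V - {a, c, u, m}" for x
    by (rule exI[of _ "of_bool (adj x a)"], rule exI[of _ "of_bool (adj x c)"],
        rule exI[of _ "of_bool (adj x u) - of_bool (adj x m)"], rule exI[of _ "of_bool (adj x u)"])
      (use x V in \<open>simp add: form_simps form_delta_adj\<close>)
qed

lemma diamond_commute: "diamond a c u m \<Longrightarrow> diamond c a u m"
  using adj_sym by (auto simp: diamond_def)

text \<open>The coset that pairs \<open>a\<close> with \<open>delta u - delta m\<close>. In a line
  graph this is the case where \<open>a\<close>, \<open>u\<close>, \<open>m\<close> are the sides of
  a triangle and \<open>c\<close> is a further edge at the common end of \<open>u\<close> and
  \<open>m\<close>.\<close>

definition oriented_diamond :: "'a \<Rightarrow> 'a \<Rightarrow> 'a \<Rightarrow> 'a \<Rightarrow> bool" where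
  "oriented_diamond a c u m \<longleftrightarrow> diamond a c u m \<and>
     (\<forall>x \<in> V - {a, c, u, m}. adj a x \<longleftrightarrow> (adj u x \<noteq> adj m x))"

text \<open>The coset pairing \<open>a\<close> with \<open>c\<close> would make them agree on
  \<open>x\<close>, which was chosen to separate them. Either of the two can be the one paired with
  the difference of \<open>u\<close> and \<open>m\<close>, hence the disjunction.\<close>

lemma diamond_orientation:
  assumes D: "diamond a c u m"
  shows "oriented_diamond a c u m \<or> oriented_diamond c a u m"
proof -
  interpret d4_frame V b adj k "{a, c, u, m}" "delta a" "delta c" "\<lambda>v. delta u v - delta m v"
    "\<lambda>v. delta u v + delta m v - delta a v - delta c v"
    by (rule diamond_frame[OF D])
  let ?S = "{a, c, u, m}"
  have V: "a \<in> V" "c \<in> V" "u \<in> V" "m \<in> V" and adj: "adj a u" "adj a m" "adj c u" "adj c m" "adj u m"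
    and ne: "a \<noteq> c" "u \<noteq> m" and nadj: "\<not> adj a c" "\<not> adj c a" using D adj_sym by (auto simp: diamond_def)
  have h1: "b (delta x) (delta a) = of_bool (adj a x)" "b (delta x) (delta c) = of_bool (adj c x)"
    "b (delta x) (\<lambda>v. delta u v - delta m v) = of_bool (adj u x) - of_bool (adj m x)"
    "b (delta x) (\<lambda>v. delta u v + delta m v - delta a v - delta c v) =
      of_bool (adj u x) + of_bool (adj m x) - of_bool (adj a x) - of_bool (adj c x)"
    if "x \<in> V - ?S" for x
    using that V by (auto simp: form_simps form_delta_adj adj_commute)
  have "\<exists>x \<in> V. x \<noteq> u \<and> \<not> (adj a x \<longleftrightarrow> adj c x)"
    using no_twins[of a c u] V adj ne nadj by blast
  then obtain x where x: "x \<in> V" "x \<noteq> u" "adj a x \<noteq> adj c x" by blast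
  have "x \<noteq> m" "x \<noteq> a" "x \<noteq> c" using x adj nadj adj_irrefl by auto
  \<comment> \<open>Taking the end that is not adjacent to \<open>x\<close> adds \<open>x\<close> to
    the \<open>k - 2\<close> neighbours counted below, just enough for five when
    \<open>k = 6\<close>.\<close>
  obtain a' where a': "a' \<in> {a, c}" "\<not> adj a' x" using x by blast
  have a'V: "a' \<in> V" "adj a' u" "adj a' m" using a' V adj by auto
  have sub: "insert x ({y \<in> V. adj a' y} - {u, m}) \<subseteq> attached"
  proof
    fix y assume y: "y \<in> insert x ({y \<in> V. adj a' y} - {u, m})"
    then have yV: "y \<in> V - ?S"
      using a' x \<open>x \<noteq> m\<close> \<open>x \<noteq> a\<close> \<open>x \<noteq> c\<close> nadj adj_irrefl by auto
    have "adj a y \<or> adj c y" using y a' x by auto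
    then show "y \<in> attached" using h1[OF yV] yV by (auto simp: attached_def)
  qed
  have "card ({y \<in> V. adj a' y} - {u, m}) = k - 2"
    using valency[OF a'V(1)] a'V V ne finite_V by (subst card_Diff_subset) auto
  then have "card (insert x ({y \<in> V. adj a' y} - {u, m})) = k - 2 + 1"
    using finite_V a' by simp
  moreover have "card (insert x ({y \<in> V. adj a' y} - {u, m})) \<le> card attached"
    by (rule card_mono[OF _ sub]) (use finite_V in \<open>auto simp: attached_def\<close>)
  ultimately have "card attached \<ge> 5" using valency_ge by simp
  note one = one_coset[OF this]
  have y: "x \<in> attached" using sub by blast
  have att: "z \<in> attached \<or> (\<not> adj a z \<and> \<not> adj c z \<and> \<not> adj u z \<and> \<not> adj m z)" if "z \<in> V - ?S" for z
    using that h1[OF that] by (auto simp: attached_def)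
  have "coset x < 3" by (simp add: coset_def)
  then consider "coset x = 0" | "coset x = 1" | "coset x = 2" by linarith
  then show ?thesis
  proof cases
    case 1
    then have "adj a x \<longleftrightarrow> adj c x"
      using coset_zero_patterns(1)[OF y] h1[of x] x \<open>x \<noteq> m\<close> \<open>x \<noteq> a\<close> \<open>x \<noteq> c\<close> by simp
    then show ?thesis using x by blast
  next
    case 2
    have "adj a z \<longleftrightarrow> adj u z \<noteq> adj m z" if z: "z \<in> V - ?S" for z
    proof (cases "z \<in> attached")
      case True
      with one[OF True y] 2 have
        "b (delta z) (delta a) = 0 \<longleftrightarrow> b (delta z) (\<lambda>v. delta u v - delta m v) = 0"
        using coset_zero_patterns(2)[OF True] by simp
      then show ?thesis unfolding h1[OF z] by auto
    qed (use att[OF z] in auto)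
    then show ?thesis using D by (auto simp: oriented_diamond_def)
  next
    case 3
    have "adj c z \<longleftrightarrow> adj u z \<noteq> adj m z" if z: "z \<in> V - ?S" for z
    proof (cases "z \<in> attached")
      case True
      with one[OF True y] 3 have
        "b (delta z) (delta c) = 0 \<longleftrightarrow> b (delta z) (\<lambda>v. delta u v - delta m v) = 0"
        using coset_zero_patterns(3)[OF True] by simp
      then show ?thesis unfolding h1[OF z] by auto
    qed (use att[OF z] in auto)
    then show ?thesis using diamond_commute[OF D] by (auto simp: oriented_diamond_def)
  qed
qed

text \<open>An attached vertex has its two nonzero coordinates at the first and third root or at the
  second and fourth. In the last claim \<open>x\<close> has coordinates 1, 0, 1, 0, and half the
  product with those of \<open>y\<close> is 1 exactly if \<open>y\<close> has the same ones, and 0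
  otherwise.\<close>

lemma oriented_diamond_outside:
  assumes D: "oriented_diamond a c u m" and x: "x \<in> V - {a, c, u, m}"
  shows "adj c x \<Longrightarrow> \<not> adj a x" and "\<not> adj a x \<Longrightarrow> \<not> adj c x \<Longrightarrow> \<not> adj u x \<and> \<not> adj m x"
    and "\<lbrakk>adj a x; adj u x; y \<in> V - {a, c, u, m}; x \<noteq> y; adj a y \<or> adj c y\<rbrakk> \<Longrightarrow>
      adj x y \<longleftrightarrow> adj a y \<and> adj u y"
proof -
  have D': "diamond a c u m" and ori: "\<And>x. x \<in> V - {a, c, u, m} \<Longrightarrow> adj a x \<longleftrightarrow> (adj u x \<noteq> adj m x)"
    using D by (auto simp: oriented_diamond_def)
  interpret d4_frame V b adj k "{a, c, u, m}" "delta a" "delta c" "\<lambda>v. delta u v - delta m v"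
    "\<lambda>v. delta u v + delta m v - delta a v - delta c v"
    by (rule diamond_frame[OF D'])
  let ?S = "{a, c, u, m}"
  have V: "a \<in> V" "c \<in> V" "u \<in> V" "m \<in> V" using D' by (auto simp: diamond_def)
  have h1: "b (delta x) (delta a) = of_bool (adj a x)" "b (delta x) (delta c) = of_bool (adj c x)"
    "b (delta x) (\<lambda>v. delta u v - delta m v) = of_bool (adj u x) - of_bool (adj m x)"
    "b (delta x) (\<lambda>v. delta u v + delta m v - delta a v - delta c v) =
      of_bool (adj u x) + of_bool (adj m x) - of_bool (adj a x) - of_bool (adj c x)"
    if "x \<in> V - ?S" for x
    using that V by (auto simp: form_simps form_delta_adj adj_commute)
  have ac: "\<not> (adj a z \<and> adj c z)" if z: "z \<in> V - ?S" for z
    by (rule coordinate_cases[OF z]) (use h1[OF z] ori[OF z] in \<open>auto simp: of_bool_def split: if_splits\<close>)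
  have none: "\<not> adj u z \<and> \<not> adj m z" if z: "z \<in> V - ?S" "\<not> adj a z" "\<not> adj c z" for z
    by (rule coordinate_cases[OF z(1)]) (use h1[OF z(1)] ori[OF z(1)] z in \<open>auto simp: of_bool_def split: if_splits\<close>)
  show "adj c x \<Longrightarrow> \<not> adj a x" using ac[OF x] by blast
  show "\<not> adj a x \<Longrightarrow> \<not> adj c x \<Longrightarrow> \<not> adj u x \<and> \<not> adj m x" using none[OF x] by blast
  show "adj x y \<longleftrightarrow> adj a y \<and> adj u y" if "adj a x" "adj u x" and y: "y \<in> V - ?S" and "x \<noteq> y" "adj a y \<or> adj c y"
  proof -
    have at: "x \<in> attached" "y \<in> attached" using that x h1[OF x] h1[OF y] by (auto simp: attached_def)
    have "coset z = 1" if "z \<in> attached" for z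
    proof -
      have z: "z \<in> V - ?S" using that by (auto simp: attached_def)
      show ?thesis using coset_cases[OF that] ac[OF z] ori[OF z] h1[OF z] by auto
    qed
    with at have "coset x = coset y" by simp
    from gram_same_coset[OF at \<open>x \<noteq> y\<close> this]
    show ?thesis unfolding h1[OF x] h1[OF y] using that x ori[OF x] ori[OF y] ac[OF x] ac[OF y]
      by (auto simp: form_delta_adj of_bool_def split: if_splits)
  qed
qed

text \<open>
  The null vector carries alternating signs along a closed walk of length 6 that runs around two
  triangles sharing a vertex, in a graph of which adj is locally the line graph.
\<close>

lemma no_bowtie:
  assumes V: "u \<in> V" "m \<in> V" "a \<in> V" "x \<in> V" "y \<in> V" "z \<in> V"
    and ne: "m \<noteq> x" "m \<noteq> y" "z \<noteq> u" "z \<noteq> m" "z \<noteq> a"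
    and adj: "adj u m" "adj u a" "adj m a" "adj u x" "adj u y" "adj a x" "adj a y" "adj x y" "adj z x" "adj z y"
    and nadj: "\<not> adj m x" "\<not> adj m y" "\<not> adj z u" "\<not> adj z m" "\<not> adj z a"
  shows False
proof -
  have ne': "u \<noteq> m" "u \<noteq> a" "m \<noteq> a" "u \<noteq> x" "u \<noteq> y" "a \<noteq> x" "a \<noteq> y" "x \<noteq> y" "z \<noteq> x" "z \<noteq> y"
    using adj adj_irrefl by metis+
  have nadj': "\<not> adj x m" "\<not> adj y m" "\<not> adj u z" "\<not> adj m z" "\<not> adj a z"
    using nadj adj_sym by blast+
  define f where "f = (\<lambda>v. delta u v - delta m v + delta a v - delta x v - delta y v + delta z v)"
  have "b f f = 0"
    unfolding f_def form_simps
    using V ne ne[symmetric] ne' ne'[symmetric] adj adj[THEN adj_sym] nadj nadj' by (simp add: gram)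
  moreover have "b f f > 0"
    by (rule form_pos[of u]) (use V ne ne' in \<open>auto simp: f_def delta_def\<close>)
  ultimately show False by simp
qed

section \<open>The clique of an oriented diamond\<close>

context
  fixes a c u m R K
  assumes D: "oriented_diamond a c u m"
  defines "R \<equiv> {x \<in> V - {a, c, u, m}. adj a x \<and> adj u x}"
  defines "K \<equiv> insert u (insert a R)"
begin

text \<open>In the line graph picture \<open>K\<close> is the star of edges at the common end of
  \<open>a\<close> and \<open>u\<close>. The triangle side \<open>m\<close> is adjacent to both but
  lies outside this star.\<close>

lemma diamond_clique: "x \<in> K \<Longrightarrow> y \<in> K \<Longrightarrow> x \<noteq> y \<Longrightarrow> adj x y"
proof -
  have D': "adj a u" "adj u a" using D adj_commute[of u a] by (auto simp: oriented_diamond_def diamond_def)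
  have R: "adj x y" if "x \<in> R" "y \<in> R" "x \<noteq> y" for x y
    using oriented_diamond_outside(3)[OF D, of x y] that by (auto simp: R_def)
  have R': "adj a x" "adj u x" "adj x a" "adj x u" if "x \<in> R" for x
    using that adj_commute[of x a] adj_commute[of x u] by (auto simp: R_def)
  show "x \<in> K \<Longrightarrow> y \<in> K \<Longrightarrow> x \<noteq> y \<Longrightarrow> adj x y"
    using D' R R' by (auto simp: K_def)
qed

lemma diamond_clique_subset: "K \<subseteq> V"
  using D by (auto simp: oriented_diamond_def diamond_def K_def R_def)

text \<open>\<open>R\<close>, \<open>R'\<close> and \<open>P\<close> collect the outer neighbours at
  the three corners of the triangle. Equal valency of \<open>u\<close> and \<open>m\<close> gives
  \<open>R\<close> and \<open>R'\<close> the same size, and the valency of \<open>a\<close> then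
  determines it.\<close>

lemma diamond_clique_card: "2 * card K = k + 2"
proof -
  let ?S = "{a, c, u, m}"
  define R' where "R' = {x \<in> V - ?S. adj a x \<and> adj m x}"
  define P where "P = {x \<in> V - ?S. adj u x \<and> adj m x}"
  have V: "a \<in> V" "c \<in> V" "u \<in> V" "m \<in> V" and adj: "adj a u" "adj a m" "adj c u" "adj c m" "adj u m"
    "adj u a" "adj m a" "adj u c" "adj m c" "adj m u"
    and ne: "a \<noteq> c" "u \<noteq> m" and nadj: "\<not> adj a c" "\<not> adj c a" using D adj_sym by (auto simp: diamond_def oriented_diamond_def)
  have ne': "a \<noteq> u" "a \<noteq> m" "c \<noteq> u" "c \<noteq> m" using adj adj_irrefl by metis+
  have ori: "\<And>x. x \<in> V - ?S \<Longrightarrow> adj a x \<longleftrightarrow> (adj u x \<noteq> adj m x)"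
    using D by (auto simp: oriented_diamond_def)
  have fin: "finite R" "finite R'" "finite P" using finite_V by (auto simp: R_def R'_def P_def)
  have "{y \<in> V. adj a y} = {u, m} \<union> (R \<union> R')"
    using V adj nadj ori adj_irrefl by (auto simp: R_def R'_def)
  then have "card {y \<in> V. adj a y} = card ({u, m} \<union> (R \<union> R'))" by simp
  also have "\<dots> = card {u, m} + card (R \<union> R')"
    using fin by (intro card_Un_disjoint) (auto simp: R_def R'_def)
  also have "card (R \<union> R') = card R + card R'"
    using fin ori by (intro card_Un_disjoint) (auto simp: R_def R'_def)
  finally have 1: "k = 2 + (card R + card R')" using valency[OF V(1)] ne by simp
  have "{y \<in> V. adj u y} = {a, c, m} \<union> (R \<union> P)"
    using V adj nadj ori adj_irrefl by (auto simp: R_def P_def)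
  then have "card {y \<in> V. adj u y} = card ({a, c, m} \<union> (R \<union> P))" by simp
  also have "\<dots> = card {a, c, m} + card (R \<union> P)"
    using fin by (intro card_Un_disjoint) (auto simp: R_def P_def)
  also have "card (R \<union> P) = card R + card P"
    using fin ori by (intro card_Un_disjoint) (auto simp: R_def P_def)
  finally have 2: "k = 3 + (card R + card P)" using valency[OF V(3)] ne ne' by simp
  have "{y \<in> V. adj m y} = {a, c, u} \<union> (R' \<union> P)"
    using V adj nadj ori adj_irrefl by (auto simp: R'_def P_def)
  then have "card {y \<in> V. adj m y} = card ({a, c, u} \<union> (R' \<union> P))" by simp
  also have "\<dots> = card {a, c, u} + card (R' \<union> P)"
    using fin by (intro card_Un_disjoint) (auto simp: R'_def P_def)
  also have "card (R' \<union> P) = card R' + card P"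
    using fin ori by (intro card_Un_disjoint) (auto simp: R'_def P_def)
  finally have 3: "k = 3 + (card R' + card P)" using valency[OF V(4)] ne ne' by simp
  have "card K = card R + 2" using fin ne' by (simp add: K_def R_def)
  with 1 2 3 show ?thesis by simp
qed

text \<open>A vertex outside the star that meets two of its members closes a triangle with them.
  Besides the triangle of \<open>m\<close>, another one would form a bowtie.\<close>

lemma diamond_clique_escape:
  assumes z: "z \<in> V" "z \<notin> K" and xy: "x \<in> K" "y \<in> K" "x \<noteq> y" and adj: "adj z x" "adj z y"
  shows "z = m" "{x, y} = {u, a}"
proof -
  let ?S = "{a, c, u, m}"
  have V: "a \<in> V" "c \<in> V" "u \<in> V" "m \<in> V" and D': "adj a u" "adj a m" "adj u m" "\<not> adj a c" "adj u a" "adj m a" "\<not> adj c a"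
    using D adj_commute[of u a] adj_commute[of m a] adj_commute[of c a]
    by (auto simp: diamond_def oriented_diamond_def)
  have ori: "\<And>x. x \<in> V - ?S \<Longrightarrow> adj a x \<longleftrightarrow> (adj u x \<noteq> adj m x)"
    using D by (auto simp: oriented_diamond_def)
  have xz: "adj x z" "adj y z" using adj adj_sym by auto
  have "z = m \<and> {x, y} = {u, a}"
  proof (cases "z \<in> ?S")
    case True
    then have "z = m \<or> z = c" using z by (auto simp: K_def)
    moreover have "\<not> adj c r" "\<not> adj m r" if "r \<in> R" for r
      using that oriented_diamond_outside(1)[OF D, of r] ori[of r] by (auto simp: R_def)
    ultimately show ?thesis using xy adj D' by (auto simp: K_def)
  next
    case False
    then have zS: "z \<in> V - ?S" using z by auto
    have "\<not> (adj a z \<and> adj u z)" using zS z by (auto simp: K_def R_def)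
    \<comment> \<open>As \<open>z\<close> misses \<open>a\<close> or \<open>u\<close>, one of its
      two neighbours in \<open>K\<close> lies in \<open>R\<close>, where adjacencies are
      known.\<close>
    then obtain r where r: "r \<in> R" "adj r z"
      using xy xz by (auto simp: K_def)
    have rV: "r \<in> V - ?S" "adj a r" "adj u r" using r by (auto simp: R_def)
    have "\<not> (adj a z \<or> adj c z)"
      using oriented_diamond_outside(3)[OF D rV zS] r z \<open>\<not> (adj a z \<and> adj u z)\<close> by (auto simp: K_def)
    then have un: "\<not> adj a z" "\<not> adj u z" "\<not> adj m z"
      using oriented_diamond_outside(2)[OF D zS] by auto
    then have R: "x \<in> R" "y \<in> R" using xy xz by (auto simp: K_def)
    have "adj x y" using xy by (intro diamond_clique)
    have un': "\<not> adj z u" "\<not> adj z m" "\<not> adj z a"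
      using un adj_commute[of z u] adj_commute[of z m] adj_commute[of z a] by auto
    have "\<not> adj m x" "\<not> adj m y" using R ori by (auto simp: R_def)
    then have False
      using R V z zS un' D' adj \<open>adj x y\<close>
      by (intro no_bowtie[of u m a x y z]) (auto simp: R_def)
    then show ?thesis ..
  qed
  then show "z = m" "{x, y} = {u, a}" by auto
qed

end

end

section \<open>Linear spaces with a positive definite form\<close>

text \<open>Gaussian elimination: equation \<open>w\<close> is solved for one unknown
  \<open>q\<close>, which \<open>M'\<close> eliminates from the other equations and \<open>h\<close>
  restores afterwards.\<close>

lemma homogeneous_system_solution:
  fixes M :: "'b \<Rightarrow> 'a \<Rightarrow> real"
  assumes "finite L" "finite K" "card L < card K"
  shows "\<exists>f. (\<exists>p \<in> K. f p \<noteq> 0) \<and> (\<forall>p. p \<notin> K \<longrightarrow> f p = 0) \<and> (\<forall>w \<in> L. (\<Sum>p \<in> K. M w p * f p) = 0)"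
  using assms
proof (induction L arbitrary: K M rule: finite_induct)
  case empty
  then obtain p where "p \<in> K" by fastforce
  then show ?case by (intro exI[of _ "\<lambda>q. if q = p then 1 else 0"]) auto
next
  case (insert w L)
  show ?case
  proof (cases "\<forall>p \<in> K. M w p = 0")
    case True
    have "card L < card K" using insert by simp
    from insert.IH[OF \<open>finite K\<close> this, of M] obtain f where f:
      "\<exists>p \<in> K. f p \<noteq> 0" "\<forall>p. p \<notin> K \<longrightarrow> f p = 0" "\<forall>v \<in> L. (\<Sum>p \<in> K. M v p * f p) = 0" by blast
    have "(\<Sum>p \<in> K. M w p * f p) = 0" using True by (intro sum.neutral) auto
    then show ?thesis using f by blast
  next
    case False
    then obtain q where q: "q \<in> K" "M w q \<noteq> 0" by blast
    define M' where "M' v p = M v p - M v q * M w p / M w q" for v p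
    have "card L < card (K - {q})" using insert q by simp
    from insert.IH[OF _ this, of M'] insert.prems obtain f where
      f: "\<exists>p \<in> K - {q}. f p \<noteq> 0" "\<And>p. p \<notin> K - {q} \<Longrightarrow> f p = 0"
      "\<And>v. v \<in> L \<Longrightarrow> (\<Sum>p \<in> K - {q}. M' v p * f p) = 0" by auto
    define s where "s = (\<Sum>p \<in> K - {q}. M w p * f p)"
    define h where "h = f(q := - s / M w q)"
    have sum_h: "(\<Sum>p \<in> K. M v p * h p) = (\<Sum>p \<in> K - {q}. M v p * f p) - M v q * s / M w q" for v
    proof -
      have "(\<Sum>p \<in> K. M v p * h p) = M v q * h q + (\<Sum>p \<in> K - {q}. M v p * h p)"
        using q insert.prems by (intro sum.remove) auto
      also have "(\<Sum>p \<in> K - {q}. M v p * h p) = (\<Sum>p \<in> K - {q}. M v p * f p)"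
        by (rule sum.cong) (auto simp: h_def)
      finally show ?thesis by (simp add: h_def)
    qed
    have "(\<Sum>p \<in> K. M v p * h p) = 0" if "v \<in> insert w L" for v
    proof (cases "v = w")
      case True
      then show ?thesis using q by (simp add: sum_h s_def[symmetric])
    next
      case False
      then have "0 = (\<Sum>p \<in> K - {q}. M' v p * f p)" using f that by auto
      also have "\<dots> = (\<Sum>p \<in> K - {q}. M v p * f p) - (\<Sum>p \<in> K - {q}. M v q / M w q * (M w p * f p))"
        unfolding sum_subtractf[symmetric] by (rule sum.cong) (auto simp: M'_def algebra_simps)
      also have "(\<Sum>p \<in> K - {q}. M v q / M w q * (M w p * f p)) = M v q * s / M w q"
        unfolding sum_distrib_left[symmetric] by (simp add: s_def)
      finally show ?thesis by (simp add: sum_h)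
    qed
    moreover have "\<exists>p \<in> K. h p \<noteq> 0" using f(1) by (auto simp: h_def)
    moreover have "h p = 0" if "p \<notin> K" for p using f(2) that q by (auto simp: h_def)
    ultimately show ?thesis by blast
  qed
qed

text \<open>Incidence is adjacency, so \<open>N x\<close> also indexes the lines through
  \<open>x\<close>, and points and lines are the same set.\<close>

locale linear_graph =
  fixes V :: "'a set" and N :: "'a \<Rightarrow> 'a set" and d :: nat
  assumes finite_V: "finite V"
    and N_subset: "v \<in> V \<Longrightarrow> N v \<subseteq> V"
    and N_sym: "x \<in> V \<Longrightarrow> y \<in> N x \<Longrightarrow> x \<in> N y"
    and N_card: "v \<in> V \<Longrightarrow> card (N v) = d"
    and N_linear: "x \<in> V \<Longrightarrow> y \<in> V \<Longrightarrow> x \<noteq> y \<Longrightarrow> card (N x \<inter> N y) \<le> 1"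
    and d_ge: "d \<ge> 3"
begin

lemma N_iff: "x \<in> V \<Longrightarrow> y \<in> V \<Longrightarrow> y \<in> N x \<longleftrightarrow> x \<in> N y"
  using N_sym by blast

lemma finite_N: "v \<in> V \<Longrightarrow> finite (N v)"
  using N_subset finite_V finite_subset by blast

lemma N_inter_unique:
  assumes "x \<in> V" "y \<in> V" "x \<noteq> y" "p \<in> N x" "p \<in> N y" "q \<in> N x" "q \<in> N y"
  shows "p = q"
proof (rule ccontr)
  assume "p \<noteq> q"
  then have "card {p, q} \<le> card (N x \<inter> N y)"
    using assms finite_N by (intro card_mono) auto
  with N_linear[of x y] assms \<open>p \<noteq> q\<close> show False by simp
qed

definition col :: "'a \<Rightarrow> 'a \<Rightarrow> bool" where
  "col x y \<longleftrightarrow> x \<noteq> y \<and> (\<exists>w \<in> V. x \<in> N w \<and> y \<in> N w)"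

lemma col_sym: "col x y \<Longrightarrow> col y x"
  by (auto simp: col_def)

lemma col_in_V: "col x y \<Longrightarrow> x \<in> V" "col x y \<Longrightarrow> y \<in> V"
  using N_subset by (auto simp: col_def)

text \<open>The bilinear form of \<open>A^2 - (d - 2) I\<close>; the first sum is the inner product
  of \<open>A f\<close> and \<open>A g\<close>.\<close>

definition form :: "('a \<Rightarrow> real) \<Rightarrow> ('a \<Rightarrow> real) \<Rightarrow> real" where
  "form f g = (\<Sum>w \<in> V. (\<Sum>p \<in> N w. f p) * (\<Sum>p \<in> N w. g p)) - (real d - 2) * (\<Sum>p \<in> V. f p * g p)"

text \<open>Through \<open>x\<close> pass \<open>d\<close> lines with \<open>d - 1\<close> further
  points each, and two of these lines share only \<open>x\<close>.\<close>

lemma col_card: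
  assumes x: "x \<in> V"
  shows "card {y \<in> V. col x y} = d * (d - 1)"
proof -
  have "{y \<in> V. col x y} = (\<Union>w \<in> N x. N w - {x})"
  proof (intro equalityI subsetI)
    fix y assume "y \<in> {y \<in> V. col x y}"
    then obtain w where "w \<in> V" "x \<in> N w" "y \<in> N w" "y \<noteq> x" by (auto simp: col_def)
    then show "y \<in> (\<Union>w \<in> N x. N w - {x})" using N_sym by blast
  next
    fix y assume "y \<in> (\<Union>w \<in> N x. N w - {x})"
    then obtain w where w: "w \<in> N x" "y \<in> N w" "y \<noteq> x" by blast
    then have "w \<in> V" "x \<in> N w" using x N_subset N_sym by blast+
    then show "y \<in> {y \<in> V. col x y}" using w N_subset by (auto simp: col_def)
  qed
  also have "card \<dots> = (\<Sum>w \<in> N x. card (N w - {x}))"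
  proof (rule card_UN_disjoint)
    show "finite (N x)" using finite_N x by auto
    show "\<forall>w \<in> N x. finite (N w - {x})" using finite_N N_subset x by auto
    show "\<forall>w \<in> N x. \<forall>w' \<in> N x. w \<noteq> w' \<longrightarrow> (N w - {x}) \<inter> (N w' - {x}) = {}"
    proof (intro ballI impI)
      fix w w' assume w: "w \<in> N x" "w' \<in> N x" "w \<noteq> w'"
      then have "w \<in> V" "w' \<in> V" "x \<in> N w" "x \<in> N w'" using N_subset N_sym x by blast+
      with w show "(N w - {x}) \<inter> (N w' - {x}) = {}" using N_inter_unique[of w w' x] by blast
    qed
  qed
  also have "\<dots> = (\<Sum>w \<in> N x. d - 1)"
  proof (rule sum.cong)
    fix w assume "w \<in> N x"
    then have "w \<in> V" "x \<in> N w" using N_subset N_sym x by blast+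
    then show "card (N w - {x}) = d - 1" using N_card finite_N by simp
  qed simp
  finally show ?thesis using N_card[OF x] by simp
qed

lemma sum_delta_N: "w \<in> V \<Longrightarrow> (\<Sum>p \<in> N w. delta x p) = of_bool (x \<in> N w)"
  using finite_N by (simp add: delta_def sum.delta)

lemma form_delta:
  assumes "x \<in> V" "y \<in> V"
  shows "form (delta x) (delta y) = (if x = y then 2 else if col x y then 1 else 0)"
proof -
  have "(\<Sum>w \<in> V. (\<Sum>p \<in> N w. delta x p) * (\<Sum>p \<in> N w. delta y p)) =
    (\<Sum>w \<in> V. of_bool (w \<in> N x \<inter> N y))"
    by (rule sum.cong) (use assms N_iff in \<open>auto simp: sum_delta_N\<close>)
  also have "\<dots> = card (N x \<inter> N y)"
  proof -
    have "V \<inter> {w. w \<in> N x \<inter> N y} = N x \<inter> N y" using assms N_subset by auto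
    then show ?thesis using finite_V by (simp add: sum.If_cases of_bool_def)
  qed
  finally have 1: "(\<Sum>w \<in> V. (\<Sum>p \<in> N w. delta x p) * (\<Sum>p \<in> N w. delta y p)) = card (N x \<inter> N y)" .
  have "(\<Sum>p \<in> V. delta x p * delta y p) = (\<Sum>p \<in> V. if p = x then delta y x else 0)"
    by (rule sum.cong) (auto simp: delta_def)
  also have "\<dots> = of_bool (x = y)" using assms finite_V by (auto simp: delta_def)
  finally have 2: "(\<Sum>p \<in> V. delta x p * delta y p) = of_bool (x = y)" .
  have "card (N x \<inter> N y) = of_bool (col x y)" if "x \<noteq> y"
  proof (cases "col x y")
    case True
    then have "N x \<inter> N y \<noteq> {}" using assms N_iff by (auto simp: col_def)
    then have "card (N x \<inter> N y) \<noteq> 0" using finite_N assms by simp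
    then show ?thesis using N_linear[of x y] assms that True by simp
  next
    case False
    have "\<not> (w \<in> N x \<and> w \<in> N y)" for w
      using False assms that N_sym[of x w] N_sym[of y w] N_subset[of x] by (auto simp: col_def)
    then have "N x \<inter> N y = {}" by auto
    then show ?thesis using False by simp
  qed
  then show ?thesis unfolding form_def 1 2 using N_card assms by auto
qed

end

section \<open>Cliques closed under lines and complete components\<close>

locale posdef_linear_graph = linear_graph +
  assumes form_pos: "x \<in> V \<Longrightarrow> f x \<noteq> 0 \<Longrightarrow> form f f > 0"
begin

sublocale root_graph V form col "d * (d - 1)"
proof unfold_locales
  show "form (\<lambda>v. f v + g v) h = form f h + form g h" for f g h
    by (simp add: form_def sum.distrib algebra_simps)
  show "form (\<lambda>v. c * f v) h = c * form f h" for c f h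
    by (simp add: form_def sum_distrib_left[symmetric] mult.assoc right_diff_distrib)
  show "form f g = form g f" for f g
    by (simp add: form_def mult.commute)
  have "3 * 2 \<le> d * (d - 1)" using d_ge by (intro mult_le_mono) auto
  then show "6 \<le> d * (d - 1)" by simp
  show "\<not> col x x" for x by (simp add: col_def)
qed (rule form_pos finite_V col_sym form_delta col_card; assumption)+

text \<open>If \<open>f\<close> lives on \<open>K\<close> and vanishes on its lines, only the other
  lines contribute to \<open>form\<close>. Each of them meets \<open>K\<close> in at most one point,
  and a point lies on at most \<open>d - 2\<close> of them, the multiple of the norm that
  \<open>form\<close> subtracts. The conclusion concerns a single point because collinearity may
  have several components.\<close>

lemma no_proper_subspace:
  assumes K: "K \<subseteq> V" "K \<noteq> {}"
    and clique: "\<And>x y. x \<in> K \<Longrightarrow> y \<in> K \<Longrightarrow> x \<noteq> y \<Longrightarrow> col x y"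
    and closed: "\<And>w x y. w \<in> V \<Longrightarrow> x \<in> K \<Longrightarrow> y \<in> K \<Longrightarrow> x \<noteq> y \<Longrightarrow> x \<in> N w \<Longrightarrow> y \<in> N w \<Longrightarrow> N w \<subseteq> K"
    and noline: "\<And>w. w \<in> V \<Longrightarrow> \<not> K \<subseteq> N w"
  shows "\<exists>p \<in> K. {y \<in> V. col p y} \<subseteq> K"
proof (rule ccontr)
  assume neg: "\<not> ?thesis"
  define L where "L = {w \<in> V. N w \<subseteq> K}"
  define r where "r p = card {w \<in> L. p \<in> N w}" for p
  have finK: "finite K" using K finite_V finite_subset by blast
  have finL: "finite L" using finite_V by (simp add: L_def)
  \<comment> \<open>Two lines of \<open>L\<close> pass through \<open>p\<close> because
    \<open>K\<close> is not inside one line. The line from \<open>p\<close> to a collinear point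
    outside \<open>K\<close> is missing from \<open>L\<close>.\<close>
  have r_ge: "r p \<ge> 2" and r_le: "r p \<le> d - 1" if p: "p \<in> K" for p
  proof -
    have pV: "p \<in> V" using p K by auto
    have join: "\<exists>w \<in> L. p \<in> N w \<and> q \<in> N w" if "q \<in> K" "q \<noteq> p" for q
      using clique[OF p that(1)] closed[OF _ p that(1)] that by (auto simp: col_def L_def)
    have "N p \<noteq> {}" using N_card[OF pV] d_ge by auto
    then obtain w0 where "w0 \<in> N p" by blast
    then have "w0 \<in> V" "p \<in> N w0" using N_subset N_sym pV by auto
    with noline obtain q where q: "q \<in> K" "q \<noteq> p" by blast
    obtain w where w: "w \<in> L" "p \<in> N w" "q \<in> N w" using join[OF q] by blast
    then have "w \<in> V" by (simp add: L_def)
    with noline obtain x where x: "x \<in> K" "x \<notin> N w" by blast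
    with w have "x \<noteq> p" by auto
    obtain w' where w': "w' \<in> L" "p \<in> N w'" "x \<in> N w'" using join[OF x(1) \<open>x \<noteq> p\<close>] by blast
    have "w \<noteq> w'" using x w' by auto
    then have "card {w, w'} \<le> r p" unfolding r_def using w w' finL by (intro card_mono) auto
    with \<open>w \<noteq> w'\<close> show "r p \<ge> 2" by simp
    obtain y where y: "y \<notin> K" "col p y" using neg p by blast
    then obtain v where v: "v \<in> V" "p \<in> N v" "y \<in> N v" by (auto simp: col_def)
    then have "v \<notin> L" using y by (auto simp: L_def)
    then have "{w \<in> L. p \<in> N w} \<subseteq> N p - {v}" using N_sym by (auto simp: L_def)
    then have "r p \<le> card (N p - {v})"
      unfolding r_def by (rule card_mono[rotated]) (use finite_N pV in auto)
    also have "\<dots> = d - 1" using v N_sym N_card[OF pV] finite_N pV by simp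
    finally show "r p \<le> d - 1" .
  qed
  have "d * card L = (\<Sum>w \<in> L. card (N w))" using N_card by (simp add: L_def)
  also have "\<dots> = (\<Sum>w \<in> L. \<Sum>p \<in> K. of_bool (p \<in> N w))"
  proof (rule sum.cong)
    fix w assume "w \<in> L"
    then have "K \<inter> {p. p \<in> N w} = N w" by (auto simp: L_def)
    then show "card (N w) = (\<Sum>p \<in> K. of_bool (p \<in> N w))"
      using finK by (simp add: of_bool_def sum.If_cases)
  qed simp
  also have "\<dots> = (\<Sum>p \<in> K. r p)"
    by (subst sum.swap) (use finL in \<open>simp add: r_def of_bool_def sum.If_cases Int_def\<close>)
  also have "\<dots> \<le> (\<Sum>p \<in> K. d - 1)" by (rule sum_mono) (rule r_le)
  also have "\<dots> < d * card K" using finK K d_ge by (simp add: card_gt_0_iff algebra_simps diff_mult_distrib2)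
  finally have "card L < card K" by simp
  from homogeneous_system_solution[OF finL finK this, of "\<lambda>w p. of_bool (p \<in> N w)"]
  obtain f :: "'a \<Rightarrow> real" where f: "\<exists>p \<in> K. f p \<noteq> 0" "\<And>p. p \<notin> K \<Longrightarrow> f p = 0"
    "\<And>w. w \<in> L \<Longrightarrow> (\<Sum>p \<in> K. of_bool (p \<in> N w) * f p) = 0" by blast
  have line_sum: "(\<Sum>p \<in> N w. f p) = (\<Sum>p \<in> K. of_bool (p \<in> N w) * f p)" if "w \<in> V" for w
  proof -
    have "(\<Sum>p \<in> N w. f p) = (\<Sum>p \<in> K \<inter> N w. f p)"
      by (rule sum.mono_neutral_right) (use f(2) finite_N that in auto)
    also have "\<dots> = (\<Sum>p \<in> K. of_bool (p \<in> N w) * f p)"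
      by (rule sum.mono_neutral_cong_left) (use finK in auto)
    finally show ?thesis .
  qed
  have sq: "(\<Sum>p \<in> N w. f p) * (\<Sum>p \<in> N w. f p) = (\<Sum>p \<in> K. of_bool (p \<in> N w \<and> w \<notin> L) * (f p * f p))"
    if w: "w \<in> V" for w
  proof (cases "w \<in> L")
    case True
    then show ?thesis using f(3)[OF True] line_sum[OF w] by simp
  next
    case False
    have "\<forall>x \<in> K \<inter> N w. \<forall>y \<in> K \<inter> N w. x = y"
      using closed[OF w] False w by (auto simp: L_def)
    then consider "K \<inter> N w = {}" | p where "K \<inter> N w = {p}" by (metis is_singletonI' is_singleton_the_elem)
    then show ?thesis
    proof cases
      case 1
      then have "(\<Sum>q \<in> K. of_bool (q \<in> N w) * f q) = 0"
        "(\<Sum>q \<in> K. of_bool (q \<in> N w \<and> w \<notin> L) * (f q * f q)) = 0"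
        by (auto intro!: sum.neutral)
      then show ?thesis using line_sum[OF w] by simp
    next
      case (2 p)
      have "(\<Sum>q \<in> K. of_bool (q \<in> N w) * f q) = (\<Sum>q \<in> {p}. f q)"
        by (rule sum.mono_neutral_cong_right) (use 2 finK in auto)
      moreover have "(\<Sum>q \<in> K. of_bool (q \<in> N w \<and> w \<notin> L) * (f q * f q)) = (\<Sum>q \<in> {p}. f q * f q)"
        by (rule sum.mono_neutral_cong_right) (use 2 finK False in auto)
      ultimately show ?thesis using line_sum[OF w] by simp
    qed
  qed
  have deg: "real (card {w \<in> V. p \<in> N w \<and> w \<notin> L}) \<le> real d - 2" if p: "p \<in> K" for p
  proof -
    have pV: "p \<in> V" using p K by auto
    have "{w \<in> V. p \<in> N w \<and> w \<notin> L} = N p - {w \<in> L. p \<in> N w}"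
      using pV N_iff N_subset by (auto simp: L_def)
    moreover have "{w \<in> L. p \<in> N w} \<subseteq> N p" using N_sym by (auto simp: L_def)
    ultimately have "card {w \<in> V. p \<in> N w \<and> w \<notin> L} = d - r p"
      using N_card[OF pV] finL by (simp add: card_Diff_subset r_def)
    then show ?thesis using r_ge[OF p] r_le[OF p] d_ge by linarith
  qed
  have "(\<Sum>w \<in> V. (\<Sum>p \<in> N w. f p) * (\<Sum>p \<in> N w. f p)) =
     (\<Sum>w \<in> V. \<Sum>p \<in> K. of_bool (p \<in> N w \<and> w \<notin> L) * (f p * f p))"
    by (rule sum.cong) (auto simp: sq)
  also have "\<dots> = (\<Sum>p \<in> K. real (card {w \<in> V. p \<in> N w \<and> w \<notin> L}) * (f p * f p))"
    by (subst sum.swap) (use finite_V in \<open>simp add: sum_distrib_right[symmetric] of_bool_def sum.If_cases Int_def\<close>)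
  also have "\<dots> \<le> (\<Sum>p \<in> K. (real d - 2) * (f p * f p))"
    by (rule sum_mono) (use deg in \<open>auto intro!: mult_right_mono\<close>)
  also have "\<dots> = (real d - 2) * (\<Sum>p \<in> V. f p * f p)"
    unfolding sum_distrib_left[symmetric]
    by (rule arg_cong[where f = "\<lambda>s. _ * s"], rule sum.mono_neutral_left) (use K finite_V f(2) in auto)
  finally have "form f f \<le> 0" by (simp add: form_def)
  moreover have "form f f > 0" using f(1) K form_pos by blast
  ultimately show False by simp
qed

text \<open>The clique has \<open>d * (d - 1) / 2 + 1\<close> points, too few to contain all
  neighbours of one of them. It can fail to be closed under lines only if \<open>u\<close>,
  \<open>a\<close>, \<open>m\<close> are a full line, so \<open>d = 3\<close>; then \<open>u\<close>
  has too many neighbours.\<close>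

lemma no_diamond: "\<not> diamond a c u m"
proof
  assume "diamond a c u m"
  then obtain a c where D: "oriented_diamond a c u m" using diamond_orientation by blast
  define R where "R = {x \<in> V - {a, c, u, m}. col a x \<and> col u x}"
  define K where "K = insert u (insert a R)"
  note clique = diamond_clique[OF D, folded R_def, folded K_def]
  note escape = diamond_clique_escape[OF D, folded R_def, folded K_def]
  have card2: "2 * card K = d * (d - 1) + 2" and KV: "K \<subseteq> V"
    using diamond_clique_card[OF D] diamond_clique_subset[OF D] by (simp_all add: K_def R_def)
  have V: "a \<in> V" "c \<in> V" "u \<in> V" "m \<in> V" and ne: "a \<noteq> c" "u \<noteq> m" and nac: "\<not> col a c"
    and adj: "col a u" "col a m" "col c u" "col c m" "col u m"
    using D by (auto simp: oriented_diamond_def diamond_def)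
  have ne': "a \<noteq> u" "a \<noteq> m" "c \<noteq> u" "c \<noteq> m" using adj by (auto simp: col_def)
  have mK: "m \<notin> K" using ne ne' by (auto simp: K_def R_def)
  have finK: "finite K" using KV finite_V finite_subset by blast
  have "\<exists>p \<in> K. {y \<in> V. col p y} \<subseteq> K"
  proof (rule no_proper_subspace)
    show "K \<subseteq> V" "K \<noteq> {}" using KV by (auto simp: K_def)
    show "col x y" if "x \<in> K" "y \<in> K" "x \<noteq> y" for x y using clique that .
    show "\<not> K \<subseteq> N w" if w: "w \<in> V" for w
    proof
      assume "K \<subseteq> N w"
      then have "card K \<le> d" using N_card[OF w] finite_N[OF w] card_mono by metis
      with card2 have "d * (d - 1) + 2 \<le> 2 * d" by simp
      moreover have "d * (d - 1) \<ge> d * 2" using d_ge by (intro mult_le_mono2) simp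
      ultimately show False by linarith
    qed
    show "N w \<subseteq> K" if w: "w \<in> V" and x: "x \<in> K" "y \<in> K" "x \<noteq> y" "x \<in> N w" "y \<in> N w" for w x y
    proof (rule ccontr)
      assume "\<not> N w \<subseteq> K"
      then obtain z where z: "z \<in> N w" "z \<notin> K" by blast
      have on_line: "col p q" if "p \<in> N w" "q \<in> N w" "p \<noteq> q" for p q
        using that w by (auto simp: col_def)
      have zV: "z \<in> V" using z w N_subset by auto
      have "z \<noteq> x" "z \<noteq> y" using z x by auto
      then have "z = m" "{x, y} = {u, a}" using escape[OF zV z(2) x(1-3)] on_line z x by auto
      then have uam: "u \<in> N w" "a \<in> N w" "m \<in> N w" using x z by auto
      have line: "N w = {u, a, m}"
      proof (rule ccontr)
        assume "N w \<noteq> {u, a, m}"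
        then obtain q where q: "q \<in> N w" "q \<notin> {u, a, m}" using uam by blast
        then have qV: "q \<in> V" using w N_subset by auto
        have uaK: "u \<in> K" "a \<in> K" by (auto simp: K_def)
        have "q \<in> K" using escape(1)[OF qV _ uaK] q uam on_line ne' by blast
        then have "{u, q} = {u, a}"
          using escape(2)[OF V(4) mK uaK(1), of q] q uam on_line ne by auto
        then show False using q by auto
      qed
      have unique: "w' = w" if "w' \<in> V" "u \<in> N w'" "m \<in> N w'" for w'
        using N_inter_unique[of w' w u m] that w uam ne by blast
      have d3: "d = 3" using N_card[OF w] line ne ne' by simp
      have ori: "\<And>x. x \<in> V - {a, c, u, m} \<Longrightarrow> col a x \<longleftrightarrow> (col u x \<noteq> col m x)"
        using D by (auto simp: oriented_diamond_def)
      \<comment> \<open>The lines from \<open>c\<close> to \<open>u\<close> and to \<open>m\<close>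
        have one further point each. Both points are collinear with \<open>u\<close>, in the case of
        \<open>m\<close> by the orientation, and raise the neighbours of \<open>u\<close> to seven
        against a valency of six.\<close>
      have third: "\<exists>w' \<in> V. \<exists>z. N w' = {s, c, z} \<and> z \<in> V - {a, c, u, m} \<and> col u z \<and> \<not> col a z"
        if s: "s \<in> {u, m}" for s
      proof -
        have "col c s" "s \<noteq> c" using s adj ne' by auto
        then obtain w' where w': "w' \<in> V" "c \<in> N w'" "s \<in> N w'" by (auto simp: col_def)
        have "card (N w' - {s, c}) = 1"
          using N_card[OF w'(1)] d3 w' \<open>s \<noteq> c\<close> finite_N by (subst card_Diff_subset) auto
        then obtain z where z: "N w' - {s, c} = {z}" by (auto simp: card_1_singleton_iff)
        then have Nw': "N w' = {s, c, z}" and zs: "z \<noteq> s" "z \<noteq> c" and zV: "z \<in> V"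
          using w' N_subset[OF w'(1)] by auto
        have cz: "col c z" "col s z" using Nw' w' zs by (auto simp: col_def)
        then have "z \<noteq> a" using nac col_sym by blast
        moreover have "z \<noteq> u \<and> z \<noteq> m"
        proof (rule ccontr)
          assume "\<not> ?thesis"
          then have "w' = w" using unique[of w'] w' Nw' zs s by auto
          then show False using w' line ne ne' by auto
        qed
        ultimately have zS: "z \<in> V - {a, c, u, m}" using zV zs by auto
        then have "\<not> col a z" using oriented_diamond_outside(1)[OF D zS] cz by blast
        moreover have "col u z" using ori[OF zS] calculation cz s by auto
        ultimately show ?thesis using w' Nw' zS by blast
      qed
      obtain w1 z1 where w1: "w1 \<in> V" "N w1 = {u, c, z1}" "z1 \<in> V - {a, c, u, m}" "col u z1" "\<not> col a z1"
        using third[of u] by auto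
      obtain w2 z2 where w2: "w2 \<in> V" "N w2 = {m, c, z2}" "z2 \<in> V - {a, c, u, m}" "col u z2" "\<not> col a z2"
        using third[of m] by auto
      have "z1 \<noteq> z2"
      proof
        assume "z1 = z2"
        have "w1 \<noteq> w2"
        proof
          assume "w1 = w2"
          then have "m \<in> N w1" using w2 by auto
          then have "w1 = w" using unique[of w1] w1 by auto
          then show False using w1 line ne ne' by auto
        qed
        then show False using N_inter_unique[of w1 w2 c z1] w1 w2 \<open>z1 = z2\<close> by auto
      qed
      have "card R = 2"
      proof -
        have "card K = card R + 2"
          using finK ne' by (simp add: K_def R_def)
        then show ?thesis using card2 d3 by simp
      qed
      have "{a, c, m, z1, z2} \<union> R \<subseteq> {y \<in> V. col u y}"
        using V adj(5) col_sym[OF adj(1)] col_sym[OF adj(3)] w1 w2 by (auto simp: R_def)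
      then have "card ({a, c, m, z1, z2} \<union> R) \<le> card {y \<in> V. col u y}"
        using finite_V by (intro card_mono) auto
      moreover have "card ({a, c, m, z1, z2} \<union> R) = card {a, c, m, z1, z2} + card R"
        by (rule card_Un_disjoint) (use w1 w2 finite_V in \<open>auto simp: R_def\<close>)
      moreover have "card {a, c, m, z1, z2} = 5" using w1(3) w2(3) ne(1) ne'(2,4) \<open>z1 \<noteq> z2\<close> by (auto simp: card_insert_if)
      ultimately show False using \<open>card R = 2\<close> col_card[OF V(3)] d3 by simp
    qed
  qed
  then obtain p where p: "p \<in> K" "{y \<in> V. col p y} \<subseteq> K" by blast
  then have "{y \<in> V. col p y} \<subseteq> K - {p}" by (auto simp: col_def)
  then have "card {y \<in> V. col p y} \<le> card (K - {p})" using finK by (intro card_mono) auto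
  then have "d * (d - 1) \<le> card K - 1" using col_card[of p] p KV finK by auto
  moreover have "d * (d - 1) > 0" using d_ge by simp
  ultimately show False using card2 by linarith
qed

text \<open>Three lines through \<open>u\<close> and the absence of claws give a triangle
  \<open>u\<close>, \<open>a\<close>, \<open>a'\<close> not on a line. The points joined to both
  \<open>u\<close> and \<open>a\<close> form a clique closed under lines. One of them has all its
  neighbours inside, which fixes the size of the clique; counting then closes it under
  collinearity.\<close>

lemma complete_component:
  assumes "V \<noteq> {}"
  shows "\<exists>K \<subseteq> V. K \<noteq> {} \<and> card K = d * (d - 1) + 1 \<and> (\<forall>x \<in> K. \<forall>y \<in> K. x \<noteq> y \<longrightarrow> col x y) \<and>
    (\<forall>x \<in> K. \<forall>y. col x y \<longrightarrow> y \<in> K)"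
proof -
  obtain u where u: "u \<in> V" using assms by blast
  obtain W where "W \<subseteq> N u" "card W = 3"
    using N_card[OF u] d_ge by (metis obtain_subset_with_card_n)
  then obtain w1 w2 w3 where w: "w1 \<in> N u" "w2 \<in> N u" "w3 \<in> N u" "w1 \<noteq> w2" "w1 \<noteq> w3" "w2 \<noteq> w3"
    by (auto simp: card_3_iff)
  have pick: "\<exists>a. a \<in> N w \<and> a \<noteq> u" if "w \<in> N u" for w
  proof (rule ccontr)
    assume "\<not> ?thesis"
    then have "N w \<subseteq> {u}" by auto
    then have "card (N w) \<le> 1" using card_mono[of "{u}" "N w"] by simp
    then show False using N_card[of w] that N_subset u d_ge by fastforce
  qed
  obtain a1 a2 a3 where a: "a1 \<in> N w1" "a1 \<noteq> u" "a2 \<in> N w2" "a2 \<noteq> u" "a3 \<in> N w3" "a3 \<noteq> u"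
    using pick w by meson
  have not_both: "\<not> (p \<in> N v \<and> p \<in> N v')" if "v \<in> N u" "v' \<in> N u" "v \<noteq> v'" "p \<noteq> u" for v v' p
    using N_inter_unique[of v v' u p] that N_subset[OF u] N_sym[OF u] by blast
  have wV: "w1 \<in> V" "w2 \<in> V" "w3 \<in> V" and uw: "u \<in> N w1" "u \<in> N w2" "u \<in> N w3"
    using w N_subset[OF u] N_sym[OF u] by auto
  have cola: "col u a1" "col u a2" "col u a3" using a wV uw by (auto simp: col_def)
  have "a1 \<noteq> a2" "a1 \<noteq> a3" "a2 \<noteq> a3" using a w not_both by metis+
  then have "col a1 a2 \<or> col a1 a3 \<or> col a2 a3"
    using no_claw[of u a1 a2 a3] cola col_in_V by blast
  then obtain v v' a a' where v: "v \<in> N u" "v' \<in> N u" "v \<noteq> v'" "a \<in> N v" "a' \<in> N v'" "a \<noteq> u" "a' \<noteq> u" "col a a'"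
    using w a by metis
  have vV: "v \<in> V" "v' \<in> V" "u \<in> N v" "u \<in> N v'" using v N_subset[OF u] N_sym[OF u] by auto
  have ua: "col u a" "col u a'" using v vV by (auto simp: col_def)
  define K where "K = {x \<in> V. (x = u \<or> col u x) \<and> (x = a \<or> col a x)}"
  have KV: "K \<subseteq> V" by (auto simp: K_def)
  have inK: "u \<in> K" "a \<in> K" "a' \<in> K"
    using u ua v(8) col_sym[OF ua(1)] col_in_V(2)[OF ua(1)] col_in_V(2)[OF ua(2)] by (auto simp: K_def)
  have clique: "col x y" if xy: "x \<in> K" "y \<in> K" "x \<noteq> y" for x y
  proof (rule ccontr)
    assume n: "\<not> col x y"
    then have "x \<noteq> u" "y \<noteq> u" "x \<noteq> a" "y \<noteq> a" using xy col_sym[of y x] by (auto simp: K_def)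
    then have "diamond x y u a"
      using n xy ua u inK KV col_sym[of u x] col_sym[of u y] col_sym[of a x] col_sym[of a y] \<open>a \<noteq> u\<close>
      by (auto simp: K_def diamond_def)
    then show False using no_diamond by blast
  qed
  \<comment> \<open>Absence of diamonds as a transfer rule: whatever equals or is joined to both
    ends of a collinear pair is pairwise equal or joined.\<close>
  have through: "t = z \<or> col t z" if "x \<noteq> y" "t = x \<or> col t x" "t = y \<or> col t y" "col x y" "z = x \<or> col x z" "z = y \<or> col y z" "t \<in> V" for t x y z
  proof (rule ccontr)
    assume n: "\<not> ?thesis"
    then have "t \<noteq> x" "t \<noteq> y" "z \<noteq> x" "z \<noteq> y" using that col_sym[of x t] col_sym[of y t] by auto
    then have "diamond t z x y"
      using n that col_sym[of x z] col_sym[of y z] col_in_V(2)[of x z] col_in_V[of x y]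
      by (auto simp: diamond_def)
    then show False using no_diamond by blast
  qed
  have "\<exists>p \<in> K. {y \<in> V. col p y} \<subseteq> K"
  proof (rule no_proper_subspace)
    show "K \<subseteq> V" "K \<noteq> {}" using KV inK by auto
    show "col x y" if "x \<in> K" "y \<in> K" "x \<noteq> y" for x y using clique that .
    show "\<not> K \<subseteq> N w" if wV: "w \<in> V" for w
    proof
      assume "K \<subseteq> N w"
      then have "u \<in> N w" "a \<in> N w" "a' \<in> N w" using inK by auto
      then have "w = v" "w = v'"
        using N_inter_unique[of w v u a] N_inter_unique[of w v' u a'] vV v wV by auto
      then show False using v by simp
    qed
    show "N w \<subseteq> K" if w: "w \<in> V" and x: "x \<in> K" "y \<in> K" "x \<noteq> y" "x \<in> N w" "y \<in> N w" for w x y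
    proof
      fix z assume z: "z \<in> N w"
      have zx: "z = x \<or> col x z" "z = y \<or> col y z" using z x w by (auto simp: col_def)
      have "t = z \<or> col t z" if "t \<in> {u, a}" for t
      proof -
        have t: "t = x \<or> col t x" "t = y \<or> col t y" using x(1,2) that by (auto simp: K_def)
        have "t \<in> V" using that inK KV by auto
        then show ?thesis using through[OF x(3) t clique[OF x(1-3)] zx] by blast
      qed
      then show "z \<in> K" using z w N_subset by (auto simp: K_def)
    qed
  qed
  then obtain p where p: "p \<in> K" "{y \<in> V. col p y} \<subseteq> K" by blast
  have finK: "finite K" using KV finite_V finite_subset by blast
  have "K = insert p {y \<in> V. col p y}" using p clique KV by auto
  then have "card K = card (insert p {y \<in> V. col p y})" by simp
  also have "\<dots> = d * (d - 1) + 1"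
    using finite_V col_card[of p] p KV by (subst card_insert_disjoint) (auto simp: col_def)
  finally have cardK: "card K = d * (d - 1) + 1" .
  have closed: "y \<in> K" if x: "x \<in> K" "col x y" for x y
  proof -
    have "K - {x} \<subseteq> {y \<in> V. col x y}" using clique x KV by auto
    moreover have "card (K - {x}) = card {y \<in> V. col x y}"
      using cardK x KV col_card[of x] finK by auto
    ultimately have "K - {x} = {y \<in> V. col x y}" using finite_V by (intro card_subset_eq) auto
    then show ?thesis using x col_in_V by blast
  qed
  show ?thesis
  proof (intro exI[of _ K] conjI ballI impI allI)
    show "K \<noteq> {}" using inK by blast
  qed (rule KV cardK clique closed; assumption)+
qed

end

section \<open>Rayleigh quotients of the random walk\<close>

text \<open>First-order condition at a minimum: at \<open>t = - B / k\<close>, with \<open>k\<close>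
  above the modulus of \<open>C\<close>, the linear term would win.\<close>

lemma linear_term_zero:
  fixes B C :: real
  assumes "\<And>t. 2 * t * B + t\<^sup>2 * C \<ge> 0"
  shows "B = 0"
proof (rule ccontr)
  assume B: "B \<noteq> 0"
  define k where "k = \<bar>C\<bar> + 1"
  have k: "k > 0" "C < k" by (auto simp: k_def)
  have "2 * (- B / k) * B + (- B / k)\<^sup>2 * C = B\<^sup>2 / k\<^sup>2 * (C - 2 * k)"
    using k by (simp add: field_simps power2_eq_square)
  moreover have "B\<^sup>2 / k\<^sup>2 * (C - 2 * k) < 0"
    using B k by (intro mult_pos_neg) auto
  ultimately show False using assms[of "- B / k"] by simp
qed

text \<open>Functions on the whole type carry the product topology. Vanishing off \<open>V\<close>
  makes the other factors singletons and \<open>D v \<ge> 1\<close> confines the rest to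
  \<open>[-1, 1]\<close>, so the set is closed in a compact box.\<close>

lemma compact_weighted_sphere:
  fixes D :: "'a \<Rightarrow> real"
  assumes V: "finite V" and D: "\<And>v. v \<in> V \<Longrightarrow> D v \<ge> 1"
  shows "compact {f :: 'a \<Rightarrow> real. (\<forall>v. v \<notin> V \<longrightarrow> f v = 0) \<and> (\<Sum>v \<in> V. D v * (f v)\<^sup>2) = 1}" (is "compact ?S")
proof -
  define X where "X v = (if v \<in> V then {-1..1::real} else {0})" for v
  have "compactin (product_topology (\<lambda>_. euclidean) UNIV) (PiE UNIV X)"
    by (subst compactin_PiE) (auto simp: X_def)
  then have X: "compact (PiE UNIV X)"
    by (simp add: euclidean_product_topology)
  have "?S = PiE UNIV X \<inter> {f. (\<Sum>v \<in> V. D v * (f v)\<^sup>2) = 1}"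
  proof (intro equalityI subsetI)
    fix f assume f: "f \<in> ?S"
    have "f v \<in> X v" for v
    proof (cases "v \<in> V")
      case True
      have "(f v)\<^sup>2 \<le> D v * (f v)\<^sup>2" using D[OF True] by (simp add: mult_le_cancel_right1)
      also have "\<dots> \<le> (\<Sum>v \<in> V. D v * (f v)\<^sup>2)"
        using True V D by (intro member_le_sum) (auto intro!: mult_nonneg_nonneg order_trans[OF zero_le_one D])
      finally have "\<bar>f v\<bar> \<le> 1" using f by (simp add: abs_square_le_1)
      then show ?thesis using True by (auto simp: X_def)
    qed (use f in \<open>simp add: X_def\<close>)
    then show "f \<in> PiE UNIV X \<inter> {f. (\<Sum>v \<in> V. D v * (f v)\<^sup>2) = 1}" using f by auto
  next
    fix f assume f: "f \<in> PiE UNIV X \<inter> {f. (\<Sum>v \<in> V. D v * (f v)\<^sup>2) = 1}"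
    then have "f v \<in> X v" for v by auto
    then have "f v = 0" if "v \<notin> V" for v using that by (auto simp: X_def dest: meta_spec[of _ v])
    then show "f \<in> ?S" using f by auto
  qed
  moreover have "closed {f :: 'a \<Rightarrow> real. (\<Sum>v \<in> V. D v * (f v)\<^sup>2) = 1}"
    by (intro closed_Collect_eq continuous_intros continuous_on_product_coordinates)
  ultimately show ?thesis using X by (simp add: compact_Int_closed)
qed

locale weighted_nbr =
  fixes V :: "'a set" and N :: "'a \<Rightarrow> 'a set"
  assumes finite_V: "finite V" and V_ne: "V \<noteq> {}"
    and N_subset: "v \<in> V \<Longrightarrow> N v \<subseteq> V"
    and N_sym: "x \<in> V \<Longrightarrow> y \<in> N x \<Longrightarrow> x \<in> N y"
    and N_ne: "v \<in> V \<Longrightarrow> N v \<noteq> {}"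
begin

abbreviation deg :: "'a \<Rightarrow> real" where "deg v \<equiv> real (card (N v))"

lemma finite_N: "v \<in> V \<Longrightarrow> finite (N v)"
  using N_subset finite_V finite_subset by blast

lemma deg_ge1: "v \<in> V \<Longrightarrow> deg v \<ge> 1"
  using N_ne finite_N by (simp add: Suc_le_eq card_gt_0_iff)

definition walk :: "('a \<Rightarrow> 'b::real_normed_field) \<Rightarrow> 'a \<Rightarrow> 'b" where
  "walk f v = (\<Sum>u \<in> N v. f u) / of_nat (card (N v))"

text \<open>With vertices weighted by degree the walk is self-adjoint; this is the weighted square
  norm of \<open>walk f\<close>, and \<open>mass\<close> is that of \<open>f\<close>.\<close>

definition energy :: "('a \<Rightarrow> real) \<Rightarrow> real" where
  "energy f = (\<Sum>w \<in> V. (\<Sum>u \<in> N w. f u)\<^sup>2 / deg w)"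

definition mass :: "('a \<Rightarrow> real) \<Rightarrow> real" where
  "mass f = (\<Sum>v \<in> V. deg v * (f v)\<^sup>2)"

lemma N_iff: "x \<in> V \<Longrightarrow> y \<in> V \<Longrightarrow> y \<in> N x \<longleftrightarrow> x \<in> N y"
  using N_sym by blast

lemma mass_zero_iff: "mass f = 0 \<longleftrightarrow> (\<forall>v \<in> V. f v = 0)"
proof -
  have "mass f = 0 \<longleftrightarrow> (\<forall>v \<in> V. deg v * (f v)\<^sup>2 = 0)"
    unfolding mass_def using finite_V by (intro sum_nonneg_eq_0_iff) auto
  also have "\<dots> \<longleftrightarrow> (\<forall>v \<in> V. f v = 0)"
    using deg_ge1 by (intro ball_cong) fastforce+
  finally show ?thesis .
qed

text \<open>Changing a single value serves twice: as the variation at a minimizer and, starting from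
  0, to build test functions on one or two points.\<close>

lemma energy_add_point:
  assumes x: "x \<in> V"
  shows "energy (\<lambda>v. f v + t * of_bool (v = x)) =
    energy f + 2 * t * (\<Sum>w \<in> N x. walk f w) + t\<^sup>2 * (\<Sum>w \<in> N x. 1 / deg w)"
proof -
  have s: "(\<Sum>u \<in> N w. f u + t * of_bool (u = x)) = (\<Sum>u \<in> N w. f u) + t * of_bool (x \<in> N w)" if "w \<in> V" for w
    using finite_N[OF that] by (simp add: sum.distrib sum_distrib_left[symmetric] of_bool_def sum.delta)
  have "energy (\<lambda>v. f v + t * of_bool (v = x)) =
    (\<Sum>w \<in> V. (\<Sum>u \<in> N w. f u)\<^sup>2 / deg w + of_bool (w \<in> N x) * (2 * t * walk f w + t\<^sup>2 * (1 / deg w)))"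
    unfolding energy_def
  proof (rule sum.cong)
    fix w assume w: "w \<in> V"
    show "(\<Sum>u \<in> N w. f u + t * of_bool (u = x))\<^sup>2 / deg w = (\<Sum>u \<in> N w. f u)\<^sup>2 / deg w +
      of_bool (w \<in> N x) * (2 * t * walk f w + t\<^sup>2 * (1 / deg w))"
      unfolding s[OF w] N_iff[OF x w]
      by (cases "x \<in> N w") (simp_all add: walk_def power2_eq_square algebra_simps add_divide_distrib)
  qed simp
  also have "\<dots> = energy f + (\<Sum>w \<in> V. of_bool (w \<in> N x) * (2 * t * walk f w + t\<^sup>2 * (1 / deg w)))"
    by (simp add: sum.distrib energy_def)
  also have "(\<Sum>w \<in> V. of_bool (w \<in> N x) * (2 * t * walk f w + t\<^sup>2 * (1 / deg w))) =
     (\<Sum>w \<in> N x. 2 * t * walk f w + t\<^sup>2 * (1 / deg w))"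
    by (rule sum.mono_neutral_cong_right) (use x N_subset finite_V in auto)
  finally show ?thesis by (simp add: sum.distrib sum_distrib_left)
qed

lemma mass_add_point:
  assumes x: "x \<in> V"
  shows "mass (\<lambda>v. f v + t * of_bool (v = x)) = mass f + 2 * t * (deg x * f x) + t\<^sup>2 * deg x"
proof -
  have "mass (\<lambda>v. f v + t * of_bool (v = x)) =
    (\<Sum>v \<in> V. deg v * (f v)\<^sup>2 + of_bool (v = x) * (2 * t * (deg x * f x) + t\<^sup>2 * deg x))"
    unfolding mass_def by (rule sum.cong) (auto simp: power2_eq_square algebra_simps)
  also have "\<dots> = mass f + (2 * t * (deg x * f x) + t\<^sup>2 * deg x)"
    using x finite_V by (simp add: sum.distrib mass_def of_bool_def sum.delta flip: sum_distrib_right)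
  finally show ?thesis by simp
qed

lemma energy_scale: "energy (\<lambda>v. c * f v) = c\<^sup>2 * energy f"
proof -
  have "(\<Sum>u \<in> N w. c * f u) = c * (\<Sum>u \<in> N w. f u)" for w by (simp add: sum_distrib_left)
  then show ?thesis
    unfolding energy_def sum_distrib_left[of "c\<^sup>2"] by (simp add: power_mult_distrib)
qed

lemma mass_scale: "mass (\<lambda>v. c * f v) = c\<^sup>2 * mass f"
  by (simp add: mass_def power_mult_distrib sum_distrib_left mult.left_commute)

lemma energy_cong: "(\<And>v. v \<in> V \<Longrightarrow> f v = g v) \<Longrightarrow> energy f = energy g"
  unfolding energy_def by (intro sum.cong refl arg_cong2[where f = "(/)"] arg_cong[where f = "\<lambda>x. x\<^sup>2"])
    (use N_subset in auto)

lemma mass_cong: "(\<And>v. v \<in> V \<Longrightarrow> f v = g v) \<Longrightarrow> mass f = mass g"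
  unfolding mass_def by (intro sum.cong) auto

lemma energy_nonneg: "energy f \<ge> 0"
  unfolding energy_def by (intro sum_nonneg) auto

lemma mass_nonneg: "mass f \<ge> 0"
  unfolding mass_def by (intro sum_nonneg) auto

lemma rayleigh_minimum:
  obtains f mu where "mass f = 1" "energy f = mu" "\<And>g. energy g \<ge> mu * mass g"
proof -
  define S where "S = {f :: 'a \<Rightarrow> real. (\<forall>v. v \<notin> V \<longrightarrow> f v = 0) \<and> mass f = 1}"
  have "compact S" unfolding S_def mass_def
    by (rule compact_weighted_sphere) (use finite_V deg_ge1 in auto)
  moreover have "S \<noteq> {}"
  proof -
    obtain x where x: "x \<in> V" using V_ne by blast
    have "mass (\<lambda>v. of_bool (v = x)) = deg x"
      using mass_add_point[OF x, of "\<lambda>_. 0" 1] by (simp add: mass_def)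
    then have "mass (\<lambda>v. 1 / sqrt (deg x) * of_bool (v = x)) = 1"
      unfolding mass_scale using deg_ge1[OF x] by (simp add: power_divide)
    then have "(\<lambda>v. 1 / sqrt (deg x) * of_bool (v = x)) \<in> S" using x by (auto simp: S_def)
    then show ?thesis by blast
  qed
  moreover have "continuous_on S energy"
    unfolding energy_def[abs_def] divide_inverse
    by (intro continuous_intros continuous_on_product_coordinates[THEN continuous_on_subset]) auto
  ultimately obtain f where f: "f \<in> S" "\<And>g. g \<in> S \<Longrightarrow> energy f \<le> energy g"
    using continuous_attains_inf by metis
  have "energy g \<ge> energy f * mass g" for g
  proof (cases "mass g = 0")
    case False
    define c where "c = 1 / sqrt (mass g)"
    have pos: "mass g > 0" using False mass_nonneg[of g] by simp
    have c2: "c\<^sup>2 = 1 / mass g" using pos by (simp add: c_def power_divide)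
    \<comment> \<open>Cutting off outside \<open>V\<close> changes neither energy nor mass and puts
      \<open>h\<close> into \<open>S\<close>.\<close>
    define h where "h v = (if v \<in> V then c * g v else 0)" for v
    have "mass h = mass (\<lambda>v. c * g v)" "energy h = energy (\<lambda>v. c * g v)"
      by (intro mass_cong energy_cong; simp add: h_def)+
    then have h: "mass h = 1" "energy h = energy g / mass g"
      using pos by (simp_all add: mass_scale energy_scale c2)
    then have "h \<in> S" by (auto simp: S_def h_def)
    from f(2)[OF this] h pos show ?thesis by (simp add: field_simps)
  qed (use energy_nonneg in simp)
  then show ?thesis using f that[of f "energy f"] by (auto simp: S_def)
qed

text \<open>A minimizer satisfies \<open>walk (walk f) = mu * f\<close> on \<open>V\<close>. Writing
  M for the walk, \<open>M^2 - s^2\<close> factors as \<open>(M - s) (M + s)\<close>: either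
  \<open>(M + s) f\<close> is an eigenfunction for \<open>s\<close>, or it vanishes and
  \<open>f\<close> is one for \<open>- s\<close>.\<close>

lemma rayleigh_eigenfunction:
  obtains f s where "\<exists>v \<in> V. f v \<noteq> (0::real)" "\<And>v. v \<in> V \<Longrightarrow> walk f v = s * f v"
    "\<And>g. energy g \<ge> s\<^sup>2 * mass g"
proof -
  obtain f mu where f: "mass f = 1" "energy f = mu" "\<And>g. energy g \<ge> mu * mass g"
    using rayleigh_minimum by blast
  have mu: "mu \<ge> 0" using f(2) energy_nonneg by metis
  have f0: "\<exists>v \<in> V. f v \<noteq> 0" using f(1) mass_zero_iff[of f] by auto
  have walk2: "walk (walk f) x = mu * f x" if x: "x \<in> V" for x
  proof -
    define B where "B = (\<Sum>w \<in> N x. walk f w) - mu * (deg x * f x)"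
    define C where "C = (\<Sum>w \<in> N x. 1 / deg w) - mu * deg x"
    have "2 * t * B + t\<^sup>2 * C \<ge> 0" for t
      using f(3)[of "\<lambda>v. f v + t * of_bool (v = x)"] f(1,2)
      unfolding energy_add_point[OF x] mass_add_point[OF x] B_def C_def
      by (simp add: algebra_simps)
    then have "B = 0" by (rule linear_term_zero)
    then show ?thesis using deg_ge1[OF x] by (simp add: walk_def[of "walk f"] B_def)
  qed
  define s where "s = sqrt mu"
  have s: "s\<^sup>2 = mu" using mu by (simp add: s_def)
  define g where "g v = walk f v + s * f v" for v
  have lin: "walk g v = s * g v" if v: "v \<in> V" for v
  proof -
    have "walk g v = walk (walk f) v + s * walk f v"
      unfolding g_def walk_def[of "\<lambda>v. walk f v + s * f v"] walk_def[of "walk f"]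
      by (simp add: sum.distrib walk_def[of f v] sum_distrib_left add_divide_distrib)
    then show ?thesis using walk2[OF v] by (simp add: g_def algebra_simps flip: s power2_eq_square)
  qed
  show ?thesis
  proof (cases "\<exists>v \<in> V. g v \<noteq> 0")
    case True
    show ?thesis by (rule that[OF True lin]) (use f(3) s in auto)
  next
    case False
    then have "walk f v = (- s) * f v" if "v \<in> V" for v using that by (auto simp: g_def)
    then show ?thesis by (rule that[OF f0]) (use f(3) s in auto)
  qed
qed

end

section \<open>Irregular graphs\<close>

context weighted_nbr begin

lemma energy_two_points:
  assumes "x \<in> V" "y \<in> V" "x \<noteq> y"
  shows "energy (\<lambda>v. a * of_bool (v = x) + t * of_bool (v = y)) =
    a\<^sup>2 * (\<Sum>w \<in> N x. 1 / deg w) + 2 * a * t * (\<Sum>w \<in> N x \<inter> N y. 1 / deg w) + t\<^sup>2 * (\<Sum>w \<in> N y. 1 / deg w)"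
proof -
  have "energy (\<lambda>v. a * of_bool (v = x)) = a\<^sup>2 * (\<Sum>w \<in> N x. 1 / deg w)"
    using energy_add_point[OF assms(1), of "\<lambda>_. 0" a] by (simp add: energy_def walk_def)
  moreover have "(\<Sum>w \<in> N y. walk (\<lambda>v. a * of_bool (v = x)) w) = a * (\<Sum>w \<in> N x \<inter> N y. 1 / deg w)"
  proof -
    have "walk (\<lambda>v. a * of_bool (v = x)) w = a * (of_bool (w \<in> N x) * (1 / deg w))" if "w \<in> N y" for w
    proof -
      have w: "w \<in> V" using that assms N_subset by auto
      have "(\<Sum>u \<in> N w. a * of_bool (u = x)) = a * of_bool (x \<in> N w)"
        using finite_N[OF w] by (simp add: sum_distrib_left[symmetric] of_bool_def sum.delta)
      then show ?thesis using N_iff[OF assms(1) w] by (simp add: walk_def)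
    qed
    then have "(\<Sum>w \<in> N y. walk (\<lambda>v. a * of_bool (v = x)) w) = a * (\<Sum>w \<in> N y. of_bool (w \<in> N x) * (1 / deg w))"
      by (simp add: sum_distrib_left)
    also have "(\<Sum>w \<in> N y. of_bool (w \<in> N x) * (1 / deg w)) = (\<Sum>w \<in> N x \<inter> N y. 1 / deg w)"
      by (rule sum.mono_neutral_cong_right) (use assms finite_N in auto)
    finally show ?thesis .
  qed
  ultimately show ?thesis
    using energy_add_point[OF assms(2), of "\<lambda>v. a * of_bool (v = x)" t] by simp
qed

lemma mass_two_points:
  assumes "x \<in> V" "y \<in> V" "x \<noteq> y"
  shows "mass (\<lambda>v. a * of_bool (v = x) + t * of_bool (v = y)) = a\<^sup>2 * deg x + t\<^sup>2 * deg y"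
  using mass_add_point[OF assms(1), of "\<lambda>_. 0" a] mass_add_point[OF assms(2), of "\<lambda>v. a * of_bool (v = x)" t] assms
  by (simp add: mass_def)

text \<open>The diagonal entry at \<open>x\<close> of the form \<open>energy - lam * mass\<close>.
  As \<open>mass\<close> is diagonal, the entry at \<open>x\<close> and \<open>y\<close> is the sum
  of \<open>1 / deg w\<close> over common neighbours.\<close>

definition excess :: "real \<Rightarrow> 'a \<Rightarrow> real" where
  "excess lam x = (\<Sum>w \<in> N x. 1 / deg w) - lam * deg x"

lemma excess_two_points:
  assumes ray: "\<And>g. energy g \<ge> lam * mass g" and xy: "x \<in> V" "y \<in> V" "x \<noteq> y"
  shows "a\<^sup>2 * excess lam x + 2 * a * t * (\<Sum>w \<in> N x \<inter> N y. 1 / deg w) + t\<^sup>2 * excess lam y \<ge> 0"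
  using ray[of "\<lambda>v. a * of_bool (v = x) + t * of_bool (v = y)"]
  unfolding energy_two_points[OF xy] mass_two_points[OF xy] excess_def by (simp add: algebra_simps)

lemma excess_nonneg:
  assumes ray: "\<And>g. energy g \<ge> lam * mass g" and x: "x \<in> V"
  shows "excess lam x \<ge> 0"
  using ray[of "\<lambda>v. 0 + 1 * of_bool (v = x)"]
  unfolding energy_add_point[OF x] mass_add_point[OF x] by (simp add: energy_def mass_def walk_def excess_def)

text \<open>A 2 by 2 minor of a semidefinite form; a zero diagonal entry forces a zero off-diagonal
  one and is treated apart.\<close>

lemma excess_mult:
  assumes ray: "\<And>g. energy g \<ge> lam * mass g" and xy: "x \<in> V" "y \<in> V" "x \<noteq> y"
  shows "(\<Sum>w \<in> N x \<inter> N y. 1 / deg w)\<^sup>2 \<le> excess lam x * excess lam y"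
proof -
  define c where "c = (\<Sum>w \<in> N x \<inter> N y. 1 / deg w)"
  have psd: "a\<^sup>2 * excess lam x + 2 * a * t * c + t\<^sup>2 * excess lam y \<ge> 0" for a t
    unfolding c_def by (rule excess_two_points[OF ray xy])
  have pos: "excess lam y \<ge> 0" using excess_nonneg[OF ray xy(2)] .
  show ?thesis
  proof (cases "excess lam y = 0")
    case True
    have "2 * a * c + a\<^sup>2 * excess lam x \<ge> 0" for a
      using psd[of a 1] True by (simp add: algebra_simps)
    then have "c = 0" by (rule linear_term_zero)
    then show ?thesis using True by (simp add: c_def)
  next
    case False
    then have "excess lam y > 0" using pos by simp
    moreover have "excess lam y * (excess lam x * excess lam y - c\<^sup>2) \<ge> 0"
      using psd[of "excess lam y" "- c"] by (simp add: algebra_simps power2_eq_square)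
    ultimately show ?thesis by (simp add: zero_le_mult_iff c_def)
  qed
qed

text \<open>Source of all degree estimates: a small excess at one end of a path of length two forces
  a large one at the other.\<close>

lemma excess_path:
  assumes ray: "\<And>g. energy g \<ge> lam * mass g" and w: "w \<in> V" "x \<in> N w" "y \<in> N w" "x \<noteq> y"
  shows "1 / (deg w)\<^sup>2 \<le> excess lam x * excess lam y"
proof -
  have xy: "x \<in> V" "y \<in> V" using w N_subset by auto
  have "w \<in> N x \<inter> N y" using w N_sym by auto
  then have "1 / deg w \<le> (\<Sum>w \<in> N x \<inter> N y. 1 / deg w)"
    using finite_N xy by (intro member_le_sum) auto
  then have "(1 / deg w)\<^sup>2 \<le> (\<Sum>w \<in> N x \<inter> N y. 1 / deg w)\<^sup>2" by (intro power_mono) auto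
  also have "\<dots> \<le> excess lam x * excess lam y" by (rule excess_mult[OF ray xy w(4)])
  finally show ?thesis by (simp add: power_divide)
qed

lemma inverse_deg_sum_le:
  assumes w: "w \<in> V" and x: "x \<in> N w" and ax: "1 / deg x \<le> a" and bv: "\<And>v. v \<in> N w - {x} \<Longrightarrow> 1 / deg v \<le> b"
  shows "(\<Sum>v \<in> N w. 1 / deg v) \<le> a + (deg w - 1) * b"
proof -
  have "(\<Sum>v \<in> N w. 1 / deg v) = 1 / deg x + (\<Sum>v \<in> N w - {x}. 1 / deg v)"
    using finite_N[OF w] x by (rule sum.remove)
  also have "\<dots> \<le> a + of_nat (card (N w - {x})) * b"
    by (intro add_mono ax sum_bounded_above bv)
  also have "real (card (N w - {x})) = deg w - 1"
    using finite_N[OF w] x deg_ge1[OF w] by (simp add: of_nat_diff)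
  finally show ?thesis .
qed

text \<open>The excess is at most \<open>deg v / M^2\<close>, so a large excess means a large
  degree, and large degrees around a vertex lower its own excess. Passing bounds between
  \<open>u\<close> and its neighbour \<open>w0\<close> of least degree drives an excess to 0 or
  below, although all are positive.\<close>

lemma min_degree_nbrs:
  fixes m :: nat
  assumes m: "m \<ge> 3" and ge: "\<And>v. v \<in> V \<Longrightarrow> card (N v) \<ge> m"
    and ray: "\<And>g. energy g \<ge> (real m - 1) / (real m)\<^sup>2 * mass g"
    and u: "u \<in> V" "card (N u) = m" and w: "w \<in> N u"
  shows "card (N w) = m"
proof (rule ccontr)
  assume "card (N w) \<noteq> m"
  define lam where "lam = (real m - 1) / (real m)\<^sup>2"
  note ray' = ray[folded lam_def]
  define M where "M = real m"
  have M: "M \<ge> 3" using m by (simp add: M_def)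
  have nz: "M \<noteq> 0" "M + 1 \<noteq> 0" using M by auto
  have lam: "lam = (M - 1) / M\<^sup>2" by (simp add: lam_def M_def)
  have NV: "v \<in> V" if "v \<in> N x" "x \<in> V" for v x using that N_subset by auto
  have degM: "deg v \<ge> M" if "v \<in> V" for v using ge[OF that] by (simp add: M_def)
  have t_deg: "M\<^sup>2 * excess lam v \<le> deg v" if v: "v \<in> V" for v
  proof -
    have "(\<Sum>w \<in> N v. 1 / deg w) \<le> of_nat (card (N v)) * (1 / M)"
    proof (rule sum_bounded_above)
      fix w assume "w \<in> N v"
      then show "1 / deg w \<le> 1 / M" using degM[OF NV[OF _ v]] M by (simp add: frac_le)
    qed
    then have "excess lam v \<le> deg v * (1 / M - lam)" by (simp add: excess_def algebra_simps)
    also have "1 / M - lam = 1 / M\<^sup>2" using M by (simp add: lam field_simps power2_eq_square)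
    finally show ?thesis using M by (simp add: field_simps)
  qed
  have wV: "w \<in> V" using NV[OF w u(1)] .
  have degw: "deg w \<ge> M + 1" using ge[OF wV] \<open>card (N w) \<noteq> m\<close> by (simp add: M_def)
  obtain w0 where w0: "w0 \<in> N u" "\<And>v. v \<in> N u \<Longrightarrow> card (N w0) \<le> card (N v)"
  proof -
    have "arg_min_on (\<lambda>v. card (N v)) (N u) \<in> N u"
      using finite_N[OF u(1)] N_ne[OF u(1)] by (rule arg_min_if_finite)
    moreover have "card (N (arg_min_on (\<lambda>v. card (N v)) (N u))) \<le> card (N v)" if "v \<in> N u" for v
      using arg_min_least[OF finite_N[OF u(1)] N_ne[OF u(1)] that] .
    ultimately show ?thesis using that by blast
  qed
  have w0V: "w0 \<in> V" and uw0: "u \<in> N w0" using NV[OF w0(1) u(1)] N_sym[OF u(1) w0(1)] by auto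
  have tu: "excess lam u = (\<Sum>w \<in> N u. 1 / deg w) - (M - 1) / M"
    using u M by (simp add: excess_def lam power2_eq_square M_def)
  have other: "\<exists>v \<in> N x. v \<noteq> y" if x: "x \<in> V" for x y
  proof (rule ccontr)
    assume "\<not> ?thesis"
    then have "card (N x) \<le> card {y}" by (intro card_mono) auto
    then show False using ge[OF x] m by simp
  qed
  have pos: "excess lam x > 0" if x: "x \<in> V" for x
  proof -
    obtain w where w: "w \<in> N x" using N_ne[OF x] by blast
    then have wV: "w \<in> V" "x \<in> N w" using NV[OF w x] N_sym[OF x w] by auto
    obtain y where y: "y \<in> N w" "y \<noteq> x" using other[OF wV(1)] by blast
    have "0 < 1 / (deg w)\<^sup>2" using deg_ge1[OF wV(1)] by simp
    also have "\<dots> \<le> excess lam x * excess lam y" using excess_path[OF ray' wV(1) wV(2) y(1)] y by simp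
    finally show ?thesis using excess_nonneg[OF ray' x] by (auto simp: zero_less_mult_iff)
  qed
  show False
  proof (cases "card (N w0) = m")
    \<comment> \<open>The irregular neighbour \<open>w\<close> lowers the excess of \<open>u\<close>
      to \<open>1 / (M + 1)\<close>. The effect travels to the other neighbours of
      \<open>w0\<close>, to \<open>w0\<close>, to the other neighbours of \<open>u\<close>, and back
      to \<open>u\<close>, where the final bound \<open>(3 - M) / (M + 1)\<close> uses
      \<open>M \<ge> 3\<close>.\<close>
    case True
    then have dw0: "deg w0 = M" by (simp add: M_def)
    have "w \<noteq> w0" using True \<open>card (N w) \<noteq> m\<close> by auto
    have "(\<Sum>v \<in> N u. 1 / deg v) \<le> 1 / (M + 1) + (deg u - 1) * (1 / M)"
      by (rule inverse_deg_sum_le[OF u(1) w]) (use degw degM NV[OF _ u(1)] M in \<open>auto intro!: frac_le\<close>)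
    then have tu_le: "excess lam u \<le> 1 / (M + 1)"
      using u by (simp add: tu M_def[symmetric])
    have degv: "deg v \<ge> M + 1" if v: "v \<in> N w0 - {u}" for v
    proof -
      have vV: "v \<in> V" using v NV[of v w0] w0V by auto
      have "1 / M\<^sup>2 \<le> excess lam u * excess lam v"
        using excess_path[OF ray' w0V uw0, of v] v dw0 by auto
      also have "\<dots> \<le> 1 / (M + 1) * excess lam v"
        using tu_le pos[OF vV] by (intro mult_right_mono) auto
      finally have "M + 1 \<le> M\<^sup>2 * excess lam v" using M by (simp add: field_simps)
      then show ?thesis using t_deg[OF vV] by linarith
    qed
    have "(\<Sum>v \<in> N w0. 1 / deg v) \<le> 1 / M + (deg w0 - 1) * (1 / (M + 1))"
      by (rule inverse_deg_sum_le[OF w0V uw0]) (use degv degM[OF u(1)] M in \<open>auto intro!: frac_le\<close>)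
    then have "excess lam w0 \<le> 1 / M + (M - 1) / (M + 1) - (M - 1) / M"
      using M by (simp add: excess_def dw0 lam power2_eq_square)
    also have "\<dots> = 2 / (M * (M + 1))" using nz by (simp add: divide_simps; simp add: algebra_simps)
    finally have tw0: "excess lam w0 \<le> 2 / (M * (M + 1))" .
    have degx: "1 / deg x \<le> 2 / (M * (M + 1))" if x: "x \<in> N u - {w0}" for x
    proof -
      have xV: "x \<in> V" using x NV[of x u] u by auto
      have "1 / M\<^sup>2 \<le> excess lam w0 * excess lam x"
        using excess_path[OF ray' u(1) w0(1), of x] x u by (auto simp: M_def)
      also have "\<dots> \<le> 2 / (M * (M + 1)) * excess lam x"
        using tw0 pos[OF xV] by (intro mult_right_mono) auto
      finally have "1 / M\<^sup>2 \<le> 2 / (M * (M + 1)) * excess lam x" .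
      moreover have "P / 2 \<le> Q * e" if "P > 0" "Q > 0" "1 / Q \<le> 2 / P * e" for P Q e :: real
        using that by (simp add: field_simps)
      ultimately have "M * (M + 1) / 2 \<le> M\<^sup>2 * excess lam x" using M by simp
      then have "M * (M + 1) / 2 \<le> deg x" using t_deg[OF xV] by linarith
      then have "1 / deg x \<le> 1 / (M * (M + 1) / 2)" using M by (intro frac_le) auto
      then show ?thesis by simp
    qed
    have "(\<Sum>v \<in> N u. 1 / deg v) \<le> 1 / M + (deg u - 1) * (2 / (M * (M + 1)))"
      by (rule inverse_deg_sum_le[OF u(1) w0(1)]) (use degx dw0 in auto)
    then have "excess lam u \<le> 1 / M + (M - 1) * (2 / (M * (M + 1))) - (M - 1) / M"
      using u by (simp add: tu M_def[symmetric])
    also have "\<dots> = (3 - M) / (M + 1)" using nz by (simp add: divide_simps; simp add: algebra_simps)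
    also have "\<dots> \<le> 0" using M by (simp add: divide_nonpos_pos)
    finally show False using pos[OF u(1)] by simp
  next
    \<comment> \<open>All neighbours of \<open>u\<close> now have degree at least
      \<open>M + 1\<close>. Positive excess at \<open>u\<close> leaves only \<open>M + 1\<close> for
      \<open>w0\<close>; the paths through \<open>w0\<close> then give its other neighbours degree
      at least \<open>M ^ 3 / (M + 1)\<close>, which makes the excess of \<open>w0\<close>
      negative.\<close>
    case False
    have "deg w0 \<ge> M + 1" using ge[OF w0V] False by (simp add: M_def)
    have all: "1 / deg v \<le> 1 / deg w0" if "v \<in> N u" for v
      using w0(2)[OF that] \<open>deg w0 \<ge> M + 1\<close> M by (intro frac_le) auto
    have "(\<Sum>v \<in> N u. 1 / deg v) \<le> 1 / deg w0 + (deg u - 1) * (1 / deg w0)"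
      by (rule inverse_deg_sum_le[OF u(1) w0(1)])
        (use all in auto)
    then have tu_le: "excess lam u \<le> M / deg w0 - (M - 1) / M"
      using u by (simp add: tu M_def[symmetric] algebra_simps add_divide_distrib[symmetric])
    have "deg w0 < M + 2"
    proof (rule ccontr)
      assume "\<not> deg w0 < M + 2"
      then have "M / deg w0 \<le> M / (M + 2)" using M by (intro divide_left_mono) auto
      also have "\<dots> \<le> (M - 1) / M" using M by (simp add: field_simps)
      finally show False using tu_le pos[OF u(1)] by simp
    qed
    then have "real (card (N w0)) < real (m + 2)" by (simp add: M_def)
    then have "card (N w0) < m + 2" by (simp only: of_nat_less_iff)
    then have "card (N w0) = m + 1" using ge[OF w0V] False by simp
    then have dw0: "deg w0 = M + 1" by (simp add: M_def)
    have tu_le': "excess lam u \<le> 1 / (M * (M + 1))"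
      using tu_le M unfolding dw0 by (simp add: field_simps)
    have degv: "1 / deg v \<le> (M + 1) / M ^ 3" if v: "v \<in> N w0 - {u}" for v
    proof -
      have vV: "v \<in> V" using v NV[of v w0] w0V by auto
      have "1 / (M + 1)\<^sup>2 \<le> excess lam u * excess lam v"
        using excess_path[OF ray' w0V uw0, of v] v dw0 by auto
      also have "\<dots> \<le> 1 / (M * (M + 1)) * excess lam v"
        using tu_le' pos[OF vV] by (intro mult_right_mono) auto
      finally have "M * (M + 1) * (1 / (M + 1)\<^sup>2) \<le> M * (M + 1) * (1 / (M * (M + 1)) * excess lam v)"
        using M by (intro mult_left_mono) auto
      moreover have "M * (M + 1) * (1 / (M + 1)\<^sup>2) = M / (M + 1)"
        using nz by (simp add: power2_eq_square)
      moreover have "M * (M + 1) * (1 / (M * (M + 1)) * excess lam v) = excess lam v"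
        using nz by simp
      ultimately have "M / (M + 1) \<le> excess lam v" by simp
      then have "M\<^sup>2 * (M / (M + 1)) \<le> M\<^sup>2 * excess lam v" using M by (intro mult_left_mono) auto
      then have "M ^ 3 / (M + 1) \<le> deg v" using t_deg[OF vV] by (simp add: power2_eq_square power3_eq_cube)
      then have "1 / deg v \<le> 1 / (M ^ 3 / (M + 1))" using M by (intro frac_le) auto
      then show ?thesis by simp
    qed
    have "(\<Sum>v \<in> N w0. 1 / deg v) \<le> 1 / M + (deg w0 - 1) * ((M + 1) / M ^ 3)"
      by (rule inverse_deg_sum_le[OF w0V uw0]) (use degv degM[OF u(1)] M in \<open>auto intro!: frac_le\<close>)
    then have "excess lam w0 \<le> 1 / M + M * ((M + 1) / M ^ 3) - lam * (M + 1)"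
      by (simp add: excess_def dw0)
    also have "\<dots> = (2 * M + 2 - M\<^sup>2) / M\<^sup>2"
      using nz by (simp add: lam power2_eq_square power3_eq_cube divide_simps; simp add: algebra_simps)
    also have "\<dots> < 0"
    proof -
      have "M\<^sup>2 \<ge> 3 * M" using M by (simp add: power2_eq_square)
      then show ?thesis using M by (intro divide_neg_pos) auto
    qed
    finally show False using pos[OF w0V] by simp
  qed
qed

text \<open>In this range \<open>(m - 1) / m^2\<close> decreases with \<open>m\<close>, so the
  hypothesis for \<open>d\<close> implies the one for the minimum degree \<open>m\<close>, and
  connectedness spreads degree \<open>m\<close> everywhere. A regular graph of degree
  \<open>m > d\<close> stays strictly below the bound for \<open>d\<close>.\<close>

lemma extremal_is_regular:
  fixes d :: nat
  assumes d: "d \<ge> 3" and ge: "\<And>v. v \<in> V \<Longrightarrow> card (N v) \<ge> d"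
    and ray: "\<And>g. energy g \<ge> (real d - 1) / (real d)\<^sup>2 * mass g"
    and conn: "\<And>S. S \<subseteq> V \<Longrightarrow> S \<noteq> {} \<Longrightarrow> (\<And>x. x \<in> S \<Longrightarrow> N x \<subseteq> S) \<Longrightarrow> S = V"
    and v: "v \<in> V"
  shows "card (N v) = d"
proof -
  define m where "m = Min ((\<lambda>v. card (N v)) ` V)"
  have m_le: "m \<le> card (N v)" if "v \<in> V" for v
    using that finite_V by (simp add: m_def)
  have "m \<in> (\<lambda>v. card (N v)) ` V" unfolding m_def using finite_V V_ne by (intro Min_in) auto
  then obtain u where u: "u \<in> V" "card (N u) = m" by auto
  have md: "m \<ge> d" using ge[OF u(1)] u by simp
  have mono: "(real m - 1) / (real m)\<^sup>2 \<le> (real d - 1) / (real d)\<^sup>2"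
    and strict: "m \<noteq> d \<Longrightarrow> (real m - 1) / (real m)\<^sup>2 < (real d - 1) / (real d)\<^sup>2"
  proof -
    \<comment> \<open>The second factor is positive because \<open>1 / m + 1 / d < 1\<close> for
      degrees of at least 3.\<close>
    have id: "(real d - 1) / (real d)\<^sup>2 - (real m - 1) / (real m)\<^sup>2 =
      (real m - real d) * (real m * real d - real m - real d) / ((real m)\<^sup>2 * (real d)\<^sup>2)"
      using d md by (simp add: field_simps power2_eq_square)
    have "real m * real d \<ge> real m * 3" using d by (intro mult_left_mono) auto
    moreover have "real d \<le> real m" "real m > 0" using d md by simp_all
    ultimately have 2: "real m * real d - real m - real d > 0" by linarith
    then have "(real m - real d) * (real m * real d - real m - real d) / ((real m)\<^sup>2 * (real d)\<^sup>2) \<ge> 0"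
      using md by (intro divide_nonneg_nonneg mult_nonneg_nonneg) auto
    then show "(real m - 1) / (real m)\<^sup>2 \<le> (real d - 1) / (real d)\<^sup>2" using id by linarith
    assume "m \<noteq> d"
    then have "(real m - real d) * (real m * real d - real m - real d) / ((real m)\<^sup>2 * (real d)\<^sup>2) > 0"
      using md d 2 by (intro divide_pos_pos mult_pos_pos) auto
    then show "(real m - 1) / (real m)\<^sup>2 < (real d - 1) / (real d)\<^sup>2" using id by linarith
  qed
  have raym: "energy g \<ge> (real m - 1) / (real m)\<^sup>2 * mass g" for g
    using mult_right_mono[OF mono mass_nonneg[of g]] ray[of g] by linarith
  have "{v \<in> V. card (N v) = m} = V"
  proof (rule conn)
    show "N x \<subseteq> {v \<in> V. card (N v) = m}" if "x \<in> {v \<in> V. card (N v) = m}" for x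
    proof
      fix w assume "w \<in> N x"
      then show "w \<in> {v \<in> V. card (N v) = m}"
        using min_degree_nbrs[of m x w] that m_le raym md d N_subset by auto
    qed
  qed (use u in auto)
  then have reg: "card (N v) = m" if "v \<in> V" for v using that by blast
  have "m = d"
  proof (rule ccontr)
    assume "m \<noteq> d"
    have "2 \<le> card (N u)" using u d md by simp
    then obtain S where "S \<subseteq> N u" "card S = 2" by (meson obtain_subset_with_card_n)
    then obtain x y where xy: "x \<in> N u" "y \<in> N u" "x \<noteq> y" by (auto simp: card_2_iff)
    have V: "x \<in> V" "y \<in> V" using xy N_subset u by auto
    define lam where "lam = (real d - 1) / (real d)\<^sup>2"
    have M: "real m > 0" using md d by simp
    have ex: "excess lam z = 1 - lam * real m" if "z \<in> V" for z
    proof -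
      have "(\<Sum>w \<in> N z. 1 / deg w) = (\<Sum>w \<in> N z. 1 / real m)"
        by (rule sum.cong) (use reg N_subset[OF that] in auto)
      then show ?thesis using reg[OF that] M by (simp add: excess_def)
    qed
    have "1 / (real m)\<^sup>2 \<le> (1 - lam * real m) * (1 - lam * real m)"
      using excess_path[OF ray[folded lam_def] u(1) xy] u(2) ex[OF V(1)] ex[OF V(2)] by simp
    moreover have "1 - lam * real m \<ge> 0"
      using excess_nonneg[OF ray[folded lam_def] V(1)] ex[OF V(1)] by simp
    ultimately have "1 / real m \<le> 1 - lam * real m"
      using power2_le_imp_le[of "1 / real m" "1 - lam * real m"] by (simp add: power2_eq_square)
    then have "lam \<le> (real m - 1) / (real m)\<^sup>2"
      using M by (simp add: field_simps power2_eq_square)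
    then show False using strict[OF \<open>m \<noteq> d\<close>] by (simp add: lam_def)
  qed
  then show ?thesis using reg v by simp
qed

end

section \<open>The spectrum of the normalized Laplacian\<close>

definition nbrs :: "'a pair_pre_digraph \<Rightarrow> 'a \<Rightarrow> 'a set" where
  "nbrs G v = {u. (v, u) \<in> parcs G}"

lemma out_degree_eq_card_nbrs: "out_degree (with_proj G) v = card (nbrs G v)"
proof -
  have "out_arcs (with_proj G) v = Pair v ` nbrs G v"
    by (auto simp: out_arcs_def nbrs_def)
  then show ?thesis by (simp add: out_degree_def card_image inj_on_def)
qed

lemma graphs_pair_graph: "G \<in> graphs \<Longrightarrow> pair_graph G"
  by (simp add: graphs_def)

lemma graphs_finite: "G \<in> graphs \<Longrightarrow> finite (pverts G)"
  by (meson graphs_pair_graph pair_graph.axioms(1) pair_digraph.axioms(1) pair_fin_digraph.pair_finite_verts)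

lemma graphs_nonempty: "G \<in> graphs \<Longrightarrow> pverts G \<noteq> {}"
  by (auto simp: graphs_def)

lemma graphs_nbrs_subset:
  assumes "G \<in> graphs" shows "nbrs G v \<subseteq> pverts G"
proof -
  interpret pair_graph G using assms by (rule graphs_pair_graph)
  show ?thesis using in_arcsD2 by (auto simp: nbrs_def)
qed

lemma graphs_nbrs_sym:
  assumes "G \<in> graphs" "y \<in> nbrs G x" shows "x \<in> nbrs G y"
proof -
  interpret pair_graph G using assms by (intro graphs_pair_graph)
  show ?thesis using assms pair_sym_arcs by (auto simp: nbrs_def symmetric_def dest: symD)
qed

lemma graphs_nbrs_irrefl:
  assumes "G \<in> graphs" shows "v \<notin> nbrs G v"
proof -
  interpret pair_graph G using assms by (rule graphs_pair_graph)
  show ?thesis using pair_no_loops by (force simp: nbrs_def)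
qed

text \<open>Symmetric arcs turn connectedness into directed reachability, and a closed set contains
  everything reachable from it.\<close>

lemma graphs_closed_set:
  assumes G: "G \<in> graphs" and S: "S \<subseteq> pverts G" "S \<noteq> {}" "\<And>x. x \<in> S \<Longrightarrow> nbrs G x \<subseteq> S"
  shows "S = pverts G"
proof -
  interpret pair_graph G using G by (rule graphs_pair_graph)
  have "Digraph_Component.connected (with_proj G)" using G by (simp add: graphs_def)
  then have sc: "strongly_connected (with_proj G)"
    using pair_sym_arcs by (intro symmetric_connected_imp_strongly_connected)
  obtain x where x: "x \<in> S" using S by blast
  have "v \<in> S" if "v \<in> pverts G" for v
  proof -
    have "x \<rightarrow>\<^sup>*\<^bsub>with_proj G\<^esub> v" using sc x S that by (auto simp: strongly_connected_def)
    then show ?thesis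
      by (induction rule: reachable_induct) (use x S(3) in \<open>auto simp: nbrs_def\<close>)
  qed
  then show ?thesis using S by auto
qed

lemma weighted_nbr_graph:
  assumes "G \<in> graphs_ge d" "d \<ge> 1"
  shows "weighted_nbr (pverts G) (nbrs G)"
proof
  have G: "G \<in> graphs" using assms by (simp add: graphs_ge_def)
  show "finite (pverts G)" "pverts G \<noteq> {}" "\<And>v. nbrs G v \<subseteq> pverts G"
    using G by (auto intro: graphs_finite graphs_nonempty dest: graphs_nonempty graphs_nbrs_subset)
  show "x \<in> nbrs G y" if "y \<in> nbrs G x" for x y using graphs_nbrs_sym[OF G that] .
  show "nbrs G v \<noteq> {}" if "v \<in> pverts G" for v
    using assms that by (force simp: graphs_ge_def out_degree_eq_card_nbrs)
qed

section \<open>The Laplacian matrix as an operator on functions of the vertices\<close>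

lemma normalized_laplacian_carrier: "normalized_laplacian G \<in> carrier_mat (card (pverts G)) (card (pverts G))"
  unfolding normalized_laplacian_def
  by (intro minus_carrier_mat mult_carrier_mat[of _ _ "card (pverts G)"])
    (simp_all add: degree_mat_inv_def adjacency_mat_def Let_def mat_diag_def)

lemma enum_bij: "finite V \<Longrightarrow> bij_betw (from_nat_into V) {0..<card V} V"
  using bij_betw_from_nat_into_finite[of V] by (simp add: atLeast0LessThan)

lemma sum_adjacency_row:
  fixes f :: "'a \<Rightarrow> complex"
  assumes G: "G \<in> graphs" and i: "i < card (pverts G)"
  defines "e \<equiv> from_nat_into (pverts G)"
  shows "(\<Sum>j = 0..<card (pverts G). (if (e i, e j) \<in> parcs G then 1 else 0) * f (e j)) = (\<Sum>u \<in> nbrs G (e i). f u)"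
proof -
  have "(\<Sum>j = 0..<card (pverts G). (if (e i, e j) \<in> parcs G then 1 else 0) * f (e j)) =
    (\<Sum>u \<in> pverts G. (if (e i, u) \<in> parcs G then 1 else 0) * f u)"
    unfolding e_def by (rule sum.reindex_bij_betw[OF enum_bij[OF graphs_finite[OF G]]])
  also have "\<dots> = (\<Sum>u \<in> nbrs G (e i). f u)"
    by (rule sum.mono_neutral_cong_right)
      (use graphs_finite[OF G] graphs_nbrs_subset[OF G] in \<open>auto simp: nbrs_def\<close>)
  finally show ?thesis .
qed

lemma laplacian_entries:
  fixes G :: "'a pair_pre_digraph"
  defines "e \<equiv> from_nat_into (pverts G)" and "n \<equiv> card (pverts G)"
  shows "normalized_laplacian G = mat n n (\<lambda>(i, j). (if i = j then 1 else 0) -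
    inverse (of_nat (card (nbrs G (e i)))) * (if (e i, e j) \<in> parcs G then 1 else 0))"
proof -
  define A where "A i j = (if (e i, e j) \<in> parcs G then 1 else 0 :: complex)" for i j
  have adj: "adjacency_mat G = mat n n (\<lambda>(i, j). A i j)"
    by (simp add: adjacency_mat_def Let_def n_def A_def e_def)
  have "degree_mat_inv G * adjacency_mat G =
    mat n n (\<lambda>(i, j). inverse (of_nat (card (nbrs G (e i)))) * A i j)"
    unfolding degree_mat_inv_def n_def[symmetric]
    by (subst mat_diag_mult_left[of _ n n]) (auto simp: adj out_degree_eq_card_nbrs e_def)
  then show ?thesis
    by (auto simp: normalized_laplacian_def n_def[symmetric] A_def)
qed

lemma laplacian_mult_vec:
  fixes x :: "complex vec"
  assumes G: "G \<in> graphs" and i: "i < card (pverts G)" and x: "x \<in> carrier_vec (card (pverts G))"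
    and f: "\<And>j. j < card (pverts G) \<Longrightarrow> x $ j = f (from_nat_into (pverts G) j)"
  defines "e \<equiv> from_nat_into (pverts G)"
  shows "(normalized_laplacian G *\<^sub>v x) $ i = f (e i) - (\<Sum>u \<in> nbrs G (e i). f u) / of_nat (card (nbrs G (e i)))"
proof -
  define n where "n = card (pverts G)"
  define A where "A i j = (if (e i, e j) \<in> parcs G then 1 else 0 :: complex)" for i j
  have L: "normalized_laplacian G = mat n n (\<lambda>(i, j). (if i = j then 1 else 0) - inverse (of_nat (card (nbrs G (e i)))) * A i j)"
    unfolding A_def n_def e_def by (rule laplacian_entries)
  have "(normalized_laplacian G *\<^sub>v x) $ i =
    (\<Sum>j = 0..<n. ((if i = j then 1 else 0) - inverse (of_nat (card (nbrs G (e i)))) * A i j) * f (e j))"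
    using i x f by (simp add: L n_def scalar_prod_def e_def)
  also have "\<dots> = (\<Sum>j = 0..<n. (if i = j then f (e i) else 0) - inverse (of_nat (card (nbrs G (e i)))) * (A i j * f (e j)))"
    by (rule sum.cong) (auto simp: algebra_simps)
  also have "\<dots> = f (e i) - inverse (of_nat (card (nbrs G (e i)))) * (\<Sum>j = 0..<n. A i j * f (e j))"
    using i by (simp add: sum_subtractf n_def sum_distrib_left)
  also have "(\<Sum>j = 0..<n. A i j * f (e j)) = (\<Sum>u \<in> nbrs G (e i). f u)"
    unfolding A_def n_def e_def by (rule sum_adjacency_row[OF G i])
  finally show ?thesis by (simp add: divide_inverse mult.commute)
qed

text \<open>Vectors and functions on the vertices are exchanged along the numbering
  \<open>e\<close>. An eigenvalue \<open>l\<close> of the Laplacian becomes the eigenvalue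
  \<open>1 - l\<close> of the walk, so the gap is the least modulus of a walk eigenvalue.\<close>

lemma laplacian_spectrum_iff:
  assumes G: "G \<in> graphs"
  shows "l \<in> spectrum (normalized_laplacian G) \<longleftrightarrow>
    (\<exists>f :: 'a \<Rightarrow> complex. (\<exists>v \<in> pverts G. f v \<noteq> 0) \<and>
      (\<forall>v \<in> pverts G. (\<Sum>u \<in> nbrs G v. f u) / of_nat (card (nbrs G v)) = (1 - l) * f v))" (is "_ \<longleftrightarrow> ?R")
proof -
  define n where "n = card (pverts G)"
  define e where "e = from_nat_into (pverts G)"
  have e: "bij_betw e {0..<n} (pverts G)"
    unfolding e_def n_def by (rule enum_bij[OF graphs_finite[OF G]])
  have dim: "dim_row (normalized_laplacian G) = n" "normalized_laplacian G \<in> carrier_mat n n"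
    using normalized_laplacian_carrier[of G] by (auto simp: n_def)
  have key: "normalized_laplacian G *\<^sub>v x = l \<cdot>\<^sub>v x \<longleftrightarrow>
      (\<forall>v \<in> pverts G. (\<Sum>u \<in> nbrs G v. f u) / of_nat (card (nbrs G v)) = (1 - l) * f v)"
    if x: "x \<in> carrier_vec n" and f: "\<And>j. j < n \<Longrightarrow> x $ j = f (e j)" for x f
  proof -
    have "normalized_laplacian G *\<^sub>v x = l \<cdot>\<^sub>v x \<longleftrightarrow>
      (\<forall>i < n. (normalized_laplacian G *\<^sub>v x) $ i = l * x $ i)"
      using dim x by (auto simp: vec_eq_iff)
    also have "\<dots> \<longleftrightarrow> (\<forall>i < n. (\<Sum>u \<in> nbrs G (e i). f u) / of_nat (card (nbrs G (e i))) = (1 - l) * f (e i))"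
    proof (intro all_cong1 imp_cong refl)
      fix i assume i: "i < n"
      have eq: "(normalized_laplacian G *\<^sub>v x) $ i = f (e i) - (\<Sum>u \<in> nbrs G (e i). f u) / of_nat (card (nbrs G (e i)))"
        unfolding e_def by (rule laplacian_mult_vec[OF G]) (use i x f in \<open>auto simp: n_def e_def\<close>)
      show "((normalized_laplacian G *\<^sub>v x) $ i = l * x $ i) =
        ((\<Sum>u \<in> nbrs G (e i). f u) / of_nat (card (nbrs G (e i))) = (1 - l) * f (e i))"
        unfolding eq f[OF i] by (auto simp: algebra_simps)
    qed
    also have "\<dots> \<longleftrightarrow> (\<forall>v \<in> e ` {0..<n}. (\<Sum>u \<in> nbrs G v. f u) / of_nat (card (nbrs G v)) = (1 - l) * f v)"
      by auto
    also have "e ` {0..<n} = pverts G" using e by (simp add: bij_betw_def)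
    finally show ?thesis .
  qed
  have nz: "x \<noteq> 0\<^sub>v n \<longleftrightarrow> (\<exists>v \<in> pverts G. f v \<noteq> 0)"
    if x: "x \<in> carrier_vec n" and f: "\<And>j. j < n \<Longrightarrow> x $ j = f (e j)" for x f
  proof -
    have "x = 0\<^sub>v n \<longleftrightarrow> (\<forall>i < n. f (e i) = 0)" using x f by (auto simp: vec_eq_iff)
    also have "\<dots> \<longleftrightarrow> (\<forall>v \<in> e ` {0..<n}. f v = 0)" by auto
    also have "e ` {0..<n} = pverts G" using e by (simp add: bij_betw_def)
    finally show ?thesis by auto
  qed
  show ?thesis
  proof
    assume "l \<in> spectrum (normalized_laplacian G)"
    then obtain x where x: "x \<in> carrier_vec n" "x \<noteq> 0\<^sub>v n" "normalized_laplacian G *\<^sub>v x = l \<cdot>\<^sub>v x"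
      by (auto simp: spectrum_def eigenvalue_def eigenvector_def dim)
    define f where "f v = x $ (the_inv_into {0..<n} e v)" for v
    have f: "x $ j = f (e j)" if "j < n" for j
      using that e by (simp add: f_def bij_betw_def the_inv_into_f_f)
    show ?R using key[OF x(1) f] nz[OF x(1) f] x by blast
  next
    assume ?R
    then obtain f :: "'a \<Rightarrow> complex" where f: "\<exists>v \<in> pverts G. f v \<noteq> 0"
      "\<forall>v \<in> pverts G. (\<Sum>u \<in> nbrs G v. f u) / of_nat (card (nbrs G v)) = (1 - l) * f v" by blast
    define x where "x = vec n (\<lambda>j. f (e j))"
    have x: "x \<in> carrier_vec n" "\<And>j. j < n \<Longrightarrow> x $ j = f (e j)" by (auto simp: x_def)
    then show "l \<in> spectrum (normalized_laplacian G)"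
      using key[OF x] nz[OF x] f by (auto simp: spectrum_def eigenvalue_def eigenvector_def dim)
  qed
qed

lemma gap_in_spectrum:
  assumes "G \<in> graphs"
  shows "\<exists>l \<in> spectrum (normalized_laplacian G). gap G = cmod (l - 1)"
proof -
  have "card (pverts G) > 0" using assms by (auto simp: graphs_def)
  then have "gap G \<in> (\<lambda>l. cmod (l - 1)) ` spectrum (normalized_laplacian G)"
    unfolding gap_def using card_finite_spectrum[OF normalized_laplacian_carrier]
      spectrum_non_empty[OF normalized_laplacian_carrier] by (intro Min_in) auto
  then show ?thesis by auto
qed

lemma gap_le_spectrum: "l \<in> spectrum (normalized_laplacian G) \<Longrightarrow> gap G \<le> cmod (l - 1)"
  unfolding gap_def using card_finite_spectrum[OF normalized_laplacian_carrier] by (intro Min_le) auto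

lemma gap_ge:
  fixes G :: "'a pair_pre_digraph"
  assumes G: "G \<in> graphs"
    and ev: "\<And>(f :: 'a \<Rightarrow> complex) s. \<exists>v \<in> pverts G. f v \<noteq> 0 \<Longrightarrow>
      (\<And>v. v \<in> pverts G \<Longrightarrow> (\<Sum>u \<in> nbrs G v. f u) / of_nat (card (nbrs G v)) = s * f v) \<Longrightarrow> c \<le> cmod s"
  shows "c \<le> gap G"
proof -
  obtain l where l: "l \<in> spectrum (normalized_laplacian G)" "gap G = cmod (l - 1)"
    using gap_in_spectrum[OF G] by blast
  then obtain f :: "'a \<Rightarrow> complex" where f: "\<exists>v \<in> pverts G. f v \<noteq> 0"
    "\<forall>v \<in> pverts G. (\<Sum>u \<in> nbrs G v. f u) / of_nat (card (nbrs G v)) = (1 - l) * f v"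
    using laplacian_spectrum_iff[OF G] by blast
  then have "c \<le> cmod (1 - l)" using ev[of f "1 - l"] by blast
  then show ?thesis using l by (simp add: norm_minus_commute)
qed

lemma gap_nonneg: "G \<in> graphs \<Longrightarrow> gap G \<ge> 0"
  using gap_in_spectrum by fastforce

text \<open>The least Rayleigh quotient is \<open>s^2\<close> for an eigenvalue \<open>s\<close> of
  the walk itself, so \<open>1 - s\<close> is in the Laplacian spectrum and bounds the gap by the
  modulus of \<open>s\<close>.\<close>

lemma gap_rayleigh:
  assumes G: "G \<in> graphs_ge d" "d \<ge> 1"
  shows "(gap G)\<^sup>2 * weighted_nbr.mass (pverts G) (nbrs G) g \<le> weighted_nbr.energy (pverts G) (nbrs G) g"
proof -
  interpret weighted_nbr "pverts G" "nbrs G" by (rule weighted_nbr_graph[OF G])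
  have G': "G \<in> graphs" using G by (simp add: graphs_ge_def)
  obtain f s where f: "\<exists>v \<in> pverts G. f v \<noteq> (0::real)" "\<And>v. v \<in> pverts G \<Longrightarrow> walk f v = s * f v"
    "\<And>g. energy g \<ge> s\<^sup>2 * mass g"
    using rayleigh_eigenfunction by blast
  have "complex_of_real (1 - s) \<in> spectrum (normalized_laplacian G)"
    unfolding laplacian_spectrum_iff[OF G']
  proof (intro exI conjI ballI)
    show "\<exists>v \<in> pverts G. complex_of_real (f v) \<noteq> 0" using f(1) by simp
    show "(\<Sum>u \<in> nbrs G v. complex_of_real (f u)) / of_nat (card (nbrs G v)) =
      (1 - complex_of_real (1 - s)) * complex_of_real (f v)" if "v \<in> pverts G" for v
      using arg_cong[OF f(2)[OF that], of complex_of_real] by (simp add: walk_def)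
  qed
  moreover have "complex_of_real (1 - s) - 1 = - complex_of_real s" by simp
  ultimately have "gap G \<le> \<bar>s\<bar>"
    using gap_le_spectrum[of "complex_of_real (1 - s)" G] by (metis norm_minus_cancel norm_of_real)
  then have "(gap G)\<^sup>2 \<le> s\<^sup>2" using gap_nonneg[OF G'] by (metis power2_abs power_mono)
  then have "(gap G)\<^sup>2 * mass g \<le> s\<^sup>2 * mass g" using mass_nonneg by (intro mult_right_mono)
  also have "\<dots> \<le> energy g" by (rule f(3))
  finally show ?thesis .
qed

section \<open>Gap bounds\<close>

lemma graphs_eq_subset_ge: "G \<in> graphs_eq d \<Longrightarrow> G \<in> graphs_ge d"
  by (auto simp: graphs_eq_def graphs_ge_def)

lemma graphs_eq_card_nbrs: "G \<in> graphs_eq d \<Longrightarrow> v \<in> pverts G \<Longrightarrow> card (nbrs G v) = d"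
  by (auto simp: graphs_eq_def out_degree_eq_card_nbrs)

text \<open>The test function is the difference of two vertices, which cancels on their common
  neighbours. One common neighbour gives \<open>(d - 1) / d^2\<close>, two already give at most
  \<open>(d - 2) / d^2\<close>.\<close>

lemma regular_gap_common_nbrs:
  assumes G: "G \<in> graphs_eq d" "d \<ge> 1" and xy: "x \<in> pverts G" "y \<in> pverts G" "x \<noteq> y"
  shows "(gap G)\<^sup>2 \<le> (real d - real (card (nbrs G x \<inter> nbrs G y))) / (real d)\<^sup>2"
proof -
  interpret weighted_nbr "pverts G" "nbrs G"
    by (rule weighted_nbr_graph[OF graphs_eq_subset_ge[OF G(1)] G(2)])
  have deg: "card (nbrs G v) = d" if "v \<in> pverts G" for v using graphs_eq_card_nbrs[OF G(1) that] .
  have D: "real d > 0" using G by simp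
  let ?g = "\<lambda>v. 1 * of_bool (v = x) + (-1) * of_bool (v = y)"
  have s: "(\<Sum>w \<in> S. 1 / real (card (nbrs G w))) = real (card S) / real d" if "S \<subseteq> pverts G" for S
  proof -
    have "(\<Sum>w \<in> S. 1 / real (card (nbrs G w))) = (\<Sum>w \<in> S. 1 / real d)"
      by (rule sum.cong) (use that deg in auto)
    then show ?thesis by simp
  qed
  have "nbrs G x \<subseteq> pverts G" "nbrs G y \<subseteq> pverts G" "nbrs G x \<inter> nbrs G y \<subseteq> pverts G"
    using xy N_subset by auto
  then have "energy ?g = 2 - 2 * real (card (nbrs G x \<inter> nbrs G y)) / real d"
    unfolding energy_two_points[OF xy] using D deg[OF xy(1)] deg[OF xy(2)] by (simp add: s)
  moreover have "mass ?g = 2 * real d"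
    unfolding mass_two_points[OF xy] using deg[OF xy(1)] deg[OF xy(2)] by simp
  ultimately have "(gap G)\<^sup>2 * (2 * real d) \<le> 2 - 2 * real (card (nbrs G x \<inter> nbrs G y)) / real d"
    using gap_rayleigh[OF graphs_eq_subset_ge[OF G(1)] G(2), of ?g] by simp
  then show ?thesis using D by (simp add: field_simps power2_eq_square)
qed

lemma gap_le_sqrtI:
  assumes "c \<ge> 0" "(gap G)\<^sup>2 \<le> c / (real d)\<^sup>2"
  shows "gap G \<le> sqrt c / real d"
proof (rule power2_le_imp_le)
  show "(gap G)\<^sup>2 \<le> (sqrt c / real d)\<^sup>2" using assms by (simp add: power_divide)
  show "0 \<le> sqrt c / real d" using assms by simp
qed

lemma regular_gap_le:
  assumes G: "G \<in> graphs_eq d" "d \<ge> 3"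
  shows "gap G \<le> sqrt (real d - 1) / real d"
proof -
  have G': "G \<in> graphs" using G by (simp add: graphs_eq_def)
  obtain u where u: "u \<in> pverts G" using graphs_nonempty[OF G'] by blast
  have "2 \<le> card (nbrs G u)" using graphs_eq_card_nbrs[OF G(1) u] G by simp
  then obtain S where "S \<subseteq> nbrs G u" "card S = 2" by (meson obtain_subset_with_card_n)
  then obtain x y where xy: "x \<in> nbrs G u" "y \<in> nbrs G u" "x \<noteq> y" by (auto simp: card_2_iff)
  have V: "x \<in> pverts G" "y \<in> pverts G" using xy graphs_nbrs_subset[OF G'] by auto
  have "u \<in> nbrs G x \<inter> nbrs G y" using xy graphs_nbrs_sym[OF G'] by auto
  moreover have "finite (nbrs G x \<inter> nbrs G y)"
    using graphs_finite[OF G'] graphs_nbrs_subset[OF G'] finite_subset by blast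
  ultimately have "card (nbrs G x \<inter> nbrs G y) \<ge> 1" by (auto simp: Suc_le_eq card_gt_0_iff)
  then have "(real d - real (card (nbrs G x \<inter> nbrs G y))) / (real d)\<^sup>2 \<le> (real d - 1) / (real d)\<^sup>2"
    by (intro divide_right_mono) auto
  then have "(gap G)\<^sup>2 \<le> (real d - 1) / (real d)\<^sup>2"
    using regular_gap_common_nbrs[OF G(1) _ V xy(3)] G by linarith
  then show ?thesis using G G' by (intro gap_le_sqrtI) auto
qed

lemma gap_ge_imp_regular:
  assumes G: "G \<in> graphs_ge d" "d \<ge> 3" and gap: "gap G \<ge> sqrt (real d - 1) / real d"
  shows "G \<in> graphs_eq d"
proof -
  have G': "G \<in> graphs" using G by (simp add: graphs_ge_def)
  have d1: "d \<ge> 1" using G by simp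
  interpret weighted_nbr "pverts G" "nbrs G"
    by (rule weighted_nbr_graph[OF G(1) d1])
  have "(real d - 1) / (real d)\<^sup>2 = (sqrt (real d - 1) / real d)\<^sup>2"
    using d1 by (simp add: power_divide)
  also have "\<dots> \<le> (gap G)\<^sup>2" using gap d1 by (intro power_mono) auto
  finally have lam: "(real d - 1) / (real d)\<^sup>2 \<le> (gap G)\<^sup>2" .
  have "card (nbrs G v) = d" if "v \<in> pverts G" for v
  proof (rule extremal_is_regular[OF G(2)])
    show "(real d - 1) / (real d)\<^sup>2 * mass g \<le> energy g" for g
      using mult_right_mono[OF lam mass_nonneg[of g]] gap_rayleigh[OF G(1) d1, of g] by linarith
    show "card (nbrs G v) \<ge> d" if "v \<in> pverts G" for v
      using G that by (auto simp: graphs_ge_def out_degree_eq_card_nbrs)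
    show "S = pverts G" if "S \<subseteq> pverts G" "S \<noteq> {}" "\<And>x. x \<in> S \<Longrightarrow> nbrs G x \<subseteq> S" for S
      using graphs_closed_set[OF G' that] .
  qed (rule that)
  then show ?thesis using G' by (auto simp: graphs_eq_def out_degree_eq_card_nbrs)
qed

lemma gap_le_of_min_degree:
  assumes G: "G \<in> graphs_ge d" "d \<ge> 3"
  shows "gap G \<le> sqrt (real d - 1) / real d"
proof (cases "gap G \<ge> sqrt (real d - 1) / real d")
  case True
  then show ?thesis using gap_ge_imp_regular[OF G] regular_gap_le[OF _ G(2)] by blast
qed simp

text \<open>Two common neighbours would bring the gap down to the excluded value. By regularity
  \<open>d\<close> times \<open>energy\<close> is the first sum in \<open>form\<close>, so the
  strict Rayleigh bound is its positivity.\<close>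

lemma posdef_linear_graph_of_gap:
  assumes G: "G \<in> graphs_eq d" "d \<ge> 3" and gap: "gap G > sqrt (real d - 2) / real d"
  shows "posdef_linear_graph (pverts G) (nbrs G) d"
proof -
  have G': "G \<in> graphs" using G by (simp add: graphs_eq_def)
  have d1: "d \<ge> 1" using G by simp
  have D: "real d > 0" using d1 by simp
  interpret weighted_nbr "pverts G" "nbrs G"
    by (rule weighted_nbr_graph[OF graphs_eq_subset_ge[OF G(1)] d1])
  have deg: "card (nbrs G v) = d" if "v \<in> pverts G" for v using graphs_eq_card_nbrs[OF G(1) that] .
  have "(real d - 2) / (real d)\<^sup>2 = (sqrt (real d - 2) / real d)\<^sup>2"
    using G by (simp add: power_divide)
  also have "\<dots> < (gap G)\<^sup>2" using gap G by (intro power_strict_mono) auto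
  finally have lam: "(real d - 2) / (real d)\<^sup>2 < (gap G)\<^sup>2" .
  interpret linear_graph "pverts G" "nbrs G" d
  proof
    show "card (nbrs G x \<inter> nbrs G y) \<le> 1" if xy: "x \<in> pverts G" "y \<in> pverts G" "x \<noteq> y" for x y
    proof (rule ccontr)
      assume "\<not> ?thesis"
      then have "(real d - real (card (nbrs G x \<inter> nbrs G y))) / (real d)\<^sup>2 \<le> (real d - 2) / (real d)\<^sup>2"
        by (intro divide_right_mono) auto
      then show False using regular_gap_common_nbrs[OF G(1) d1 xy] lam by linarith
    qed
  qed (use finite_V N_subset graphs_nbrs_sym[OF G'] deg G in auto)
  show ?thesis
  proof
    fix x and f :: "'a \<Rightarrow> real" assume x: "x \<in> pverts G" "f x \<noteq> 0"
    have "mass f > 0" using x mass_zero_iff[of f] mass_nonneg[of f] by fastforce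
    with lam have "(real d - 2) / (real d)\<^sup>2 * mass f < (gap G)\<^sup>2 * mass f" by (rule mult_strict_right_mono)
    also have "\<dots> \<le> energy f" by (rule gap_rayleigh[OF graphs_eq_subset_ge[OF G(1)] d1])
    also have "energy f = (\<Sum>w \<in> pverts G. (\<Sum>u \<in> nbrs G w. f u)\<^sup>2) / real d"
      unfolding energy_def sum_divide_distrib by (rule sum.cong) (auto simp: deg)
    also have "mass f = real d * (\<Sum>v \<in> pverts G. (f v)\<^sup>2)"
      unfolding mass_def sum_distrib_left by (rule sum.cong) (auto simp: deg)
    also have "(real d - 2) / (real d)\<^sup>2 * (real d * (\<Sum>v \<in> pverts G. (f v)\<^sup>2)) =
      (real d - 2) * (\<Sum>v \<in> pverts G. (f v)\<^sup>2) / real d"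
      using D by (simp add: power2_eq_square)
    finally have "(real d - 2) * (\<Sum>v \<in> pverts G. (f v)\<^sup>2) < (\<Sum>w \<in> pverts G. (\<Sum>u \<in> nbrs G w. f u)\<^sup>2)"
      using D by (simp add: divide_less_cancel)
    then show "0 < form f f" by (simp add: form_def power2_eq_square)
  qed
qed

section \<open>No regular friendship graph\<close>

definition mat_trace :: "'a::comm_ring_1 mat \<Rightarrow> 'a" where
  "mat_trace A = (\<Sum>i = 0..<dim_row A. A $$ (i, i))"

lemma mat_trace_commute:
  assumes "A \<in> carrier_mat n n" "B \<in> carrier_mat n n"
  shows "mat_trace (A * B) = mat_trace (B * A)"
proof -
  have "mat_trace (A * B) = (\<Sum>i = 0..<n. \<Sum>j = 0..<n. A $$ (i, j) * B $$ (j, i))"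
    using assms by (auto simp: mat_trace_def scalar_prod_def intro!: sum.cong)
  also have "\<dots> = (\<Sum>j = 0..<n. \<Sum>i = 0..<n. A $$ (i, j) * B $$ (j, i))" by (rule sum.swap)
  also have "\<dots> = mat_trace (B * A)"
    using assms by (auto simp: mat_trace_def scalar_prod_def mult.commute intro!: sum.cong)
  finally show ?thesis .
qed

lemma mat_trace_similar:
  assumes A: "A \<in> carrier_mat n n" and sim: "similar_mat_wit A B P Q"
  shows "mat_trace A = mat_trace B"
proof -
  note w = similar_mat_witD2[OF A sim]
  have "mat_trace A = mat_trace (P * (B * Q))" using w by (simp add: assoc_mult_mat[of P n n B n Q n])
  also have "\<dots> = mat_trace ((B * Q) * P)" using w by (intro mat_trace_commute[of _ n]) auto
  also have "(B * Q) * P = B * (Q * P)" using w by (intro assoc_mult_mat) auto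
  also have "\<dots> = B" using w by simp
  finally show ?thesis .
qed

text \<open>\<open>spectrum\<close> is a set and forgets multiplicities; the list \<open>as\<close>,
  the diagonal of a Schur form, keeps them. The trace of the square will determine one
  multiplicity.\<close>

lemma mat_trace_eigenvalues:
  fixes A :: "complex mat"
  assumes A: "A \<in> carrier_mat n n"
  obtains as where "length as = n" "set as \<subseteq> spectrum A" "mat_trace A = sum_list as"
    "mat_trace (A * A) = (\<Sum>a\<leftarrow>as. a * a)"
proof -
  obtain as where as: "char_poly A = (\<Prod>a\<leftarrow>as. [:- a, 1:])" "length as = n"
    using char_poly_factorized[OF A] by blast
  obtain B P Q where schur: "schur_decomposition A as = (B, P, Q)" by (cases "schur_decomposition A as") auto
  from schur_decomposition[OF A as(1) schur]
  have sim: "similar_mat_wit A B P Q" and ut: "upper_triangular B" and diag: "diag_mat B = as" by auto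
  have B: "B \<in> carrier_mat n n" using similar_mat_witD2[OF A sim] by auto
  have nth: "as ! i = B $$ (i, i)" if "i < n" for i using diag B that by (auto simp: diag_mat_def)
  have "mat_trace A = mat_trace B" by (rule mat_trace_similar[OF A sim])
  also have "\<dots> = sum_list as"
    using B as(2) nth by (simp add: mat_trace_def sum_list_sum_nth)
  finally have 1: "mat_trace A = sum_list as" .
  have AA: "A * A \<in> carrier_mat n n" using A by simp
  have "similar_mat_wit (A ^\<^sub>m 2) (B ^\<^sub>m 2) P Q" by (rule similar_mat_wit_pow[OF sim])
  then have "similar_mat_wit (A * A) (B * B) P Q" using A B by (simp add: numeral_2_eq_2)
  then have "mat_trace (A * A) = mat_trace (B * B)" by (rule mat_trace_similar[OF AA])
  also have "\<dots> = (\<Sum>i = 0..<n. \<Sum>j = 0..<n. B $$ (i, j) * B $$ (j, i))"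
    using B by (auto simp: mat_trace_def scalar_prod_def intro!: sum.cong)
  \<comment> \<open>Off the diagonal one of the two factors lies below it and vanishes.\<close>
  also have "\<dots> = (\<Sum>i = 0..<n. \<Sum>j = 0..<n. if j = i then B $$ (i, i) * B $$ (i, i) else 0)"
  proof (intro sum.cong refl)
    fix i j assume "i \<in> {0..<n}" "j \<in> {0..<n}"
    then show "B $$ (i, j) * B $$ (j, i) = (if j = i then B $$ (i, i) * B $$ (i, i) else 0)"
      using upper_triangularD[OF ut, of i j] upper_triangularD[OF ut, of j i] B
      by (cases i j rule: linorder_cases) auto
  qed
  also have "\<dots> = (\<Sum>a\<leftarrow>as. a * a)"
    using as(2) nth by (simp add: sum_list_sum_nth)
  finally have 2: "mat_trace (A * A) = (\<Sum>a\<leftarrow>as. a * a)" .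
  have "set as \<subseteq> spectrum A"
  proof
    fix a assume "a \<in> set as"
    then have "poly (char_poly A) a = 0" unfolding as(1) poly_prod_list by (auto simp: prod_list_zero_iff)
    then show "a \<in> spectrum A" by (simp add: spectrum_root_char_poly[OF A])
  qed
  then show ?thesis using that[OF as(2) _ 1 2] by blast
qed

text \<open>The entry of \<open>A^2\<close> at \<open>v\<close> and \<open>u\<close> counts common
  neighbours.\<close>

lemma two_step_sum:
  fixes f :: "'a \<Rightarrow> 'b::comm_ring_1"
  assumes G: "G \<in> graphs" and v: "v \<in> pverts G"
  shows "(\<Sum>w \<in> nbrs G v. \<Sum>u \<in> nbrs G w. f u) = (\<Sum>u \<in> pverts G. of_nat (card (nbrs G v \<inter> nbrs G u)) * f u)"
proof -
  have fin: "finite (pverts G)" "finite (nbrs G w)" for w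
    using graphs_finite[OF G] graphs_nbrs_subset[OF G] finite_subset by blast+
  have "(\<Sum>w \<in> nbrs G v. \<Sum>u \<in> nbrs G w. f u) = (\<Sum>w \<in> nbrs G v. \<Sum>u \<in> pverts G. if w \<in> nbrs G u then f u else 0)"
  proof (rule sum.cong)
    fix w
    have "nbrs G w = {u \<in> pverts G. w \<in> nbrs G u}"
      using graphs_nbrs_sym[OF G] graphs_nbrs_subset[OF G] by auto
    then show "(\<Sum>u \<in> nbrs G w. f u) = (\<Sum>u \<in> pverts G. if w \<in> nbrs G u then f u else 0)"
      using fin by (simp add: sum.inter_filter)
  qed simp
  also have "\<dots> = (\<Sum>u \<in> pverts G. \<Sum>w \<in> nbrs G v. if w \<in> nbrs G u then f u else 0)" by (rule sum.swap)
  also have "\<dots> = (\<Sum>u \<in> pverts G. of_nat (card (nbrs G v \<inter> nbrs G u)) * f u)"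
  proof (rule sum.cong)
    fix u
    have "(\<Sum>w \<in> nbrs G v. if w \<in> nbrs G u then f u else 0) = (\<Sum>w \<in> nbrs G v \<inter> nbrs G u. f u)"
      by (rule sum.inter_restrict[symmetric]) (rule fin)
    then show "(\<Sum>w \<in> nbrs G v. if w \<in> nbrs G u then f u else 0) = of_nat (card (nbrs G v \<inter> nbrs G u)) * f u" by simp
  qed simp
  finally show ?thesis .
qed

lemma eigenfunction_two_step:
  fixes f :: "'a \<Rightarrow> complex"
  assumes G: "G \<in> graphs_eq d" "d \<ge> 1" and ev: "\<And>v. v \<in> pverts G \<Longrightarrow> (\<Sum>u \<in> nbrs G v. f u) / of_nat (card (nbrs G v)) = s * f v"
    and v: "v \<in> pverts G"
  shows "(of_nat d * s)\<^sup>2 * f v = (\<Sum>u \<in> pverts G. of_nat (card (nbrs G v \<inter> nbrs G u)) * f u)"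
proof -
  have G': "G \<in> graphs" using G by (simp add: graphs_eq_def)
  have one: "(\<Sum>u \<in> nbrs G w. f u) = of_nat d * s * f w" if "w \<in> pverts G" for w
    using ev[OF that] graphs_eq_card_nbrs[OF G(1) that] G(2) by (simp add: field_simps)
  have "(\<Sum>w \<in> nbrs G v. \<Sum>u \<in> nbrs G w. f u) = (\<Sum>w \<in> nbrs G v. of_nat d * s * f w)"
    by (rule sum.cong) (use one graphs_nbrs_subset[OF G'] in auto)
  also have "\<dots> = of_nat d * s * (of_nat d * s * f v)" unfolding sum_distrib_left[symmetric] one[OF v] ..
  finally show ?thesis unfolding two_step_sum[OF G' v] by (simp add: power2_eq_square mult.assoc)
qed

lemma sum_list_plus_minus:
  fixes c :: complex
  assumes "\<And>a. a \<in> set xs \<Longrightarrow> a = c \<or> a = - c"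
  shows "\<exists>j :: int. sum_list xs = of_int j * c"
  using assms
proof (induction xs)
  case Nil
  show ?case by (intro exI[of _ 0]) simp
next
  case (Cons x xs)
  then obtain j :: int where j: "sum_list xs = of_int j * c" by auto
  have "x = c \<or> x = - c" using Cons.prems by auto
  then show ?case
  proof
    assume "x = c"
    then show ?thesis using j by (intro exI[of _ "j + 1"]) (simp add: algebra_simps)
  next
    assume "x = - c"
    then show ?thesis using j by (intro exI[of _ "j - 1"]) (simp add: algebra_simps)
  qed
qed

text \<open>The adjacency matrix has trace 0, and its square has trace \<open>n * d\<close>.\<close>

lemma regular_laplacian_traces:
  assumes G: "G \<in> graphs_eq d" "d \<ge> 1"
  defines "n \<equiv> card (pverts G)" and "L \<equiv> normalized_laplacian G"
  shows "mat_trace L = of_nat n" "mat_trace (L * L) = of_nat n + of_nat n / of_nat d"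
proof -
  have G': "G \<in> graphs" using G by (simp add: graphs_eq_def)
  define e where "e = from_nat_into (pverts G)"
  define A where "A i j = (if (e i, e j) \<in> parcs G then 1 else 0 :: complex)" for i j
  have eV: "e i \<in> pverts G" if "i < n" for i
    using that enum_bij[OF graphs_finite[OF G']] by (auto simp: e_def n_def bij_betw_def)
  have L: "L $$ (i, j) = (if i = j then 1 else 0) - A i j / of_nat d" if "i < n" "j < n" for i j
    using that graphs_eq_card_nbrs[OF G(1) eV[OF that(1)]]
    unfolding L_def laplacian_entries by (simp add: n_def A_def e_def divide_inverse)
  have Lc: "L \<in> carrier_mat n n" unfolding L_def n_def by (rule normalized_laplacian_carrier)
  have diag: "A i i = 0" for i
    using graphs_nbrs_irrefl[OF G', of "e i"] by (simp add: A_def nbrs_def)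
  have sym: "A i j * A j i = A i j" for i j
    using graphs_nbrs_sym[OF G', of "e j" "e i"] graphs_nbrs_sym[OF G', of "e i" "e j"] by (auto simp: A_def nbrs_def)
  have row: "(\<Sum>j = 0..<n. A i j) = of_nat d" if "i < n" for i
    using sum_adjacency_row[OF G', of i "\<lambda>_. 1"] that graphs_eq_card_nbrs[OF G(1) eV[OF that]]
    by (simp add: A_def e_def n_def)
  show "mat_trace L = of_nat n" using Lc by (simp add: mat_trace_def L diag)
  have "mat_trace (L * L) = (\<Sum>i = 0..<n. \<Sum>j = 0..<n. L $$ (i, j) * L $$ (j, i))"
    using Lc by (auto simp: mat_trace_def scalar_prod_def intro!: sum.cong)
  also have "\<dots> = (\<Sum>i = 0..<n. \<Sum>j = 0..<n. (if i = j then 1 else 0) + A i j / (of_nat d)\<^sup>2)"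
  proof (intro sum.cong refl)
    fix i j assume "i \<in> {0..<n}" "j \<in> {0..<n}"
    then show "L $$ (i, j) * L $$ (j, i) = (if i = j then 1 else 0) + A i j / (of_nat d)\<^sup>2"
      using sym[of i j] by (auto simp: L diag power2_eq_square)
  qed
  also have "\<dots> = (\<Sum>i = 0..<n. 1 + of_nat d / (of_nat d)\<^sup>2)"
    by (rule sum.cong) (auto simp: sum.distrib row simp flip: sum_divide_distrib)
  also have "\<dots> = of_nat n + of_nat n / of_nat d" using G(2) by (simp add: power2_eq_square algebra_simps)
  finally show "mat_trace (L * L) = of_nat n + of_nat n / of_nat d" .
qed

text \<open>
  All eigenvalues of the adjacency matrix other than the simple eigenvalue d are square roots of
  d - 1, so its trace 0 exhibits d as an integer multiple of sqrt (d - 1).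
\<close>

lemma no_regular_friendship_graph:
  assumes G: "G \<in> graphs_eq d" "d \<ge> 3"
    and one: "\<And>x y. x \<in> pverts G \<Longrightarrow> y \<in> pverts G \<Longrightarrow> x \<noteq> y \<Longrightarrow> card (nbrs G x \<inter> nbrs G y) = 1"
    and n: "card (pverts G) = d * (d - 1) + 1"
  shows False
proof -
  have G': "G \<in> graphs" using G by (simp add: graphs_eq_def)
  have d1: "d \<ge> 1" using G by simp
  define c where "c = complex_of_real (sqrt (real d - 1))"
  have c2: "c\<^sup>2 = of_nat d - 1"
  proof -
    have "c\<^sup>2 = complex_of_real ((sqrt (real d - 1))\<^sup>2)" by (simp add: c_def)
    also have "(sqrt (real d - 1))\<^sup>2 = real d - 1" using d1 by simp
    finally show ?thesis by simp
  qed
  have ev: "of_nat d * (1 - l) = of_nat d \<or> of_nat d * (1 - l) = c \<or> of_nat d * (1 - l) = - c"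
    if l: "l \<in> spectrum (normalized_laplacian G)" for l
  proof -
    obtain f :: "'a \<Rightarrow> complex" where f: "\<exists>v \<in> pverts G. f v \<noteq> 0"
      "\<And>v. v \<in> pverts G \<Longrightarrow> (\<Sum>u \<in> nbrs G v. f u) / of_nat (card (nbrs G v)) = (1 - l) * f v"
      using l unfolding laplacian_spectrum_iff[OF G'] by blast
    define t where "t = (\<Sum>u \<in> pverts G. f u)"
    \<comment> \<open>Here \<open>A^2 = (d - 1) I + J\<close> with J the all-ones matrix, so the
      total \<open>t\<close> of \<open>f\<close> is the only correction.\<close>
    have sq: "(of_nat d * (1 - l))\<^sup>2 * f v = c\<^sup>2 * f v + t" if v: "v \<in> pverts G" for v
    proof -
      have "(of_nat d * (1 - l))\<^sup>2 * f v = (\<Sum>u \<in> pverts G. of_nat (card (nbrs G v \<inter> nbrs G u)) * f u)"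
        by (rule eigenfunction_two_step[OF G(1) d1 f(2) v])
      also have "\<dots> = (\<Sum>u \<in> pverts G. f u + (if u = v then c\<^sup>2 * f v else 0))"
        by (rule sum.cong) (use one v graphs_eq_card_nbrs[OF G(1) v] in \<open>auto simp: c2 algebra_simps\<close>)
      also have "\<dots> = t + c\<^sup>2 * f v" using v graphs_finite[OF G'] by (simp add: sum.distrib t_def)
      finally show ?thesis by simp
    qed
    have "(\<Sum>v \<in> pverts G. \<Sum>u \<in> nbrs G v. f u) = of_nat d * (1 - l) * t"
      unfolding t_def sum_distrib_left
    proof (rule sum.cong)
      fix v assume "v \<in> pverts G"
      then show "(\<Sum>u \<in> nbrs G v. f u) = of_nat d * (1 - l) * f v"
        using f(2) graphs_eq_card_nbrs[OF G(1)] d1 by (simp add: field_simps)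
    qed simp
    moreover have "(\<Sum>v \<in> pverts G. \<Sum>u \<in> nbrs G v. f u) = of_nat d * t"
    proof -
      have "(\<Sum>v \<in> pverts G. \<Sum>u \<in> nbrs G v. f u) = (\<Sum>v \<in> pverts G. \<Sum>u \<in> pverts G. if v \<in> nbrs G u then f u else 0)"
      proof (rule sum.cong)
        fix v
        have "nbrs G v = {u \<in> pverts G. v \<in> nbrs G u}"
          using graphs_nbrs_sym[OF G'] graphs_nbrs_subset[OF G'] by auto
        then show "(\<Sum>u \<in> nbrs G v. f u) = (\<Sum>u \<in> pverts G. if v \<in> nbrs G u then f u else 0)"
          using graphs_finite[OF G'] by (simp add: sum.inter_filter)
      qed simp
      also have "\<dots> = (\<Sum>u \<in> pverts G. \<Sum>v \<in> pverts G. if v \<in> nbrs G u then f u else 0)" by (rule sum.swap)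
      also have "\<dots> = (\<Sum>u \<in> pverts G. of_nat d * f u)"
      proof (rule sum.cong)
        fix u assume u: "u \<in> pverts G"
        have "pverts G \<inter> nbrs G u = nbrs G u" using graphs_nbrs_subset[OF G'] by auto
        then show "(\<Sum>v \<in> pverts G. if v \<in> nbrs G u then f u else 0) = of_nat d * f u"
          using graphs_finite[OF G'] graphs_eq_card_nbrs[OF G(1) u] sum.inter_restrict[of "pverts G" "\<lambda>_. f u" "nbrs G u"] by simp
      qed simp
      finally show ?thesis by (simp add: t_def sum_distrib_left)
    qed
    \<comment> \<open>Summing the eigenvalue equation over all vertices, a nonzero total forces the
      eigenvalue \<open>d\<close>; otherwise the square is \<open>d - 1\<close>.\<close>
    ultimately have "t = 0 \<or> of_nat d * (1 - l) = of_nat d" by (metis mult_cancel_right)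
    moreover have "of_nat d * (1 - l) = c \<or> of_nat d * (1 - l) = - c" if "t = 0"
    proof -
      obtain v where v: "v \<in> pverts G" "f v \<noteq> 0" using f(1) by blast
      then have "(of_nat d * (1 - l))\<^sup>2 = c\<^sup>2" using sq[OF v(1)] that by simp
      then show ?thesis by (simp add: power2_eq_iff)
    qed
    ultimately show ?thesis by blast
  qed
  obtain ls where ls: "length ls = card (pverts G)" "set ls \<subseteq> spectrum (normalized_laplacian G)"
    "mat_trace (normalized_laplacian G) = sum_list ls"
    "mat_trace (normalized_laplacian G * normalized_laplacian G) = (\<Sum>l\<leftarrow>ls. l * l)"
    using mat_trace_eigenvalues[OF normalized_laplacian_carrier] by blast
  define xs where "xs = map (\<lambda>l. of_nat d * (1 - l)) ls"
  have tr1: "sum_list ls = of_nat (length ls)" and tr2: "(\<Sum>l\<leftarrow>ls. l * l) = of_nat (length ls) + of_nat (length ls) / of_nat d"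
    using regular_laplacian_traces[OF G(1) d1] ls by auto
  have sum1: "sum_list xs = 0"
  proof -
    have "(\<Sum>l\<leftarrow>ls. of_nat d * (1 - l)) = of_nat d * (of_nat (length ls) - sum_list ls)" for ls :: "complex list"
      by (induction ls) (simp_all add: algebra_simps)
    then show ?thesis using tr1 by (simp add: xs_def)
  qed
  have sum2: "(\<Sum>x\<leftarrow>xs. x\<^sup>2) = of_nat d * of_nat (length ls)"
  proof -
    have "(\<Sum>l\<leftarrow>ls. (of_nat d * (1 - l))\<^sup>2) =
      (of_nat d)\<^sup>2 * (of_nat (length ls) - 2 * sum_list ls + (\<Sum>l\<leftarrow>ls. l * l))" for ls :: "complex list"
      by (induction ls) (simp_all add: algebra_simps power2_eq_square)
    then have "(\<Sum>x\<leftarrow>xs. x\<^sup>2) = (of_nat d)\<^sup>2 * (of_nat (length ls) / of_nat d)"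
      by (simp add: xs_def o_def tr1 tr2)
    then show ?thesis using d1 by (simp add: power2_eq_square)
  qed
  have xs: "x = of_nat d \<or> x = c \<or> x = - c" if x: "x \<in> set xs" for x
  proof -
    obtain l where "l \<in> set ls" "x = of_nat d * (1 - l)" using x by (auto simp: xs_def)
    then show ?thesis using ev[of l] ls(2) by blast
  qed
  define D where "D = filter (\<lambda>x. x = of_nat d) xs"
  define C where "C = filter (\<lambda>x. x \<noteq> of_nat d) xs"
  have Dall: "set D \<subseteq> {of_nat d}" and Call: "\<And>x. x \<in> set C \<Longrightarrow> x = c \<or> x = - c"
    using xs by (auto simp: D_def C_def)
  have split: "sum_list (map h xs) = sum_list (map h D) + sum_list (map h C)" for h :: "complex \<Rightarrow> complex"
    unfolding D_def C_def by (induction xs) (simp_all add: algebra_simps)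
  have len: "length xs = length D + length C" unfolding D_def C_def by (rule sum_length_filter_compl[symmetric])
  have sD: "sum_list (map h D) = of_nat (length D) * h (of_nat d)" for h :: "complex \<Rightarrow> complex"
    using Dall by (induction D) (auto simp: algebra_simps)
  have sC: "(\<Sum>x\<leftarrow>C. x\<^sup>2) = of_nat (length C) * (of_nat d - 1)"
  proof -
    have "map (\<lambda>x. x\<^sup>2) C = map (\<lambda>_. c\<^sup>2) C" using Call by (intro map_cong) (auto simp: power2_eq_iff)
    then have "(\<Sum>x\<leftarrow>C. x\<^sup>2) = (\<Sum>x\<leftarrow>C. c\<^sup>2)" by (rule arg_cong)
    then show ?thesis by (simp add: sum_list_triv c2)
  qed
  \<comment> \<open>With \<open>N = d * (d - 1) + 1\<close> eigenvalues, \<open>d * N\<close> equals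
    \<open>length D * d^2 + (N - length D) * (d - 1)\<close>. This reduces to
    \<open>N = length D * N\<close>, so the eigenvalue \<open>d\<close> is simple.\<close>
  have "of_nat (d * length ls) = (of_nat (length D) * (of_nat d)\<^sup>2 + of_nat (length C) * (of_nat d - 1) :: complex)"
    using sum2 split[of "\<lambda>x. x\<^sup>2"] sD[of "\<lambda>x. x\<^sup>2"] sC by simp
  then have "of_nat (d * length ls) = (of_nat (length D * d\<^sup>2 + length C * (d - 1)) :: complex)"
    using d1 by (simp add: of_nat_diff)
  then have "d * length ls = length D * d\<^sup>2 + length C * (d - 1)" by (simp only: of_nat_eq_iff)
  moreover have "length ls = length D + length C" using len by (simp add: xs_def)
  moreover have "length ls = d * (d - 1) + 1" using ls(1) n by simp
  ultimately have "length D = 1"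
  proof -
    assume a: "d * length ls = length D * d\<^sup>2 + length C * (d - 1)" "length ls = length D + length C"
      "length ls = d * (d - 1) + 1"
    obtain k where k: "d = Suc k" using d1 by (cases d) auto
    have "length ls + k * length ls = length D * (Suc k)\<^sup>2 + length C * k" using a(1) k by simp
    then have "length ls + k * (length D + length C) = length D * (Suc k)\<^sup>2 + length C * k" using a(2) by simp
    then have "length ls = length D * (k * k + k + 1)" by (simp add: algebra_simps power2_eq_square)
    moreover have "length ls = 1 * (k * k + k + 1)" using a(3) k by simp
    ultimately have "length D * (k * k + k + 1) = 1 * (k * k + k + 1)" by (rule trans[OF sym])
    then show ?thesis by (subst (asm) mult_cancel2) simp
  qed
  then have "of_nat d + sum_list C = 0"
    using sum1 split[of "\<lambda>x. x"] sD[of "\<lambda>x. x"] by simp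
  moreover obtain j :: int where "sum_list C = of_int j * c" using sum_list_plus_minus[OF Call] by blast
  ultimately have "of_int j * c = - of_nat d" by (simp add: eq_neg_iff_add_eq_0 add.commute)
  \<comment> \<open>Squaring removes the root and leaves an equation in integers:
    \<open>d - 1\<close> divides \<open>d^2\<close>, which is 1 modulo \<open>d - 1\<close>.\<close>
  then have "(of_int j * c)\<^sup>2 = (of_nat d)\<^sup>2" by simp
  then have "of_int (j\<^sup>2 * (int d - 1)) = (of_int ((int d)\<^sup>2) :: complex)"
    by (simp add: power_mult_distrib c2)
  then have "j\<^sup>2 * (int d - 1) = (int d)\<^sup>2" by (simp only: of_int_eq_iff)
  then have "(int d - 1) dvd (int d)\<^sup>2" by (metis dvd_triv_right)
  moreover have "(int d)\<^sup>2 = (int d - 1) * (int d + 1) + 1" by (simp add: algebra_simps power2_eq_square)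
  ultimately have "(int d - 1) dvd 1" by (metis dvd_add_right_iff dvd_triv_left)
  then show False using G(2) by auto
qed

section \<open>Finite projective planes\<close>

locale proj_plane =
  fixes n :: nat and P :: "'p set" and L :: "'l set" and I :: "'p \<Rightarrow> 'l \<Rightarrow> bool"
  assumes plane: "projective_plane n P L I"
begin

lemma order_ge: "n \<ge> 2" and finite_P: "finite P" and finite_L: "finite L"
  using plane by (auto simp: projective_plane_def)

lemma unique_join: "p \<in> P \<Longrightarrow> q \<in> P \<Longrightarrow> p \<noteq> q \<Longrightarrow> \<exists>!l. l \<in> L \<and> I p l \<and> I q l"
  using plane unfolding projective_plane_def by (elim conjE) simp

lemma unique_meet: "l \<in> L \<Longrightarrow> m \<in> L \<Longrightarrow> l \<noteq> m \<Longrightarrow> \<exists>!p. p \<in> P \<and> I p l \<and> I p m"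
  using plane unfolding projective_plane_def by (elim conjE) simp

lemma join: "p \<in> P \<Longrightarrow> q \<in> P \<Longrightarrow> p \<noteq> q \<Longrightarrow> \<exists>l \<in> L. I p l \<and> I q l"
  using unique_join by (metis (no_types, lifting))

lemma meet: "l \<in> L \<Longrightarrow> m \<in> L \<Longrightarrow> l \<noteq> m \<Longrightarrow> \<exists>p \<in> P. I p l \<and> I p m"
  using unique_meet by (metis (no_types, lifting))

lemma join_unique:
  "p \<in> P \<Longrightarrow> q \<in> P \<Longrightarrow> p \<noteq> q \<Longrightarrow> l \<in> L \<Longrightarrow> m \<in> L \<Longrightarrow> I p l \<Longrightarrow> I q l \<Longrightarrow> I p m \<Longrightarrow> I q m \<Longrightarrow> l = m"
  using unique_join by (metis (no_types, lifting))

lemma quadrangle: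
  obtains a b c e where "{a, b, c, e} \<subseteq> P" "a \<noteq> b" "a \<noteq> c" "a \<noteq> e" "b \<noteq> c" "b \<noteq> e" "c \<noteq> e"
    "\<And>l x y z. l \<in> L \<Longrightarrow> {x, y, z} \<subseteq> {a, b, c, e} \<Longrightarrow> x \<noteq> y \<Longrightarrow> x \<noteq> z \<Longrightarrow> y \<noteq> z \<Longrightarrow> I x l \<Longrightarrow> I y l \<Longrightarrow> \<not> I z l"
proof -
  obtain Q where Q: "Q \<subseteq> P" "card Q = 4" "\<And>T. T \<subseteq> Q \<Longrightarrow> card T = 3 \<Longrightarrow> \<not> (\<exists>l \<in> L. \<forall>p \<in> T. I p l)"
    using plane unfolding projective_plane_def by (elim conjE exE) blast
  obtain a b c e where q: "Q = {a, b, c, e}" "a \<noteq> b" "a \<noteq> c" "a \<noteq> e" "b \<noteq> c" "b \<noteq> e" "c \<noteq> e"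
    using Q(2) by (auto simp: card_Suc_eq numeral_eq_Suc)
  show ?thesis
  proof (rule that[OF _ q(2-)])
    show "{a, b, c, e} \<subseteq> P" using Q q by simp
    fix l x y z assume h: "l \<in> L" "{x, y, z} \<subseteq> {a, b, c, e}" "x \<noteq> y" "x \<noteq> z" "y \<noteq> z" "I x l" "I y l"
    then have "card {x, y, z} = 3" by simp
    with Q(3)[of "{x, y, z}"] h q(1) show "\<not> I z l" by blast
  qed
qed

text \<open>Two lines covering all points would contain two points each of a quadrangle; a diagonal
  point, where lines joining points across meet, lies on neither.\<close>

lemma point_off_two_lines:
  assumes l: "l \<in> L" and m: "m \<in> L"
  shows "\<exists>t \<in> P. \<not> I t l \<and> \<not> I t m"
proof (rule ccontr)
  assume neg: "\<not> ?thesis"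
  then have cov: "I x l \<or> I x m" if "x \<in> P" for x using that by blast
  obtain a b c e where P: "{a, b, c, e} \<subseteq> P" and ne: "a \<noteq> b" "a \<noteq> c" "a \<noteq> e" "b \<noteq> c" "b \<noteq> e" "c \<noteq> e"
    and q: "\<And>l x y z. l \<in> L \<Longrightarrow> {x, y, z} \<subseteq> {a, b, c, e} \<Longrightarrow> x \<noteq> y \<Longrightarrow> x \<noteq> z \<Longrightarrow> y \<noteq> z \<Longrightarrow> I x l \<Longrightarrow> I y l \<Longrightarrow> \<not> I z l"
    using quadrangle by metis
  have core: False if xs: "{x, y, z, w} = {a, b, c, e}" "x \<noteq> y" "x \<noteq> z" "x \<noteq> w" "y \<noteq> z" "y \<noteq> w" "z \<noteq> w"
    and on: "I x l" "I y l" "I z m" "I w m" for x y z w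
  proof -
    have mem: "x \<in> P" "y \<in> P" "z \<in> P" "w \<in> P" using P xs by auto
    have sub: "{x, y, z} \<subseteq> {a, b, c, e}" "{x, y, w} \<subseteq> {a, b, c, e}" "{x, z, w} \<subseteq> {a, b, c, e}" "{y, z, w} \<subseteq> {a, b, c, e}"
      using xs(1) by blast+
    obtain g where g: "g \<in> L" "I x g" "I z g" using join[of x z] mem xs by auto
    obtain h where h: "h \<in> L" "I y h" "I w h" using join[of y w] mem xs by auto
    have "\<not> I y g" using q[OF g(1), of x z y] sub g xs by auto
    then have "g \<noteq> h" using h by auto
    then obtain t where t: "t \<in> P" "I t g" "I t h" using meet g h by blast
    have xh: "\<not> I x h" using q[OF h(1), of y w x] sub h xs by auto
    have zh: "\<not> I z h" using q[OF h(1), of y w z] sub h xs by auto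
    have zl: "\<not> I z l" using q[OF l, of x y z] sub on xs by auto
    have xm: "\<not> I x m" using q[OF m, of z w x] sub on xs by auto
    have "\<not> I t l"
    proof
      assume "I t l"
      have "t \<noteq> x" using t xh by auto
      then have "l = g" using join_unique[of t x l g] t g on l mem \<open>I t l\<close> by auto
      then show False using g zl by simp
    qed
    moreover have "\<not> I t m"
    proof
      assume "I t m"
      have "t \<noteq> z" using t zh by auto
      then have "m = g" using join_unique[of t z m g] t g on m mem \<open>I t m\<close> by auto
      then show False using g xm by simp
    qed
    ultimately show False using cov t by blast
  qed
  have c: "I a l \<or> I a m" "I b l \<or> I b m" "I c l \<or> I c m" "I e l \<or> I e m" using cov P by auto
  have q3: "\<not> (I x k \<and> I y k \<and> I z k)" if "k \<in> L" "{x, y, z} \<subseteq> {a, b, c, e}" "x \<noteq> y" "x \<noteq> z" "y \<noteq> z" for k x y z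
    using q that by blast
  have "\<not> (I a k \<and> I b k \<and> I c k)" "\<not> (I a k \<and> I b k \<and> I e k)" "\<not> (I a k \<and> I c k \<and> I e k)" "\<not> (I b k \<and> I c k \<and> I e k)"
    if "k \<in> L" for k
    using q3[OF that] ne by auto
  note t = this[OF l] this[OF m]
  have "\<not> (I a l \<and> I b l \<and> I c m \<and> I e m)" "\<not> (I a l \<and> I c l \<and> I b m \<and> I e m)"
    "\<not> (I a l \<and> I e l \<and> I b m \<and> I c m)" "\<not> (I c l \<and> I e l \<and> I a m \<and> I b m)"
    "\<not> (I b l \<and> I e l \<and> I a m \<and> I c m)" "\<not> (I b l \<and> I c l \<and> I a m \<and> I e m)"
    using core[of a b c e] core[of a c b e] core[of a e b c] core[of c e a b] core[of b e a c] core[of b c a e]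
      ne ne[symmetric] by blast+
  then show False using c t by blast
qed

text \<open>Central projection from a point off both lines is injective from \<open>l\<close> to
  \<open>m\<close>. By symmetry all lines have the size prescribed for one.\<close>

lemma line_card_eq:
  assumes l: "l \<in> L" and m: "m \<in> L"
  shows "card {p \<in> P. I p l} \<le> card {p \<in> P. I p m}"
proof -
  obtain t where t: "t \<in> P" "\<not> I t l" "\<not> I t m" using point_off_two_lines[OF l m] by blast
  have "\<exists>q. q \<in> P \<and> I q m \<and> (\<exists>g \<in> L. I t g \<and> I p g \<and> I q g)" if p: "p \<in> P" "I p l" for p
  proof -
    have "t \<noteq> p" using p t by auto
    then obtain g where g: "g \<in> L" "I t g" "I p g" using join t p by blast
    then have "g \<noteq> m" using t by auto
    then show ?thesis using meet[OF g(1) m] g by blast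
  qed
  then obtain f where f: "\<And>p. p \<in> P \<Longrightarrow> I p l \<Longrightarrow> f p \<in> P \<and> I (f p) m \<and> (\<exists>g \<in> L. I t g \<and> I p g \<and> I (f p) g)"
    by metis
  have "inj_on f {p \<in> P. I p l}"
  proof (rule inj_onI)
    fix p q assume "p \<in> {p \<in> P. I p l}" "q \<in> {p \<in> P. I p l}" and eq: "f p = f q"
    then have p: "p \<in> P" "I p l" "q \<in> P" "I q l" by auto
    obtain g h where g: "g \<in> L" "I t g" "I p g" "I (f p) g" and h: "h \<in> L" "I t h" "I q h" "I (f q) h"
      using f p by metis
    have fp: "f p \<in> P" "I (f p) m" using f p by auto
    then have "f p \<noteq> t" using t by auto
    then have "g = h" using join_unique[of "f p" t g h] g h t fp eq by auto
    show "p = q"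
    proof (rule ccontr)
      assume "p \<noteq> q"
      then have "l = g" using join_unique[of p q l g] p g h l \<open>g = h\<close> by auto
      then show False using g t by simp
    qed
  qed
  then show ?thesis
    using f finite_P by (intro card_inj_on_le) auto
qed

lemma line_card: "l \<in> L \<Longrightarrow> card {p \<in> P. I p l} = n + 1"
proof -
  assume l: "l \<in> L"
  obtain m where "m \<in> L" "card {p \<in> P. I p m} = n + 1"
    using plane unfolding projective_plane_def by (elim conjE bexE)
  then show ?thesis using line_card_eq[OF l] line_card_eq[OF _ l] by (metis le_antisym)
qed

lemma line_avoiding_point:
  assumes p: "p \<in> P"
  shows "\<exists>l \<in> L. \<not> I p l"
proof -
  obtain a b c e where P: "{a, b, c, e} \<subseteq> P" and ne: "a \<noteq> b" "a \<noteq> c" "a \<noteq> e" "b \<noteq> c" "b \<noteq> e" "c \<noteq> e"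
    and q: "\<And>l x y z. l \<in> L \<Longrightarrow> {x, y, z} \<subseteq> {a, b, c, e} \<Longrightarrow> x \<noteq> y \<Longrightarrow> x \<noteq> z \<Longrightarrow> y \<noteq> z \<Longrightarrow> I x l \<Longrightarrow> I y l \<Longrightarrow> \<not> I z l"
    using quadrangle by metis
  obtain x y z where xyz: "{x, y, z} \<subseteq> {a, b, c, e}" "x \<noteq> y" "x \<noteq> z" "y \<noteq> z" "x \<noteq> p"
  proof (cases "a = p")
    case True
    then show ?thesis using that[of b c e] ne by auto
  next
    case False
    then show ?thesis using that[of a b c] ne by auto
  qed
  have mem: "x \<in> P" "y \<in> P" "z \<in> P" using P xyz by auto
  obtain g where g: "g \<in> L" "I x g" "I y g" using join[of x y] mem xyz by auto
  obtain h where h: "h \<in> L" "I x h" "I z h" using join[of x z] mem xyz by auto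
  have "\<not> I z g" using q[OF g(1) xyz(1-4)] g by auto
  then have "g \<noteq> h" using h by auto
  then show ?thesis using join_unique[of x p g h] g h p mem xyz by blast
qed

text \<open>The lines through \<open>p\<close> correspond to the points of a line that misses
  \<open>p\<close>.\<close>

lemma point_card:
  assumes p: "p \<in> P"
  shows "card {l \<in> L. I p l} = n + 1"
proof -
  obtain m where m: "m \<in> L" "\<not> I p m" using line_avoiding_point[OF p] by blast
  have "\<exists>q. q \<in> P \<and> I q m \<and> I q l" if "l \<in> L" "I p l" for l
    using meet[of l m] that m by blast
  then obtain f where f: "\<And>l. l \<in> L \<Longrightarrow> I p l \<Longrightarrow> f l \<in> P \<and> I (f l) m \<and> I (f l) l" by metis
  have "bij_betw f {l \<in> L. I p l} {q \<in> P. I q m}"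
  proof (rule bij_betwI')
    fix l l' assume "l \<in> {l \<in> L. I p l}" "l' \<in> {l \<in> L. I p l}"
    then have l: "l \<in> L" "I p l" "l' \<in> L" "I p l'" by auto
    then have "f l \<noteq> p" using f m by auto
    then show "(f l = f l') = (l = l')" using join_unique[of "f l" p l l'] f[of l] f[of l'] l p by auto
  next
    fix l assume "l \<in> {l \<in> L. I p l}"
    then show "f l \<in> {q \<in> P. I q m}" using f by auto
  next
    fix q assume "q \<in> {q \<in> P. I q m}"
    then have q: "q \<in> P" "I q m" by auto
    then have "q \<noteq> p" using m by auto
    then obtain l where l: "l \<in> L" "I p l" "I q l" using join p q by blast
    have "f l = q"
    proof (rule ccontr)
      assume "f l \<noteq> q"
      then have "l = m" using join_unique[of "f l" q l m] f[of l] l q m by auto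
      then show False using l m by simp
    qed
    then show "\<exists>l \<in> {l \<in> L. I p l}. q = f l" using l by auto
  qed
  then show ?thesis using line_card[OF m(1)] by (simp add: bij_betw_same_card)
qed

end

section \<open>Extremal graphs\<close>

text \<open>A plane inside \<open>G\<close>, with \<open>X\<close> as points and the other vertices
  as lines. The notion is self-dual and carries no quadrangle axiom; degree at least 3 will provide
  a quadrangle.\<close>

definition plane_graph :: "nat \<Rightarrow> 'a pair_pre_digraph \<Rightarrow> 'a set \<Rightarrow> bool" where
  "plane_graph d G X \<longleftrightarrow> G \<in> graphs_eq d \<and> X \<subseteq> pverts G \<and>
     (\<forall>x \<in> X. nbrs G x \<subseteq> pverts G - X) \<and> (\<forall>y \<in> pverts G - X. nbrs G y \<subseteq> X) \<and>
     (\<forall>x \<in> X. \<forall>x' \<in> X. x \<noteq> x' \<longrightarrow> card (nbrs G x \<inter> nbrs G x') = 1) \<and>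
     (\<forall>y \<in> pverts G - X. \<forall>y' \<in> pverts G - X. y \<noteq> y' \<longrightarrow> card (nbrs G y \<inter> nbrs G y') = 1)"

lemma plane_graph_complement: "plane_graph d G X \<Longrightarrow> plane_graph d G (pverts G - X)"
  unfolding plane_graph_def by (auto simp: Diff_Diff_Int Int_absorb1 inf.absorb_iff2)

text \<open>Two steps from the complete component \<open>K\<close> lead back to \<open>K\<close>. By
  connectedness \<open>K\<close> is therefore one side of a bipartition, or it is everything and any
  two vertices have exactly one common neighbour.\<close>

lemma plane_graph_of_gap:
  assumes G: "G \<in> graphs_eq d" "d \<ge> 3" and gap: "gap G > sqrt (real d - 2) / real d"
  shows "\<exists>X. plane_graph d G X"
proof -
  let ?N = "nbrs G" and ?V = "pverts G"
  have G': "G \<in> graphs" using G by (simp add: graphs_eq_def)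
  interpret posdef_linear_graph ?V ?N d by (rule posdef_linear_graph_of_gap[OF assms])
  obtain K where K: "K \<subseteq> ?V" "K \<noteq> {}" "card K = d * (d - 1) + 1"
    and clique': "\<forall>x \<in> K. \<forall>y \<in> K. x \<noteq> y \<longrightarrow> col x y"
    and closed': "\<forall>x \<in> K. \<forall>y. col x y \<longrightarrow> y \<in> K"
    using complete_component[OF graphs_nonempty[OF G']] by (elim exE conjE) (rule that; assumption)
  have clique: "col x y" if "x \<in> K" "y \<in> K" "x \<noteq> y" for x y using clique' that by simp
  have closed: "y \<in> K" if "x \<in> K" "col x y" for x y using closed' that by simp
  have one: "card (?N x \<inter> ?N y) = 1" if xy: "col x y" for x y
  proof -
    have V: "x \<in> ?V" "y \<in> ?V" "x \<noteq> y" using col_in_V[OF xy] xy by (auto simp: col_def)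
    obtain w where "w \<in> ?V" "x \<in> ?N w" "y \<in> ?N w" using xy by (auto simp: col_def)
    then have "w \<in> ?N x \<inter> ?N y" using graphs_nbrs_sym[OF G'] by blast
    then have "card (?N x \<inter> ?N y) \<noteq> 0" using finite_N[OF V(1)] by auto
    then show ?thesis using N_linear[OF V] by simp
  qed
  have return: "z \<in> K" if x: "x \<in> K" "y \<in> ?N x" "z \<in> ?N y" for x y z
  proof (cases "z = x")
    case False
    have "y \<in> ?V" "x \<in> ?N y" using graphs_nbrs_subset[OF G'] graphs_nbrs_sym[OF G'] x by auto
    then have "col x z" using False x by (auto simp: col_def)
    then show ?thesis by (rule closed[OF x(1)])
  qed (use x in simp)
  have cover: "K \<union> (\<Union>x \<in> K. ?N x) = ?V"
  proof (rule graphs_closed_set[OF G'])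
    show "?N x \<subseteq> K \<union> (\<Union>x \<in> K. ?N x)" if "x \<in> K \<union> (\<Union>x \<in> K. ?N x)" for x
      using that return by blast
  qed (use K graphs_nbrs_subset[OF G'] in auto)
  \<comment> \<open>A single edge inside \<open>K\<close> spreads: every other vertex of
    \<open>K\<close> shares a neighbour with \<open>y\<close>, which lies in \<open>K\<close>, so
    all neighbours of that vertex do.\<close>
  have disj: "K \<inter> (\<Union>x \<in> K. ?N x) = {}"
  proof (rule ccontr)
    assume "K \<inter> (\<Union>x \<in> K. ?N x) \<noteq> {}"
    then obtain x0 y where y: "y \<in> K" "x0 \<in> K" "y \<in> ?N x0" by blast
    have yK: "?N y \<subseteq> K" using return y by blast
    have sub: "?N x \<subseteq> K" if x: "x \<in> K" for x
    proof (cases "x = y")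
      case False
      then have "col y x" using clique y x by blast
      then obtain w where w: "w \<in> ?V" "y \<in> ?N w" "x \<in> ?N w" by (auto simp: col_def)
      then have "w \<in> ?N y" using graphs_nbrs_sym[OF G'] by blast
      then have "w \<in> K" using yK by blast
      then show ?thesis using return[OF _ w(3)] by blast
    qed (use yK in simp)
    then have "K = ?V" using K by (intro graphs_closed_set[OF G']) auto
    then show False
      using no_regular_friendship_graph[OF G] K(3) one clique by blast
  qed
  define Y where "Y = ?V - K"
  have Y: "Y = (\<Union>x \<in> K. ?N x)" using cover disj unfolding Y_def by blast
  have NK: "?N x \<subseteq> Y" if "x \<in> K" for x using that Y by blast
  have NY: "?N y \<subseteq> K" if "y \<in> Y" for y using that return Y by blast
  have fin: "finite K" "finite Y" using K finite_V finite_subset by (auto simp: Y_def)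
  have "(\<Sum>x \<in> K. card {y \<in> Y. y \<in> ?N x}) = d * card Y"
  proof (rule sum_multicount[OF fin], rule ballI)
    fix y assume y: "y \<in> Y"
    have "{x \<in> K. y \<in> ?N x} = ?N y" using NY[OF y] graphs_nbrs_sym[OF G'] by blast
    then show "card {x \<in> K. y \<in> ?N x} = d" using y N_card by (simp add: Y_def)
  qed
  moreover have "card {y \<in> Y. y \<in> ?N x} = d" if x: "x \<in> K" for x
  proof -
    have "{y \<in> Y. y \<in> ?N x} = ?N x" using NK[OF x] by blast
    then show ?thesis using x K N_card by auto
  qed
  ultimately have "card K = card Y" using G(2) by simp
  then have cardY: "card Y = d * (d - 1) + 1" using K by simp
  \<comment> \<open>The \<open>d * (d - 1)\<close> points collinear with \<open>y\<close> lie in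
    \<open>Y - {y}\<close>, a set of the same size, so the other side is a clique too.\<close>
  have colY: "col y y'" if y: "y \<in> Y" "y' \<in> Y" "y \<noteq> y'" for y y'
  proof -
    have "{z \<in> ?V. col y z} \<subseteq> Y - {y}"
    proof
      fix z assume "z \<in> {z \<in> ?V. col y z}"
      then obtain w where w: "y \<noteq> z" "y \<in> ?N w" "z \<in> ?N w" by (auto simp: col_def)
      then have "w \<in> ?N y" using graphs_nbrs_sym[OF G'] by blast
      then have "w \<in> K" using NY y by blast
      then show "z \<in> Y - {y}" using NK w by blast
    qed
    moreover have "card {z \<in> ?V. col y z} = card (Y - {y})"
      using col_card[of y] y cardY fin by (auto simp: Y_def)
    ultimately have "{z \<in> ?V. col y z} = Y - {y}" using fin by (intro card_subset_eq) auto
    then show ?thesis using y by blast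
  qed
  have "plane_graph d G K"
    unfolding plane_graph_def Y_def[symmetric]
    by (intro conjI ballI impI G(1) K(1) NK NY one clique colY; assumption)
  then show ?thesis by blast
qed

text \<open>On one side \<open>Z\<close> the square of the adjacency matrix acts as
  \<open>(d - 1) I + J\<close>, with J the all-ones matrix, so it can only have the eigenvalues
  \<open>d - 1\<close> and \<open>d - 1 + card Z\<close>. An eigenfunction is nonzero on at least
  one side.\<close>

lemma plane_graph_gap_ge:
  assumes "plane_graph d G X" and d: "d \<ge> 1"
  shows "sqrt (real d - 1) / real d \<le> gap G"
proof (rule gap_ge)
  let ?V = "pverts G" and ?N = "nbrs G"
  have G: "G \<in> graphs_eq d" using assms by (simp add: plane_graph_def)
  then show G': "G \<in> graphs" by (simp add: graphs_eq_def)
  fix f :: "'a \<Rightarrow> complex" and s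
  assume f0: "\<exists>v \<in> ?V. f v \<noteq> 0" and ev: "\<And>v. v \<in> ?V \<Longrightarrow> (\<Sum>u \<in> ?N v. f u) / of_nat (card (?N v)) = s * f v"
  define c where "c = (of_nat d * s)\<^sup>2"
  have side: "c * f v = (of_nat d - 1) * f v + (\<Sum>u \<in> Z. f u)"
    if Z: "plane_graph d G Z" and v: "v \<in> Z" for v Z
  proof -
    have ZV: "Z \<subseteq> ?V" and NZ: "\<And>x. x \<in> Z \<Longrightarrow> ?N x \<subseteq> ?V - Z" "\<And>y. y \<in> ?V - Z \<Longrightarrow> ?N y \<subseteq> Z"
      and one: "\<And>x x'. x \<in> Z \<Longrightarrow> x' \<in> Z \<Longrightarrow> x \<noteq> x' \<Longrightarrow> card (?N x \<inter> ?N x') = 1"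
      using Z unfolding plane_graph_def by blast+
    have vV: "v \<in> ?V" using v ZV by auto
    have fin: "finite Z" using ZV graphs_finite[OF G'] finite_subset by blast
    have "c * f v = (\<Sum>u \<in> ?V. of_nat (card (?N v \<inter> ?N u)) * f u)"
      unfolding c_def by (rule eigenfunction_two_step[OF G d ev vV])
    also have "\<dots> = (\<Sum>u \<in> Z. of_nat (card (?N v \<inter> ?N u)) * f u)"
    proof (rule sum.mono_neutral_right)
      show "\<forall>u \<in> ?V - Z. of_nat (card (?N v \<inter> ?N u)) * f u = 0"
      proof
        fix u assume "u \<in> ?V - Z"
        then have "?N v \<inter> ?N u = {}" using NZ(1)[OF v] NZ(2) by blast
        then show "of_nat (card (?N v \<inter> ?N u)) * f u = 0" by simp
      qed
    qed (use ZV graphs_finite[OF G'] in auto)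
    also have "\<dots> = (\<Sum>u \<in> Z. f u + (if u = v then (of_nat d - 1) * f v else 0))"
      by (rule sum.cong) (use one v graphs_eq_card_nbrs[OF G vV] in \<open>auto simp: algebra_simps\<close>)
    also have "\<dots> = (\<Sum>u \<in> Z. f u) + (of_nat d - 1) * f v" using v fin by (simp add: sum.distrib)
    finally show ?thesis by simp
  qed
  have norm_c: "real d - 1 \<le> cmod c" if Z: "plane_graph d G Z" and v: "v \<in> Z" "f v \<noteq> 0" for Z v
  proof (cases "(\<Sum>u \<in> Z. f u) = 0")
    case True
    then have "c = of_nat d - 1" using side[OF Z v(1)] v(2) by simp
    then have "c = complex_of_real (real d - 1)" by simp
    then show ?thesis by (metis abs_ge_self norm_of_real)
  next
    case False
    have "c * (\<Sum>u \<in> Z. f u) = (\<Sum>v \<in> Z. (of_nat d - 1) * f v + (\<Sum>u \<in> Z. f u))"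
      unfolding sum_distrib_left by (rule sum.cong) (use side[OF Z] in auto)
    also have "\<dots> = (of_nat d - 1) * (\<Sum>u \<in> Z. f u) + of_nat (card Z) * (\<Sum>u \<in> Z. f u)"
      unfolding sum.distrib sum_distrib_left[symmetric] by simp
    also have "\<dots> = (of_nat d - 1 + of_nat (card Z)) * (\<Sum>u \<in> Z. f u)" by (simp add: algebra_simps)
    finally have "c = of_nat d - 1 + of_nat (card Z)" using False by simp
    then have "c = complex_of_real (real d - 1 + real (card Z))" by simp
    then have "cmod c = \<bar>real d - 1 + real (card Z)\<bar>" by (metis norm_of_real)
    then show ?thesis by linarith
  qed
  obtain v where v: "v \<in> ?V" "f v \<noteq> 0" using f0 by blast
  have "real d - 1 \<le> cmod c"
    using norm_c[OF assms(1), of v] norm_c[OF plane_graph_complement[OF assms(1)], of v] v by blast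
  also have "cmod c = (real d * cmod s)\<^sup>2" by (simp add: c_def norm_power norm_mult)
  finally have "sqrt (real d - 1) \<le> real d * cmod s" by (intro real_le_lsqrt) auto
  then show "sqrt (real d - 1) / real d \<le> cmod s" using d by (simp add: field_simps)
qed

lemma plane_graph_gap:
  assumes "plane_graph d G X" "d \<ge> 3"
  shows "gap G = sqrt (real d - 1) / real d"
  using plane_graph_gap_ge[OF assms(1)] regular_gap_le[of G d] assms by (auto simp: plane_graph_def intro: antisym)

text \<open>The quadrangle consists of two points on each of two lines through \<open>x\<close>, all
  different from \<open>x\<close>; this is where lines need at least three points.\<close>

lemma projective_plane_of_plane_graph:
  assumes X: "plane_graph d G X" and d: "d \<ge> 3"
  shows "projective_plane (d - 1) X (pverts G - X) (\<lambda>x y. (x, y) \<in> parcs G)"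
proof -
  let ?V = "pverts G" and ?N = "nbrs G"
  have G: "G \<in> graphs_eq d" and XV: "X \<subseteq> ?V"
    and NX: "\<And>x. x \<in> X \<Longrightarrow> ?N x \<subseteq> ?V - X" and NY: "\<And>y. y \<in> ?V - X \<Longrightarrow> ?N y \<subseteq> X"
    and oneX: "\<And>x x'. x \<in> X \<Longrightarrow> x' \<in> X \<Longrightarrow> x \<noteq> x' \<Longrightarrow> card (?N x \<inter> ?N x') = 1"
    and oneY: "\<And>x x'. x \<in> ?V - X \<Longrightarrow> x' \<in> ?V - X \<Longrightarrow> x \<noteq> x' \<Longrightarrow> card (?N x \<inter> ?N x') = 1"
    using X unfolding plane_graph_def by blast+
  have G': "G \<in> graphs" using G by (simp add: graphs_eq_def)
  have arc: "(x, y) \<in> parcs G \<longleftrightarrow> y \<in> ?N x" for x y by (simp add: nbrs_def)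
  have swap: "y \<in> ?N x \<longleftrightarrow> x \<in> ?N y" for x y using graphs_nbrs_sym[OF G'] by blast
  have join: "\<exists>!l. l \<in> ?V - X \<and> l \<in> ?N p \<and> l \<in> ?N q" if p: "p \<in> X" "q \<in> X" "p \<noteq> q" for p q
  proof -
    obtain l where "?N p \<inter> ?N q = {l}" using oneX[OF p] by (auto simp: card_1_singleton_iff)
    then show ?thesis using NX[OF p(1)] by (intro ex1I[of _ l]) blast+
  qed
  have meet: "\<exists>!p. p \<in> X \<and> l \<in> ?N p \<and> m \<in> ?N p" if l: "l \<in> ?V - X" "m \<in> ?V - X" "l \<noteq> m" for l m
  proof -
    obtain p where "?N l \<inter> ?N m = {p}" using oneY[OF l] by (auto simp: card_1_singleton_iff)
    then show ?thesis unfolding swap[of l] swap[of m] using NY[OF l(1)] by (intro ex1I[of _ p]) blast+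
  qed
  have deg: "card (?N v) = d" if "v \<in> ?V" for v using graphs_eq_card_nbrs[OF G that] .
  have pick2: "\<exists>p q. p \<in> ?N v \<and> q \<in> ?N v \<and> p \<noteq> q \<and> p \<noteq> t \<and> q \<noteq> t" if v: "v \<in> ?V" for v t
  proof -
    have "card (?N v - {t}) \<ge> d - 1" using deg[OF v] by (simp add: card_Diff_singleton_if)
    then have "card (?N v - {t}) \<ge> 2" using d by simp
    then obtain S where "S \<subseteq> ?N v - {t}" "card S = 2" by (meson obtain_subset_with_card_n)
    then show ?thesis by (auto simp: card_2_iff)
  qed
  obtain v where v: "v \<in> ?V" using graphs_nonempty[OF G'] by blast
  obtain x where x: "x \<in> X"
  proof (cases "v \<in> X")
    case True
    then show ?thesis using that by blast
  next
    case False
    then obtain p where "p \<in> ?N v" using pick2[OF v] by blast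
    then show ?thesis using NY[of v] v False that by blast
  qed
  obtain l m where lm: "l \<in> ?N x" "m \<in> ?N x" "l \<noteq> m" using pick2[of x] x XV by blast
  have lmY: "l \<in> ?V - X" "m \<in> ?V - X" using lm NX[OF x] by blast+
  obtain p q where p: "p \<in> ?N l" "q \<in> ?N l" "p \<noteq> q" "p \<noteq> x" "q \<noteq> x" using pick2[of l x] lmY by blast
  obtain r s where r: "r \<in> ?N m" "s \<in> ?N m" "r \<noteq> s" "r \<noteq> x" "s \<noteq> x" using pick2[of m x] lmY by blast
  have PX: "p \<in> X" "q \<in> X" "r \<in> X" "s \<in> X" using p r NY lmY by blast+
  have inter: "t = x" if "t \<in> ?N l" "t \<in> ?N m" for t
  proof -
    obtain t' where "?N l \<inter> ?N m = {t'}" using oneY[OF lmY lm(3)] by (auto simp: card_1_singleton_iff)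
    moreover have "x \<in> ?N l \<inter> ?N m" using lm swap by blast
    ultimately show ?thesis using that by (metis IntI singletonD)
  qed
  have dist: "p \<noteq> r" "p \<noteq> s" "q \<noteq> r" "q \<noteq> s" using inter p r by blast+
  have same: "k = k'" if k: "k \<in> ?V - X" "k' \<in> ?V - X" "a \<in> ?N k" "b \<in> ?N k" "a \<in> ?N k'" "b \<in> ?N k'" "a \<noteq> b" for k k' a b
  proof (rule ccontr)
    assume "k \<noteq> k'"
    then obtain t where "?N k \<inter> ?N k' = {t}" using oneY[OF k(1,2)] by (auto simp: card_1_singleton_iff)
    then show False using k(3-7) by (metis IntI singletonD)
  qed
  have no3: "\<not> (\<exists>k \<in> ?V - X. \<forall>t \<in> T. k \<in> ?N t)" if T: "T \<subseteq> {p, q, r, s}" "card T = 3" for T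
  proof
    assume "\<exists>k \<in> ?V - X. \<forall>t \<in> T. k \<in> ?N t"
    then obtain k where k: "k \<in> ?V - X" "\<And>t. t \<in> T \<Longrightarrow> t \<in> ?N k" using swap by blast
    have two: "p \<in> T \<and> q \<in> T \<and> (r \<in> T \<or> s \<in> T) \<or> r \<in> T \<and> s \<in> T \<and> (p \<in> T \<or> q \<in> T)"
    proof (rule ccontr)
      assume neg: "\<not> ?thesis"
      then have "T \<subseteq> {p, q} \<or> T \<subseteq> {r, s} \<or> T \<subseteq> {p, r} \<or> T \<subseteq> {p, s} \<or> T \<subseteq> {q, r} \<or> T \<subseteq> {q, s}"
        using T(1) by blast
      moreover have "card T \<le> 2" if "T \<subseteq> {a, b}" for a b
      proof -
        have "card T \<le> card {a, b}" using that by (intro card_mono) auto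
        also have "\<dots> \<le> 2" by (simp add: card_insert_if)
        finally show ?thesis .
      qed
      ultimately have "card T \<le> 2" by blast
      then show False using T by simp
    qed
    then show False
    proof (elim disjE conjE)
      assume h: "p \<in> T" "q \<in> T" "r \<in> T"
      then have "k = l" using same[OF k(1) lmY(1) k(2)[of p] k(2)[of q]] p by blast
      then show False using inter k(2)[of r] h r by blast
    next
      assume h: "p \<in> T" "q \<in> T" "s \<in> T"
      then have "k = l" using same[OF k(1) lmY(1) k(2)[of p] k(2)[of q]] p by blast
      then show False using inter k(2)[of s] h r by blast
    next
      assume h: "r \<in> T" "s \<in> T" "p \<in> T"
      then have "k = m" using same[OF k(1) lmY(2) k(2)[of r] k(2)[of s]] r by blast
      then show False using inter k(2)[of p] h p by blast
    next
      assume h: "r \<in> T" "s \<in> T" "q \<in> T"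
      then have "k = m" using same[OF k(1) lmY(2) k(2)[of r] k(2)[of s]] r by blast
      then show False using inter k(2)[of q] h p by blast
    qed
  qed
  show ?thesis
    unfolding projective_plane_def arc
  proof (intro conjI ballI impI)
    show "2 \<le> d - 1" using d by simp
    show "finite X" "finite (?V - X)" using XV graphs_finite[OF G'] finite_subset by blast+
    show "\<exists>!l. l \<in> ?V - X \<and> l \<in> ?N p \<and> l \<in> ?N q" if "p \<in> X" "q \<in> X" "p \<noteq> q" for p q using join[OF that] .
    show "\<exists>!p. p \<in> X \<and> l \<in> ?N p \<and> m \<in> ?N p" if "l \<in> ?V - X" "m \<in> ?V - X" "l \<noteq> m" for l m using meet[OF that] .
    show "\<exists>Q \<subseteq> X. card Q = 4 \<and> (\<forall>T \<subseteq> Q. card T = 3 \<longrightarrow> \<not> (\<exists>l \<in> ?V - X. \<forall>p \<in> T. l \<in> ?N p))"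
      using PX p(3) r(3) dist no3 by (intro exI[of _ "{p, q, r, s}"]) auto
    have "{p \<in> X. l \<in> ?N p} = ?N l" using NY[OF lmY(1)] swap by blast
    then have "card {p \<in> X. l \<in> ?N p} = d - 1 + 1" using deg lmY d by simp
    then show "\<exists>l \<in> ?V - X. card {p \<in> X. l \<in> ?N p} = d - 1 + 1" using lmY by blast
  qed
qed

section \<open>Incidence graphs\<close>

lemma graphsI:
  assumes fin: "finite (pverts G)" and sub: "parcs G \<subseteq> pverts G \<times> pverts G"
    and sym: "\<And>x y. (x, y) \<in> parcs G \<Longrightarrow> (y, x) \<in> parcs G" and irrefl: "\<And>x. (x, x) \<notin> parcs G"
    and card: "card (pverts G) \<ge> 3"
    and conn: "\<And>S. S \<subseteq> pverts G \<Longrightarrow> S \<noteq> {} \<Longrightarrow> (\<And>x. x \<in> S \<Longrightarrow> nbrs G x \<subseteq> S) \<Longrightarrow> S = pverts G"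
  shows "G \<in> graphs"
proof -
  interpret pair_graph G
  proof unfold_locales
    show "finite (parcs G)" using fin sub by (meson finite_SigmaI finite_subset)
    show "symmetric (with_proj G)" using sym by (auto simp: symmetric_def sym_def)
    show "fst e \<noteq> snd e" if "e \<in> parcs G" for e using that irrefl by (metis prod.collapse)
  qed (use sub fin in auto)
  have "strongly_connected (with_proj G)"
  proof
    show "verts (with_proj G) \<noteq> {}" using card by auto
    fix u v assume "u \<in> verts (with_proj G)" "v \<in> verts (with_proj G)"
    then have u: "u \<in> pverts G" and v: "v \<in> pverts G" by auto
    have "{y \<in> pverts G. u \<rightarrow>\<^sup>*\<^bsub>with_proj G\<^esub> y} = pverts G"
    proof (rule conn)
      show "{y \<in> pverts G. u \<rightarrow>\<^sup>*\<^bsub>with_proj G\<^esub> y} \<noteq> {}" using u by auto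
      fix x assume x: "x \<in> {y \<in> pverts G. u \<rightarrow>\<^sup>*\<^bsub>with_proj G\<^esub> y}"
      show "nbrs G x \<subseteq> {y \<in> pverts G. u \<rightarrow>\<^sup>*\<^bsub>with_proj G\<^esub> y}"
      proof
        fix y assume "y \<in> nbrs G x"
        then have xy: "(x, y) \<in> parcs G" by (simp add: nbrs_def)
        then have "u \<rightarrow>\<^sup>*\<^bsub>with_proj G\<^esub> y" using x reachable_adj_trans[of u x y] by simp
        then show "y \<in> {y \<in> pverts G. u \<rightarrow>\<^sup>*\<^bsub>with_proj G\<^esub> y}" using xy sub by auto
      qed
    qed auto
    then show "u \<rightarrow>\<^sup>*\<^bsub>with_proj G\<^esub> v" using v by blast
  qed
  then have "Digraph_Component.connected (with_proj G)"
    using pair_sym_arcs by (simp add: connected_def strongly_connected_def reachable_mk_symmetric_eq)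
  then show ?thesis using card pair_graph_axioms by (simp add: graphs_def)
qed

text \<open>A bound on the supremum in \<open>family_gap\<close> needs a nonempty family. The
  infinite vertex type has room for a complete graph on \<open>d + 1\<close> vertices.\<close>

lemma complete_graph_in_graphs_eq:
  assumes d: "d \<ge> 2"
  shows "\<exists>G :: 'a::infinite pair_pre_digraph. G \<in> graphs_eq d"
proof -
  obtain V :: "'a set" where V: "finite V" "card V = d + 1"
    using infinite_arbitrarily_large[OF infinite_UNIV] by blast
  define G where "G = \<lparr>pverts = V, parcs = {(x, y). x \<in> V \<and> y \<in> V \<and> x \<noteq> y}\<rparr>"
  have N: "nbrs G v = V - {v}" if "v \<in> V" for v using that by (auto simp: nbrs_def G_def)
  have "G \<in> graphs"
  proof (rule graphsI)
    fix S assume S: "S \<subseteq> pverts G" "S \<noteq> {}" "\<And>x. x \<in> S \<Longrightarrow> nbrs G x \<subseteq> S"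
    then obtain x where x: "x \<in> S" by blast
    then have "V - {x} \<subseteq> S" using S N[of x] by (auto simp: G_def)
    then show "S = pverts G" using x S by (auto simp: G_def)
  qed (use V d in \<open>auto simp: G_def\<close>)
  moreover have "out_degree (with_proj G) v = d" if "v \<in> pverts G" for v
    using that V N by (simp add: out_degree_eq_card_nbrs G_def)
  ultimately show ?thesis by (auto simp: graphs_eq_def)
qed

section \<open>Isomorphic copies of graphs and planes\<close>

lemma digraph_iso_pairI:
  assumes sub: "parcs H \<subseteq> pverts H \<times> pverts H" and inj: "inj_on h (pverts H)"
    and V: "pverts G = h ` pverts H" and E: "parcs G = map_prod h h ` parcs H"
  shows "digraph_iso (with_proj H) (with_proj G)"
proof -
  define f where "f = \<lparr>iso_verts = h, iso_arcs = map_prod h h, iso_head = snd, iso_tail = fst\<rparr>"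
  have "inj_on (map_prod h h) (parcs H)"
    using map_prod_inj_on[OF inj inj] sub by (rule inj_on_subset)
  moreover have "wf_digraph (with_proj H)" using sub by unfold_locales auto
  ultimately have "pre_digraph.digraph_isomorphism (with_proj H) f"
    using inj by (simp add: pre_digraph.digraph_isomorphism_def f_def)
  moreover have "with_proj G = app_iso f (with_proj H)"
    by (simp add: app_iso_def f_def with_proj_def V E)
  ultimately show ?thesis unfolding digraph_iso_def by blast
qed

text \<open>An isomorphism has separate maps for vertices and arcs. Equality with
  \<open>with_proj G\<close> makes the new tail and head the projections, so the vertex map
  determines the arc map.\<close>

lemma digraph_iso_pairD:
  assumes "digraph_iso (with_proj H) (with_proj G)"
  obtains h where "inj_on h (pverts H)" "pverts G = h ` pverts H" "parcs G = map_prod h h ` parcs H"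
proof -
  obtain f where f: "pre_digraph.digraph_isomorphism (with_proj H) f" "with_proj G = app_iso f (with_proj H)"
    using assms unfolding digraph_iso_def by blast
  have eqs: "pverts G = iso_verts f ` pverts H" "parcs G = iso_arcs f ` parcs H" "fst = iso_tail f" "snd = iso_head f"
    using f(2) by (simp_all add: app_iso_def with_proj_def)
  have hom: "inj_on (iso_verts f) (pverts H)" "\<And>a. a \<in> parcs H \<Longrightarrow>
      iso_verts f (fst a) = iso_tail f (iso_arcs f a) \<and> iso_verts f (snd a) = iso_head f (iso_arcs f a)"
    using f(1) by (auto simp: pre_digraph.digraph_isomorphism_def)
  have "iso_arcs f a = map_prod (iso_verts f) (iso_verts f) a" if "a \<in> parcs H" for a
    using hom(2)[OF that] unfolding eqs(3,4)[symmetric] by (metis fst_map_prod prod.collapse snd_map_prod prod_eq_iff)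
  then have "parcs G = map_prod (iso_verts f) (iso_verts f) ` parcs H" unfolding eqs(2) by (intro image_cong) auto
  then show ?thesis using that hom(1) eqs(1) by blast
qed

lemma bij_betw_ex1:
  assumes "bij_betw f A B" "\<exists>!b. b \<in> B \<and> Q b"
  shows "\<exists>!a. a \<in> A \<and> Q (f a)"
proof -
  obtain b where b: "b \<in> B" "Q b" "\<And>b'. b' \<in> B \<Longrightarrow> Q b' \<Longrightarrow> b' = b" using assms(2) by blast
  obtain a where a: "a \<in> A" "f a = b" using assms(1) b(1) by (auto simp: bij_betw_def)
  have inj: "inj_on f A" using assms(1) by (simp add: bij_betw_def)
  show ?thesis
  proof (rule ex1I[of _ a])
    show "a \<in> A \<and> Q (f a)" using a b(2) by simp
    fix a' assume a': "a' \<in> A \<and> Q (f a')"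
    then have "f a' = b" using b(3) bij_betwE[OF assms(1)] by blast
    then show "a' = a" using a a' inj by (auto dest: inj_onD)
  qed
qed

lemma projective_plane_transport:
  assumes plane: "projective_plane n P L I" and al: "bij_betw al P' P" and be: "bij_betw be L' L"
    and I': "\<And>p l. p \<in> P' \<Longrightarrow> l \<in> L' \<Longrightarrow> I' p l \<longleftrightarrow> I (al p) (be l)"
  shows "projective_plane n P' L' I'"
proof -
  interpret proj_plane n P L I by unfold_locales (rule plane)
  have alP: "al p \<in> P" if "p \<in> P'" for p using bij_betwE[OF al] that by blast
  have beL: "be l \<in> L" if "l \<in> L'" for l using bij_betwE[OF be] that by blast
  have inj: "inj_on al P'" "inj_on be L'" using al be by (auto simp: bij_betw_def)
  obtain Q where Q: "Q \<subseteq> P" "card Q = 4" "\<And>T. T \<subseteq> Q \<Longrightarrow> card T = 3 \<Longrightarrow> \<not> (\<exists>l \<in> L. \<forall>p \<in> T. I p l)"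
    using plane unfolding projective_plane_def by (elim conjE exE) blast
  define Q' where "Q' = {p \<in> P'. al p \<in> Q}"
  have imQ: "al ` Q' = Q" using Q(1) al unfolding Q'_def bij_betw_def by blast
  have injQ: "inj_on al Q'" using inj(1) by (rule inj_on_subset) (auto simp: Q'_def)
  show ?thesis
    unfolding projective_plane_def
  proof (intro conjI ballI impI)
    show "n \<ge> 2" by (rule order_ge)
    show "finite P'" "finite L'" using finite_P finite_L bij_betw_finite[OF al] bij_betw_finite[OF be] by auto
    show "\<exists>!l. l \<in> L' \<and> I' p l \<and> I' q l" if pq: "p \<in> P'" "q \<in> P'" "p \<noteq> q" for p q
    proof -
      have "al p \<noteq> al q" using pq inj(1) by (auto dest: inj_onD)
      then have "\<exists>!l. l \<in> L \<and> (I (al p) l \<and> I (al q) l)" using unique_join alP pq by blast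
      from bij_betw_ex1[OF be this] show ?thesis using I' pq by (metis (no_types, lifting))
    qed
    show "\<exists>!p. p \<in> P' \<and> I' p l \<and> I' p m" if lm: "l \<in> L'" "m \<in> L'" "l \<noteq> m" for l m
    proof -
      have "be l \<noteq> be m" using lm inj(2) by (auto dest: inj_onD)
      then have "\<exists>!p. p \<in> P \<and> (I p (be l) \<and> I p (be m))" using unique_meet beL lm by blast
      from bij_betw_ex1[OF al this] show ?thesis using I' lm by (metis (no_types, lifting))
    qed
    have "\<not> (\<exists>l \<in> L'. \<forall>p \<in> T. I' p l)" if T: "T \<subseteq> Q'" "card T = 3" for T
    proof
      assume "\<exists>l \<in> L'. \<forall>p \<in> T. I' p l"
      then obtain l where l: "l \<in> L'" "\<forall>p \<in> T. I' p l" by blast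
      have "\<forall>p \<in> al ` T. I p (be l)" using l T I' by (auto simp: Q'_def)
      moreover have "al ` T \<subseteq> Q" using T imQ by blast
      moreover have "card (al ` T) = 3" using T injQ by (subst card_image) (auto intro: inj_on_subset)
      ultimately show False using Q(3) beL[OF l(1)] by blast
    qed
    moreover have "card Q' = 4" using Q(2) imQ card_image[OF injQ] by simp
    ultimately show "\<exists>Q \<subseteq> P'. card Q = 4 \<and> (\<forall>T \<subseteq> Q. card T = 3 \<longrightarrow> \<not> (\<exists>l \<in> L'. \<forall>p \<in> T. I' p l))"
      by (intro exI[of _ Q']) (auto simp: Q'_def)
    obtain m where m: "m \<in> L" "card {p \<in> P. I p m} = n + 1"
      using plane unfolding projective_plane_def by (elim conjE bexE)
    obtain l where l: "l \<in> L'" "be l = m" using be m(1) by (auto simp: bij_betw_def)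
    have "al ` {p \<in> P'. I' p l} = {p \<in> P. I p m}"
      using I'[OF _ l(1)] l(2) al unfolding bij_betw_def by blast
    then have "card {p \<in> P'. I' p l} = n + 1"
      using m(2) card_image[of al "{p \<in> P'. I' p l}"] inj(1) inj_on_subset[of al P' "{p \<in> P'. I' p l}"] by auto
    then show "\<exists>l \<in> L'. card {p \<in> P'. I' p l} = n + 1" using l by blast
  qed
qed

lemma incidence_graph_parcs_subset:
  "parcs (incidence_graph P L I) \<subseteq> pverts (incidence_graph P L I) \<times> pverts (incidence_graph P L I)"
  by (auto simp: incidence_graph_def)

lemma plane_graph_imp_incidence_graph:
  assumes X: "plane_graph d G X" and d: "d \<ge> 3"
  shows "G \<in> incidence_graphs (d - 1)"
proof -
  let ?V = "pverts G"
  have XV: "X \<subseteq> ?V" and NX: "\<And>x. x \<in> X \<Longrightarrow> nbrs G x \<subseteq> ?V - X" and NY: "\<And>y. y \<in> ?V - X \<Longrightarrow> nbrs G y \<subseteq> X"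
    and G': "G \<in> graphs"
    using X unfolding plane_graph_def graphs_eq_def by blast+
  define e where "e = from_nat_into ?V"
  define n where "n = card ?V"
  have e: "bij_betw e {0..<n} ?V" unfolding e_def n_def by (rule enum_bij[OF graphs_finite[OF G']])
  \<comment> \<open>The vertex numbers give the plane on natural numbers that
    \<open>incidence_graphs\<close> asks for; points and lines receive disjoint sets of
    numbers.\<close>
  define P where "P = {i \<in> {0..<n}. e i \<in> X}"
  define L where "L = {i \<in> {0..<n}. e i \<in> ?V - X}"
  define I where "I i j \<longleftrightarrow> (e i, e j) \<in> parcs G" for i j
  have img: "e ` {0..<n} = ?V" using e by (simp add: bij_betw_def)
  have pre: "e ` {i \<in> {0..<n}. e i \<in> Z} = Z" if "Z \<subseteq> ?V" for Z
    using that unfolding img[symmetric] by blast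
  have imP: "e ` P = X" unfolding P_def using XV by (rule pre)
  have imL: "e ` L = ?V - X" unfolding L_def by (rule pre) blast
  have inje: "inj_on e {0..<n}" using e by (simp add: bij_betw_def)
  have bP: "bij_betw e P X" and bL: "bij_betw e L (?V - X)"
    using imP imL inje by (auto simp: bij_betw_def P_def L_def intro: inj_on_subset)
  have plane: "projective_plane (d - 1) P L I"
    by (rule projective_plane_transport[OF projective_plane_of_plane_graph[OF X d] bP bL]) (simp add: I_def)
  define H where "H = incidence_graph P L I"
  define h where "h = case_sum e e"
  have "digraph_iso (with_proj H) (with_proj G)"
  proof (rule digraph_iso_pairI)
    show "parcs H \<subseteq> pverts H \<times> pverts H" unfolding H_def by (rule incidence_graph_parcs_subset)
    have ne: "e i \<noteq> e j" if "i \<in> P" "j \<in> L" for i j using that by (auto simp: P_def L_def)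
    have injP: "inj_on e P" and injL: "inj_on e L" using bP bL by (simp_all add: bij_betw_def)
    show "inj_on h (pverts H)"
    proof (rule inj_onI)
      fix a b assume "a \<in> pverts H" "b \<in> pverts H" "h a = h b"
      then show "a = b"
        using inj_onD[OF injP] inj_onD[OF injL] ne
        by (cases a; cases b) (simp_all add: H_def incidence_graph_def h_def Plus_def image_iff, metis)
    qed
    have "h ` pverts H = e ` P \<union> e ` L"
      by (simp add: H_def incidence_graph_def Plus_def h_def image_Un image_image)
    then show "pverts G = h ` pverts H" using imP imL XV by auto
    have "parcs G = {(x, y). x \<in> X \<and> y \<in> ?V - X \<and> (x, y) \<in> parcs G} \<union> {(y, x). x \<in> X \<and> y \<in> ?V - X \<and> (x, y) \<in> parcs G}"
      (is "_ = ?A \<union> ?B")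
    proof (intro equalityI subsetI)
      fix a assume a: "a \<in> parcs G"
      obtain x y where xy: "a = (x, y)" by (cases a)
      have yx: "y \<in> nbrs G x" "x \<in> nbrs G y" using a xy graphs_nbrs_sym[OF G', of y x] by (auto simp: nbrs_def)
      then have xV: "x \<in> ?V" using graphs_nbrs_subset[OF G'] by blast
      show "a \<in> ?A \<union> ?B"
      proof (cases "x \<in> X")
        case True
        then show ?thesis using NX yx a xy by auto
      next
        case False
        then have "y \<in> X" using NY[of x] xV yx by auto
        then show ?thesis using yx xV False xy by (auto simp: nbrs_def)
      qed
    next
      fix a assume "a \<in> ?A \<union> ?B"
      then show "a \<in> parcs G" using graphs_nbrs_sym[OF G'] by (auto simp: nbrs_def)
    qed
    also have "?A = map_prod h h ` {(Inl p, Inr l) | p l. p \<in> P \<and> l \<in> L \<and> I p l}" (is "_ = map_prod h h ` ?A'")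
    proof (intro equalityI subsetI)
      fix a assume "a \<in> ?A"
      then obtain x y where xy: "a = (x, y)" "x \<in> X" "y \<in> ?V - X" "(x, y) \<in> parcs G" by blast
      obtain p l where "p \<in> P" "x = e p" "l \<in> L" "y = e l" using xy(2,3) imP imL by blast
      then show "a \<in> map_prod h h ` ?A'"
        using xy by (intro image_eqI[of _ _ "(Inl p, Inr l)"]) (auto simp: h_def I_def)
    next
      fix a assume "a \<in> map_prod h h ` ?A'"
      then obtain p l where "p \<in> P" "l \<in> L" "I p l" "a = (e p, e l)" by (auto simp: h_def)
      then show "a \<in> ?A" by (auto simp: P_def L_def I_def)
    qed
    also have "?B = map_prod h h ` {(Inr l, Inl p) | p l. p \<in> P \<and> l \<in> L \<and> I p l}" (is "_ = map_prod h h ` ?B'")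
    proof (intro equalityI subsetI)
      fix a assume "a \<in> ?B"
      then obtain x y where xy: "a = (y, x)" "x \<in> X" "y \<in> ?V - X" "(x, y) \<in> parcs G" by blast
      obtain p l where "p \<in> P" "x = e p" "l \<in> L" "y = e l" using xy(2,3) imP imL by blast
      then show "a \<in> map_prod h h ` ?B'"
        using xy by (intro image_eqI[of _ _ "(Inr l, Inl p)"]) (auto simp: h_def I_def)
    next
      fix a assume "a \<in> map_prod h h ` ?B'"
      then obtain p l where "p \<in> P" "l \<in> L" "I p l" "a = (e l, e p)" by (auto simp: h_def)
      then show "a \<in> ?B" by (auto simp: P_def L_def I_def)
    qed
    finally show "parcs G = map_prod h h ` parcs H"
      by (simp add: H_def incidence_graph_def image_Un)
  qed
  then show ?thesis using plane unfolding incidence_graphs_def H_def by blast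
qed

lemma incidence_graph_plane_graph:
  assumes plane: "projective_plane (d - 1) P L I" and d: "d \<ge> 3"
  shows "plane_graph d (incidence_graph P L I) (Inl ` P)"
proof -
  interpret proj_plane "d - 1" P L I by unfold_locales (rule plane)
  define H where "H = incidence_graph P L I"
  have V: "pverts H = Inl ` P \<union> Inr ` L" by (auto simp: H_def incidence_graph_def)
  have Y: "pverts H - Inl ` P = Inr ` L" by (auto simp: V)
  have Np: "nbrs H (Inl p) = Inr ` {l \<in> L. I p l}" if "p \<in> P" for p
    using that by (auto simp: H_def incidence_graph_def nbrs_def)
  have Nl: "nbrs H (Inr l) = Inl ` {p \<in> P. I p l}" if "l \<in> L" for l
    using that by (auto simp: H_def incidence_graph_def nbrs_def)
  have cp: "card (nbrs H (Inl p)) = d" if "p \<in> P" for p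
    using point_card[OF that] d by (simp add: Np[OF that] card_image)
  have cl: "card (nbrs H (Inr l)) = d" if "l \<in> L" for l
    using line_card[OF that] d by (simp add: Nl[OF that] card_image)
  have "H \<in> graphs"
  proof (rule graphsI)
    show "finite (pverts H)" using finite_P finite_L by (simp add: V)
    show "parcs H \<subseteq> pverts H \<times> pverts H" unfolding H_def by (rule incidence_graph_parcs_subset)
    show "(y, x) \<in> parcs H" if "(x, y) \<in> parcs H" for x y using that by (auto simp: H_def incidence_graph_def)
    show "(x, x) \<notin> parcs H" for x by (auto simp: H_def incidence_graph_def)
    obtain l where l: "l \<in> L" using plane unfolding projective_plane_def by (elim conjE bexE)
    have "card (nbrs H (Inr l)) \<le> card (pverts H)"
      by (rule card_mono) (use finite_P finite_L Nl[OF l] in \<open>auto simp: V\<close>)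
    then show "3 \<le> card (pverts H)" using cl[OF l] d by simp
    fix S assume S: "S \<subseteq> pverts H" "S \<noteq> {}" "\<And>x. x \<in> S \<Longrightarrow> nbrs H x \<subseteq> S"
    \<comment> \<open>A nonempty closed set contains a point, then every point by a joining line,
      then every line because no line is empty.\<close>
    have "\<exists>p. p \<in> P \<and> Inl p \<in> S"
    proof -
      obtain x where x: "x \<in> S" using S by blast
      show ?thesis
      proof (cases x)
        case (Inl p)
        then show ?thesis using x S(1) V by auto
      next
        case (Inr l)
        then have l: "l \<in> L" using x S(1) V by auto
        have "nbrs H (Inr l) \<noteq> {}" using cl[OF l] d by auto
        then show ?thesis using Nl[OF l] S(3)[OF x] Inr by auto
      qed
    qed
    then obtain p where p: "p \<in> P" "Inl p \<in> S" by blast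
    have points: "Inl q \<in> S" if q: "q \<in> P" for q
    proof (cases "q = p")
      case False
      then obtain l where l: "l \<in> L" "I p l" "I q l" using join[OF p(1) q] by auto
      then have "Inr l \<in> S" using S(3)[OF p(2)] Np[OF p(1)] by auto
      then show ?thesis using S(3)[of "Inr l"] Nl[OF l(1)] l q by auto
    qed (use p in simp)
    have lines: "Inr l \<in> S" if l: "l \<in> L" for l
    proof -
      have "card {p \<in> P. I p l} \<noteq> 0" using line_card[OF l] by simp
      then have "{p \<in> P. I p l} \<noteq> {}" by (metis card.empty)
      then obtain q where q: "q \<in> P" "I q l" by blast
      then show ?thesis using S(3)[OF points[OF q(1)]] Np[OF q(1)] l by auto
    qed
    show "S = pverts H" using S(1) points lines V by auto
  qed
  then have "H \<in> graphs_eq d"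
    using cp cl by (auto simp: graphs_eq_def out_degree_eq_card_nbrs V)
  moreover have "card (nbrs H x \<inter> nbrs H x') = 1" if x: "x \<in> Inl ` P" "x' \<in> Inl ` P" "x \<noteq> x'" for x x'
  proof -
    obtain p q where pq: "p \<in> P" "q \<in> P" "x = Inl p" "x' = Inl q" "p \<noteq> q" using x by auto
    obtain l where "\<And>m. m \<in> L \<and> I p m \<and> I q m \<longleftrightarrow> m = l" using unique_join[OF pq(1,2,5)] by (metis (no_types, lifting))
    then have "nbrs H x \<inter> nbrs H x' = {Inr l}" unfolding pq Np[OF pq(1)] Np[OF pq(2)] by auto
    then show ?thesis by simp
  qed
  moreover have "card (nbrs H x \<inter> nbrs H x') = 1" if x: "x \<in> Inr ` L" "x' \<in> Inr ` L" "x \<noteq> x'" for x x'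
  proof -
    obtain l m where lm: "l \<in> L" "m \<in> L" "x = Inr l" "x' = Inr m" "l \<noteq> m" using x by auto
    obtain p where "\<And>q. q \<in> P \<and> I q l \<and> I q m \<longleftrightarrow> q = p" using unique_meet[OF lm(1,2,5)] by (metis (no_types, lifting))
    then have "nbrs H x \<inter> nbrs H x' = {Inl p}" unfolding lm Nl[OF lm(1)] Nl[OF lm(2)] by auto
    then show ?thesis by simp
  qed
  ultimately show ?thesis
    unfolding plane_graph_def H_def[symmetric] Y using Np Nl V by auto
qed

lemma plane_graph_image:
  assumes X: "plane_graph d H X" and inj: "inj_on h (pverts H)"
    and V: "pverts G = h ` pverts H" and E: "parcs G = map_prod h h ` parcs H"
  shows "plane_graph d G (h ` X)"
proof -
  have XV: "X \<subseteq> pverts H" and NX: "\<And>x. x \<in> X \<Longrightarrow> nbrs H x \<subseteq> pverts H - X"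
    and NY: "\<And>y. y \<in> pverts H - X \<Longrightarrow> nbrs H y \<subseteq> X" and H: "H \<in> graphs_eq d"
    and oneX: "\<And>x x'. x \<in> X \<Longrightarrow> x' \<in> X \<Longrightarrow> x \<noteq> x' \<Longrightarrow> card (nbrs H x \<inter> nbrs H x') = 1"
    and oneY: "\<And>x x'. x \<in> pverts H - X \<Longrightarrow> x' \<in> pverts H - X \<Longrightarrow> x \<noteq> x' \<Longrightarrow> card (nbrs H x \<inter> nbrs H x') = 1"
    using X unfolding plane_graph_def by blast+
  have H': "H \<in> graphs" using H by (simp add: graphs_eq_def)
  note Hsub = graphs_nbrs_subset[OF H']
  have Harc: "x \<in> pverts H" "y \<in> pverts H" if "(x, y) \<in> parcs H" for x y
    using that Hsub[of x] Hsub[of y] graphs_nbrs_sym[OF H', of y x] by (auto simp: nbrs_def)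
  have N: "nbrs G (h v) = h ` nbrs H v" if v: "v \<in> pverts H" for v
  proof (intro equalityI subsetI)
    fix u assume "u \<in> nbrs G (h v)"
    then obtain a b where ab: "(a, b) \<in> parcs H" "h a = h v" "h b = u" by (auto simp: nbrs_def E)
    then have "a = v" using inj Harc v by (auto dest: inj_onD)
    then show "u \<in> h ` nbrs H v" using ab by (auto simp: nbrs_def)
  next
    fix u assume "u \<in> h ` nbrs H v"
    then show "u \<in> nbrs G (h v)" by (force simp: nbrs_def E)
  qed
  have injN: "inj_on h (nbrs H v)" for v using inj Hsub by (rule inj_on_subset)
  have Y: "pverts G - h ` X = h ` (pverts H - X)"
    unfolding V using inj XV by (simp add: inj_on_image_set_diff[OF inj])
  have int: "nbrs G (h x) \<inter> nbrs G (h y) = h ` (nbrs H x \<inter> nbrs H y)" if "x \<in> pverts H" "y \<in> pverts H" for x y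
    unfolding N[OF that(1)] N[OF that(2)] by (rule inj_on_image_Int[OF inj, symmetric]) (use Hsub in auto)
  have card_int: "card (nbrs G (h x) \<inter> nbrs G (h y)) = card (nbrs H x \<inter> nbrs H y)" if "x \<in> pverts H" "y \<in> pverts H" for x y
    unfolding int[OF that] by (rule card_image) (rule inj_on_subset[OF injN[of x]], blast)
  have "G \<in> graphs"
  proof (rule graphsI)
    show "finite (pverts G)" using graphs_finite[OF H'] by (simp add: V)
    show "parcs G \<subseteq> pverts G \<times> pverts G" using Harc by (auto simp: V E)
    show "(y, x) \<in> parcs G" if xy: "(x, y) \<in> parcs G" for x y
    proof -
      obtain a b where ab: "(a, b) \<in> parcs H" "x = h a" "y = h b" using xy by (auto simp: E)
      then have "(b, a) \<in> parcs H" using graphs_nbrs_sym[OF H', of b a] by (auto simp: nbrs_def)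
      then show ?thesis using ab by (force simp: E)
    qed
    show "(x, x) \<notin> parcs G" for x
    proof
      assume "(x, x) \<in> parcs G"
      then obtain a b where ab: "(a, b) \<in> parcs H" "h a = h b" by (auto simp: E)
      then have "a = b" using inj Harc by (auto dest: inj_onD)
      then show False using ab graphs_nbrs_irrefl[OF H', of a] by (auto simp: nbrs_def)
    qed
    show "3 \<le> card (pverts G)" using H' by (simp add: V card_image[OF inj] graphs_def)
    fix S assume S: "S \<subseteq> pverts G" "S \<noteq> {}" "\<And>x. x \<in> S \<Longrightarrow> nbrs G x \<subseteq> S"
    have "{v \<in> pverts H. h v \<in> S} = pverts H"
    proof (rule graphs_closed_set[OF H'])
      show "{v \<in> pverts H. h v \<in> S} \<noteq> {}" using S(1,2) V by auto
      show "nbrs H v \<subseteq> {v \<in> pverts H. h v \<in> S}" if "v \<in> {v \<in> pverts H. h v \<in> S}" for v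
        using that S(3)[of "h v"] N[of v] Hsub by auto
    qed auto
    then have "h ` pverts H \<subseteq> S" by blast
    then show "S = pverts G" using S(1) by (simp add: V)
  qed
  moreover have "card (nbrs G (h v)) = d" if "v \<in> pverts H" for v
    using graphs_eq_card_nbrs[OF H that] by (simp add: N[OF that] card_image[OF injN])
  ultimately have reg: "G \<in> graphs_eq d" by (auto simp: graphs_eq_def out_degree_eq_card_nbrs V)
  have sub: "h ` X \<subseteq> pverts G" using XV V by auto
  have NX': "nbrs G x \<subseteq> h ` (pverts H - X)" if x: "x \<in> h ` X" for x
    using x NX N XV by blast
  have NY': "nbrs G y \<subseteq> h ` X" if y: "y \<in> h ` (pverts H - X)" for y
    using y NY N by blast
  have oneX': "card (nbrs G x \<inter> nbrs G x') = 1" if x: "x \<in> h ` X" "x' \<in> h ` X" "x \<noteq> x'" for x x'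
  proof -
    obtain a a' where a: "a \<in> X" "a' \<in> X" "x = h a" "x' = h a'" using x by blast
    then have "a \<noteq> a'" "a \<in> pverts H" "a' \<in> pverts H" using x XV by auto
    then show ?thesis using card_int[of a a'] oneX[of a a'] a by simp
  qed
  have oneY': "card (nbrs G x \<inter> nbrs G x') = 1" if x: "x \<in> h ` (pverts H - X)" "x' \<in> h ` (pverts H - X)" "x \<noteq> x'" for x x'
  proof -
    obtain a a' where a: "a \<in> pverts H - X" "a' \<in> pverts H - X" "x = h a" "x' = h a'" using x by blast
    then have "a \<noteq> a'" using x by auto
    then show ?thesis using card_int[of a a'] oneY[of a a'] a by simp
  qed
  show ?thesis
    unfolding plane_graph_def Y
    by (intro conjI ballI impI reg sub NX' NY' oneX' oneY'; assumption)
qed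

lemma incidence_graphs_iff:
  assumes d: "d \<ge> 3"
  shows "G \<in> incidence_graphs (d - 1) \<longleftrightarrow> (\<exists>X. plane_graph d G X)"
proof
  assume "G \<in> incidence_graphs (d - 1)"
  then obtain P L :: "nat set" and I where
    P: "projective_plane (d - 1) P L I" "digraph_iso (with_proj (incidence_graph P L I)) (with_proj G)"
    unfolding incidence_graphs_def by blast
  obtain h where "inj_on h (pverts (incidence_graph P L I))" "pverts G = h ` pverts (incidence_graph P L I)"
    "parcs G = map_prod h h ` parcs (incidence_graph P L I)"
    by (rule digraph_iso_pairD[OF P(2)])
  then show "\<exists>X. plane_graph d G X"
    using plane_graph_image[OF incidence_graph_plane_graph[OF P(1) d]] by blast
next
  assume "\<exists>X. plane_graph d G X"
  then show "G \<in> incidence_graphs (d - 1)" using plane_graph_imp_incidence_graph d by blast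
qed

text \<open>The incidence graph lives on \<open>nat + nat\<close>; an injection into the infinite
  type yields a copy with the required vertices.\<close>

lemma incidence_graphs_nonempty:
  assumes "projective_plane_exists n"
  shows "\<exists>G :: 'a::infinite pair_pre_digraph. G \<in> incidence_graphs n"
proof -
  obtain P L :: "nat set" and I where P: "projective_plane n P L I"
    using assms unfolding projective_plane_exists_def by blast
  obtain f :: "nat \<Rightarrow> 'a" where f: "inj f"
    using infinite_countable_subset[OF infinite_UNIV] by blast
  define H where "H = incidence_graph P L I"
  define h where "h = f \<circ> sum_encode"
  have "inj h" unfolding h_def by (rule inj_compose[OF f inj_sum_encode])
  then have inj: "inj_on h (pverts H)" by (rule inj_on_subset) simp
  define G where "G = \<lparr>pverts = h ` pverts H, parcs = map_prod h h ` parcs H\<rparr>"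
  have "digraph_iso (with_proj H) (with_proj G)"
    by (rule digraph_iso_pairI[OF _ inj]) (simp_all add: G_def H_def incidence_graph_parcs_subset)
  then show ?thesis using P unfolding incidence_graphs_def H_def by blast
qed

lemma incidence_graphs_empty: "\<not> projective_plane_exists n \<Longrightarrow> incidence_graphs n = {}"
  by (auto simp: incidence_graphs_def projective_plane_exists_def)

theorem theorem2p3:
  fixes d :: nat
  assumes "d \<ge> 3"
  shows
    "(projective_plane_exists (d - 1) \<longrightarrow>
        family_gap (graphs_eq d :: 'a::infinite pair_pre_digraph set) = sqrt (real d - 1) / real d \<and>
        family_gap (graphs_ge d :: 'a pair_pre_digraph set) = sqrt (real d - 1) / real d \<and>
        {G \<in> graphs_ge d :: 'a pair_pre_digraph set.
           gap G = family_gap (graphs_ge d :: 'a pair_pre_digraph set)} = incidence_graphs (d - 1) \<and>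
        {G \<in> graphs_eq d :: 'a pair_pre_digraph set.
           gap G = family_gap (graphs_eq d :: 'a pair_pre_digraph set)} = incidence_graphs (d - 1))
     \<and>
     (\<forall>G \<in> graphs_eq d :: 'a pair_pre_digraph set.
        G \<notin> incidence_graphs (d - 1) \<longrightarrow> gap G \<le> sqrt (real d - 2) / real d)
     \<and>
     (\<not> projective_plane_exists (d - 1) \<longrightarrow>
        (\<forall>G \<in> graphs_ge d :: 'a pair_pre_digraph set. gap G < sqrt (real d - 1) / real d) \<and>
        family_gap (graphs_eq d :: 'a pair_pre_digraph set) \<le> sqrt (real d - 2) / real d)"
proof -
  define c1 where "c1 = sqrt (real d - 1) / real d"
  define c2 where "c2 = sqrt (real d - 2) / real d"
  have c12: "c2 < c1" unfolding c1_def c2_def using assms by (intro divide_strict_right_mono) auto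
  have inc: "G \<in> graphs_eq d \<and> gap G = c1" if G: "G \<in> incidence_graphs (d - 1)" for G :: "'a pair_pre_digraph"
  proof -
    obtain X where X: "plane_graph d G X" using G unfolding incidence_graphs_iff[OF assms] by blast
    then show ?thesis using plane_graph_gap[OF X assms] by (simp add: c1_def plane_graph_def)
  qed
  have non: "gap G \<le> c2" if "G \<in> graphs_eq d" "G \<notin> incidence_graphs (d - 1)" for G :: "'a pair_pre_digraph"
  proof (rule ccontr)
    assume "\<not> gap G \<le> c2"
    then have "\<exists>X. plane_graph d G X" using that(1) assms by (intro plane_graph_of_gap) (simp_all add: c2_def)
    then show False using that(2) unfolding incidence_graphs_iff[OF assms] by simp
  qed
  have reg: "G \<in> graphs_eq d" if "G \<in> graphs_ge d" "gap G \<ge> c1" for G :: "'a pair_pre_digraph"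
    using gap_ge_imp_regular[OF that(1) assms] that(2) by (simp add: c1_def)
  have le: "gap G \<le> c1" if "G \<in> graphs_ge d" for G :: "'a pair_pre_digraph"
    using gap_le_of_min_degree[OF that assms] by (simp add: c1_def)
  \<comment> \<open>Attaining \<open>c1\<close> forces regularity by \<open>reg\<close>; as
    \<open>c1\<close> exceeds \<open>c2\<close>, the bound \<open>non\<close> then leaves only
    incidence graphs.\<close>
  have extremal: "G \<in> graphs_ge d \<and> gap G = c1 \<longleftrightarrow> G \<in> incidence_graphs (d - 1)" for G :: "'a pair_pre_digraph"
    using inc[of G] reg[of G] non[of G] graphs_eq_subset_ge[of G d] c12 by fastforce
  have 1: "family_gap (graphs_eq d :: 'a pair_pre_digraph set) = c1 \<and>
    family_gap (graphs_ge d :: 'a pair_pre_digraph set) = c1" if ex: "projective_plane_exists (d - 1)"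
  proof -
    obtain G :: "'a pair_pre_digraph" where G: "G \<in> incidence_graphs (d - 1)"
      using incidence_graphs_nonempty[OF ex] by blast
    have G': "G \<in> graphs_eq d" "G \<in> graphs_ge d" "gap G = c1"
      using inc[OF G] graphs_eq_subset_ge by blast+
    \<comment> \<open>An incidence graph belongs to both families and attains \<open>c1\<close>, so
      one argument covers both suprema.\<close>
    have "(SUP G \<in> F. gap G) = c1" if F: "F \<subseteq> graphs_ge d" "G \<in> F" for F
    proof (rule cSup_eq_maximum)
      show "c1 \<in> gap ` F" using F G' by force
      show "x \<le> c1" if "x \<in> gap ` F" for x using that F le by blast
    qed
    then show ?thesis unfolding family_gap_def using G' graphs_eq_subset_ge by blast
  qed
  have 2: "(\<forall>G \<in> graphs_ge d :: 'a pair_pre_digraph set. gap G < c1) \<and>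
    family_gap (graphs_eq d :: 'a pair_pre_digraph set) \<le> c2" if nex: "\<not> projective_plane_exists (d - 1)"
  proof
    have empty: "(incidence_graphs (d - 1) :: 'a pair_pre_digraph set) = {}"
      by (rule incidence_graphs_empty[OF nex])
    show "\<forall>G \<in> graphs_ge d :: 'a pair_pre_digraph set. gap G < c1"
      using le extremal empty by (metis empty_iff order_le_less)
    show "family_gap (graphs_eq d :: 'a pair_pre_digraph set) \<le> c2"
      unfolding family_gap_def
    proof (rule cSUP_least)
      show "(graphs_eq d :: 'a pair_pre_digraph set) \<noteq> {}"
        using complete_graph_in_graphs_eq[of d] assms by auto
      show "gap G \<le> c2" if "G \<in> graphs_eq d" for G :: "'a pair_pre_digraph"
        using non[OF that] empty by simp
    qed
  qed
  have eq: "{G \<in> graphs_eq d :: 'a pair_pre_digraph set. gap G = c1} = incidence_graphs (d - 1)"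
    using extremal inc graphs_eq_subset_ge by blast
  have ge: "{G \<in> graphs_ge d :: 'a pair_pre_digraph set. gap G = c1} = incidence_graphs (d - 1)"
    using extremal by blast
  show ?thesis
    unfolding c1_def[symmetric] c2_def[symmetric] using 1 2 eq ge non by auto
qed

end
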